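(* Let $N\ge 2$, $0\le p\le 1$, $q=1-p$, and let $P_{(Y,\nu)}(X,\pi;t)$ be the transition probability of the $N$-particle multi-species ASEP with long-range jumps on $\mathbb{Z}$ (defined in the context). For each $i=1,\dots,N$ let $C_{R_i}\subset\mathbb{C}$ be the counterclockwise circle centered at the origin with radius $R_i$, where $1<R_1<\cdots<R_N$. Let $\varepsilon(\xi)=\frac{p}{\xi}+q\xi-1$, and let $\mathbf{A}_\sigma$ ($\sigma\in S_N$) be the $N^N\times N^N$ matrices, depending on $\xi_1,\dots,\xi_N$, defined in the context, with $(\pi,\nu)$-element $(\mathbf{A}_\sigma)_{(\pi,\nu)}$. Then for every initial state $(Y,\nu)$ with $Y=(y_1,\dots,y_N)$, every state $(X,\pi)$ with $X=(x_1,\dots,x_N)$, and every $t\ge 0$, $$P_{(Y,\nu)}(X,\pi;t)=\Big(\frac{1}{2\pi \mathrm{i}}\Big)^N\int_{C_{R_N}}\cdots\int_{C_{R_1}}\ \sum_{\sigma\in S_N}\big(\mathbf{A}_\sigma\big)_{(\pi,\nu)}\Big(\prod_{i=1}^N \xi_{\sigma(i)}^{\,x_i-y_{\sigma(i)}-1}\,e^{\varepsilon(\xi_i)t}\Big)\,d\xi_1\cdots d\xi_N .$$ (In the prefactor $2\pi\mathrm{i}$, $\pi$ is the number $3.14\ldots$ and $\mathrm{i}=\sqrt{-1}$; elsewhere $\pi$ is the species word of the final state.)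
   Context: **States.** There are $N$ particles on $\mathbb{Z}$, at most one per site, each labelled by its species in $\{1,\dots,N\}$ (repetitions allowed). A state is a pair $(X,\pi)$ with $X=(x_1,\dots,x_N)\in\mathbb{Z}^N$, $x_1<\cdots<x_N$, the positions, and $\pi=\pi_1\cdots\pi_N\in\{1,\dots,N\}^N$ a word, $\pi_i$ being the species of the particle at $x_i$. An empty site is regarded as a particle of species $0$. **Dynamics (continuous-time Markov chain).** Each particle, independently, waits an exponential time of rate $1$ and then chooses the right direction with probability $p$ or the left direction with probability $q=1-p$; this is then repeated. - Right: a particle of species $l$ at $x$ jumps to the nearest site to its right occupied by some $l'<l$ (including $l'=0$, an empty site); if $l'\geq 1$, the displaced particle $l'$ immediately jumps to the nearest site to its right occupied by some $l''<l'$, and so on, until a particle lands on an empty site. - Left: a particle of species $l$ at $x$, with $x-1$ occupied by $l'$: if $l'<l$ (including $l'=0$), then $l$ moves to $x-1$ and $l'$ moves to $x$; if $l'\ge l$, nothing happens. $P_{(Y,\nu)}(X,\pi;t)$ is the probability that the system is in state $(X,\pi)$ at time $t$ given that it is in state $(Y,\nu)$ at time $0$. **Matrices.** $N^2\times N^2$ matrices have rows and columns indexed by words $ij\in\{1,\dots,N\}^2$, and $N^N\times N^N$ matrices by words in $\{1,\dots,N\}^N$, both ordered lexicographically (so that tensor products are Kronecker products compatible with this indexing). For $\alpha,\beta\in\{1,\dots,N\}$ put $$S_{\beta\alpha}=-\frac{1-1/\xi_\alpha}{1-1/\xi_\beta},\qquad T_{\beta\alpha}=\frac{1/\xi_\alpha-1/\xi_\beta}{1-1/\xi_\beta},$$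 and let $\mathbf{R}_{\beta\alpha}$ be the $N^2\times N^2$ matrix with $$(\mathbf{R}_{\beta\alpha})_{(ij,lm)}=\begin{cases}S_{\beta\alpha}&\text{if } ij=lm,\ i\ge j,\\ -1&\text{if } ij=lm,\ i<j,\\ T_{\beta\alpha}&\text{if } ij=ml,\ i>j,\\ 0&\text{otherwise.}\end{cases}$$ For $1\le l\le N-1$ let $\mathbf{T}_{l,\beta\alpha}=\mathbf{I}^{\otimes(l-1)}\otimes\mathbf{R}_{\beta\alpha}\otimes\mathbf{I}^{\otimes(N-l-1)}$, with $\mathbf{I}$ the $N\times N$ identity matrix. **Permutations and $\mathbf{A}_\sigma$.** A permutation $\sigma\in S_N$ is written as a word $\sigma(1)\cdots\sigma(N)$. $T_l$ denotes the simple transposition acting on such words by exchanging the entries in positions $l$ and $l+1$: $(T_l\sigma)(l)=\sigma(l+1)$, $(T_l\sigma)(l+1)=\sigma(l)$, and $(T_l\sigma)(j)=\sigma(j)$ otherwise. Write $\sigma=T_{l_k}\cdots T_{l_2}T_{l_1}$ (applied successively to the identity word, $T_{l_1}$ first), and set $\sigma^{(0)}=$ identity, $\sigma^{(i)}=T_{l_i}\cdots T_{l_1}$. Then $$\mathbf{A}_\sigma=\mathbf{T}_{l_k,\,\sigma^{(k-1)}(l_k+1)\,\sigma^{(k-1)}(l_k)}\times\cdots\times\mathbf{T}_{l_1,\,\sigma^{(0)}(l_1+1)\,\sigma^{(0)}(l_1)},$$ with $\mathbf{A}_{\mathrm{id}}$ the identity matrix; this does not depend on the chosen expression of $\sigma$.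 *)

theory Defs
  imports
    "HOL-Probability.Probability"
    "HOL-Complex_Analysis.Complex_Analysis"
    "HOL-Combinatorics.Permutations"
begin

section \<open>States and moves\<close>

text \<open>Words are lists, so the paper's \<open>w\<^sub>i\<close> is \<open>w ! (i - 1)\<close>. Positions are functions on
  \<open>{1..N}\<close>.\<close>

definition words :: "nat \<Rightarrow> nat \<Rightarrow> nat list set" where
  "words N n = {w. length w = n \<and> set w \<subseteq> {1..N}}"

definition is_state :: "nat \<Rightarrow> (nat \<Rightarrow> int) \<Rightarrow> nat list \<Rightarrow> bool" where
  "is_state N X w \<longleftrightarrow> strict_mono_on {1..N} X \<and> w \<in> words N N"

text \<open>To let every particle carry its own clock, particles are given names \<open>1, \<dots>, N\<close>. A
  configuration maps a site to the name of the particle there, with \<open>0\<close> for an empty site, and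
  \<open>sp k\<close> is the species of particle \<open>k\<close>, with \<open>sp 0 = 0\<close>.\<close>

type_synonym config = "int \<Rightarrow> nat"

definition site_of :: "config \<Rightarrow> nat \<Rightarrow> int" where
  "site_of c k = (THE x. c x = k)"

definition nearest_right :: "(nat \<Rightarrow> nat) \<Rightarrow> config \<Rightarrow> nat \<Rightarrow> int \<Rightarrow> int" where
  "nearest_right sp c l x = x + int (LEAST d. 0 < d \<and> sp (c (x + int d)) < l)"

text \<open>Particle \<open>k\<close>, already lifted from \<open>x\<close>, lands on its target site; a particle displaced there
  continues in the same way. The bound \<open>< sp k\<close> in the test matters only for termination: it
  always holds when finitely many sites are occupied.\<close>

function push :: "(nat \<Rightarrow> nat) \<Rightarrow> nat \<Rightarrow> int \<Rightarrow> config \<Rightarrow> config" where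
  "push sp k x c =
    (let y = nearest_right sp c (sp k) x; k' = c y; c' = c(y := k)
     in if 1 \<le> sp k' \<and> sp k' < sp k then push sp k' y c' else c')"
  by pat_completeness auto
termination
  by (relation "Wellfounded.measure (\<lambda>(sp, k, x, c). sp k)") auto

declare push.simps [simp del]

definition right_move :: "(nat \<Rightarrow> nat) \<Rightarrow> nat \<Rightarrow> config \<Rightarrow> config" where
  "right_move sp k c = (let x = site_of c k in push sp k x (c(x := 0)))"

definition left_move :: "(nat \<Rightarrow> nat) \<Rightarrow> nat \<Rightarrow> config \<Rightarrow> config" where
  "left_move sp k c =
    (let x = site_of c k; k' = c (x - 1)
     in if sp k' < sp k then c(x - 1 := k, x := k') else c)"

definition species :: "nat list \<Rightarrow> nat \<Rightarrow> nat" where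
  "species w k = (if k = 0 then 0 else w ! (k - 1))"

definition initial_config :: "nat \<Rightarrow> (nat \<Rightarrow> int) \<Rightarrow> config" where
  "initial_config N Y x = (if x \<in> Y ` {1..N} then inv_into {1..N} Y x else 0)"

definition in_state :: "nat \<Rightarrow> (nat \<Rightarrow> nat) \<Rightarrow> config \<Rightarrow> (nat \<Rightarrow> int) \<Rightarrow> nat list \<Rightarrow> bool" where
  "in_state N sp c X w \<longleftrightarrow>
    {x. c x \<noteq> 0} = X ` {1..N} \<and> (\<forall>i\<in>{1..N}. sp (c (X i)) = w ! (i - 1))"

section \<open>The continuous-time dynamics\<close>

text \<open>The coordinate \<open>(k, j)\<close> of a sample point holds the waiting time of particle \<open>k\<close> before its
  \<open>j\<close>-th ring (counted from \<open>0\<close>) and the direction chosen at that ring (\<open>True\<close> for right). All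
  these variables are independent.\<close>

type_synonym sample = "nat \<times> nat \<Rightarrow> real \<times> bool"

definition clocks :: "nat \<Rightarrow> real \<Rightarrow> sample measure" where
  "clocks N p = PiM ({1..N} \<times> UNIV)
    (\<lambda>_. density lborel (exponential_density 1) \<Otimes>\<^sub>M measure_pmf (bernoulli_pmf p))"

definition ring_time :: "sample \<Rightarrow> nat \<times> nat \<Rightarrow> real" where
  "ring_time \<omega> = (\<lambda>(k, j). \<Sum>i\<le>j. fst (\<omega> (k, i)))"

text \<open>The rings up to time \<open>t\<close> in chronological order. Almost surely there are finitely many of them
  and no two are simultaneous, so that exactly one such list exists.\<close>

definition rings :: "nat \<Rightarrow> real \<Rightarrow> sample \<Rightarrow> (nat \<times> nat) list" where
  "rings N t \<omega> = (THE rs. sorted_wrt (<) (map (ring_time \<omega>) rs) \<and>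
    set rs = {r \<in> {1..N} \<times> UNIV. ring_time \<omega> r \<le> t})"

definition config_at ::
  "nat \<Rightarrow> (nat \<Rightarrow> int) \<Rightarrow> nat list \<Rightarrow> real \<Rightarrow> sample \<Rightarrow> config" where
  "config_at N Y v t \<omega> =
    fold (\<lambda>(k, j). if snd (\<omega> (k, j)) then right_move (species v) k else left_move (species v) k)
      (rings N t \<omega>) (initial_config N Y)"

definition transition_prob ::
  "nat \<Rightarrow> real \<Rightarrow> (nat \<Rightarrow> int) \<Rightarrow> nat list \<Rightarrow> (nat \<Rightarrow> int) \<Rightarrow> nat list \<Rightarrow> real \<Rightarrow> real" where
  "transition_prob N p Y v X w t =
    measure (clocks N p)
      {\<omega> \<in> space (clocks N p). in_state N (species v) (config_at N Y v t \<omega>) X w}"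

section \<open>Matrices indexed by words\<close>

type_synonym wmatrix = "nat list \<Rightarrow> nat list \<Rightarrow> complex"

definition id_mat :: wmatrix where
  "id_mat u v = (if u = v then 1 else 0)"

definition mat_mult :: "nat list set \<Rightarrow> wmatrix \<Rightarrow> wmatrix \<Rightarrow> wmatrix" where
  "mat_mult W A B u v = (\<Sum>w\<in>W. A u w * B w v)"

text \<open>Kronecker product; \<open>m\<close> is the length of the words that index the first factor.\<close>

definition tensor :: "nat \<Rightarrow> wmatrix \<Rightarrow> wmatrix \<Rightarrow> wmatrix" where
  "tensor m A B u v = A (take m u) (take m v) * B (drop m u) (drop m v)"

text \<open>Tensor powers of a matrix indexed by words of length \<open>1\<close>; the zeroth power is the
  \<open>1 \<times> 1\<close> identity, indexed by the empty word.\<close>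

primrec tensor_power :: "wmatrix \<Rightarrow> nat \<Rightarrow> wmatrix" where
  "tensor_power A 0 = id_mat"
| "tensor_power A (Suc n) = tensor 1 A (tensor_power A n)"

definition S_coeff :: "(nat \<Rightarrow> complex) \<Rightarrow> nat \<Rightarrow> nat \<Rightarrow> complex" where
  "S_coeff \<xi> \<beta> \<alpha> = - ((1 - 1 / \<xi> \<alpha>) / (1 - 1 / \<xi> \<beta>))"

definition T_coeff :: "(nat \<Rightarrow> complex) \<Rightarrow> nat \<Rightarrow> nat \<Rightarrow> complex" where
  "T_coeff \<xi> \<beta> \<alpha> = (1 / \<xi> \<alpha> - 1 / \<xi> \<beta>) / (1 - 1 / \<xi> \<beta>)"

definition R_mat :: "(nat \<Rightarrow> complex) \<Rightarrow> nat \<Rightarrow> nat \<Rightarrow> wmatrix" where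
  "R_mat \<xi> \<beta> \<alpha> u v =
    (let i = u ! 0; j = u ! 1; l = v ! 0; m = v ! 1
     in if i = l \<and> j = m \<and> i \<ge> j then S_coeff \<xi> \<beta> \<alpha>
        else if i = l \<and> j = m \<and> i < j then - 1
        else if i = m \<and> j = l \<and> i > j then T_coeff \<xi> \<beta> \<alpha>
        else 0)"

definition T_mat :: "nat \<Rightarrow> (nat \<Rightarrow> complex) \<Rightarrow> nat \<Rightarrow> nat \<Rightarrow> nat \<Rightarrow> wmatrix" where
  "T_mat N \<xi> l \<beta> \<alpha> =
    tensor (l - 1) (tensor_power id_mat (l - 1))
      (tensor 2 (R_mat \<xi> \<beta> \<alpha>) (tensor_power id_mat (N - l - 1)))"

text \<open>A list \<open>[l\<^sub>k, \<dots>, l\<^sub>1]\<close> stands for the expression \<open>T\<^bsub>l\<^sub>k\<^esub> \<cdots> T\<^bsub>l\<^sub>1\<^esub>\<close>. Exchanging the entries in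
  positions \<open>l\<close> and \<open>l + 1\<close> of the word of \<open>\<sigma>\<close> is composition with a transposition on the right.\<close>

primrec expr_perm :: "nat list \<Rightarrow> nat \<Rightarrow> nat" where
  "expr_perm [] = id"
| "expr_perm (l # ls) = expr_perm ls \<circ> Transposition.transpose l (l + 1)"

primrec expr_mat :: "nat \<Rightarrow> (nat \<Rightarrow> complex) \<Rightarrow> nat list \<Rightarrow> wmatrix" where
  "expr_mat N \<xi> [] = id_mat"
| "expr_mat N \<xi> (l # ls) =
    mat_mult (words N N) (T_mat N \<xi> l (expr_perm ls (l + 1)) (expr_perm ls l)) (expr_mat N \<xi> ls)"

text \<open>Any expression of \<open>\<sigma>\<close> may be used: the product does not depend on the choice.\<close>

definition A_mat :: "nat \<Rightarrow> (nat \<Rightarrow> complex) \<Rightarrow> (nat \<Rightarrow> nat) \<Rightarrow> wmatrix" where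
  "A_mat N \<xi> \<sigma> = expr_mat N \<xi> (SOME ls. set ls \<subseteq> {1..N - 1} \<and> expr_perm ls = \<sigma>)"

section \<open>The contour integral\<close>

definition epsilon :: "real \<Rightarrow> real \<Rightarrow> complex \<Rightarrow> complex" where
  "epsilon p q \<xi> = of_real p / \<xi> + of_real q * \<xi> - 1"

text \<open>\<open>circles_integral R n f\<close> integrates \<open>f\<close> over \<open>\<xi> 1, \<dots>, \<xi> n\<close>, each \<open>\<xi> i\<close> running
  counterclockwise over the circle of radius \<open>R i\<close> about \<open>0\<close>, with \<open>\<xi> 1\<close> innermost.\<close>

primrec circles_integral ::
  "(nat \<Rightarrow> real) \<Rightarrow> nat \<Rightarrow> ((nat \<Rightarrow> complex) \<Rightarrow> complex) \<Rightarrow> complex" where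
  "circles_integral R 0 f = f (\<lambda>_. 0)"
| "circles_integral R (Suc n) f =
    contour_integral (circlepath 0 (R (Suc n)))
      (\<lambda>z. circles_integral R n (\<lambda>\<xi>. f (\<xi>(Suc n := z))))"

end

theory Submission
  imports Defs
begin

text \<open>On pairs of letters \<open>\<R>\<^bsub>\<beta>\<alpha>\<^esub>\<close> is \<open>T\<^bsub>\<beta>\<alpha>\<^esub> b - 1\<close>, where \<open>b\<close> sorts the two letters into decreasing order. As
  \<open>b\<close> is idempotent and satisfies the braid relation, and \<open>1 - T\<^bsub>\<beta>\<alpha>\<^esub>\<close> is multiplicative in the indices, the
  Yang--Baxter equation holds, and a normal form for words in the simple transpositions shows that
  \<open>\<A>\<^sub>\<sigma>\<close> is well defined. A right move acts on the word of a cluster of particles as one pass of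
  bubble sort, that is, as a product of operators \<open>b\<close>, and a left move acts on it as at most one such
  operator. The Bethe wave function satisfies the boundary condition
  \<open>u(\<dots>, x, x, \<dots>) = b u(\<dots>, x - 1, x, \<dots>)\<close>, which therefore turns the free evolution equation into
  the one of the particle system.

  No differential equation is needed: the wave function is an exponential series in
  \<open>\<Sum>\<^sub>i (p / \<xi>\<^sub>i + q \<xi>\<^sub>i)\<close> whose \<open>n\<close>-th coefficient counts the histories with exactly \<open>n\<close> rings, up to the
  Poisson weight \<open>e\<^bsup>-Nt\<^esup> t\<^sup>n / n!\<close> which all orders of \<open>n\<close> rings share. For \<open>n = 0\<close> all terms except
  \<open>\<sigma> = id\<close> integrate to zero: let \<open>k\<close> be the first letter that \<open>\<sigma>\<close> moves. Then \<open>\<A>\<^sub>\<sigma>\<close> is a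
  polynomial of low degree in \<open>1 / \<xi>\<^sub>k\<close> and a power series in \<open>1 / \<xi>\<^sub>m\<close>, \<open>m = \<sigma>(k)\<close>, and one of these
  two variables gives the integral zero.\<close>

section \<open>Words in the simple transpositions\<close>

text \<open>The comparison with the particle system peels off the last ring, because a moment knows
  only the fixed initial state, whereas the final positions and a test function
  \<open>\<phi>\<close> of the final word are free. A single matrix entry does not stay one under
  this: a move replaces \<open>\<phi>\<close> by its composite with sortings. For this reason the
  matrices are applied to arbitrary row vectors, and all identities are proved for arbitrary
  \<open>\<phi>\<close>. The free equation leads from \<open>X\<close> to \<open>X\<close> with one
  coordinate shifted by one, and that tuple may have two equal coordinates and is then no state. The
  boundary condition turns it back into a strictly increasing tuple at the price of sortings; what
  results are, index by index, the configurations from which one ring leads to \<open>X\<close>. For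
  a permutation paired with its composite with an adjacent transposition the condition reads
  \<open>T = 1 / \<xi> \<alpha> + (T - 1) / \<xi> \<beta>\<close>, and \<open>T_coeff\<close> is its
  solution.\<close>

lemma expr_perm_append: "expr_perm (u @ v) = expr_perm v \<circ> expr_perm u"
  by (induction u) (auto simp: comp_assoc)

lemma expr_perm_permutes: "set ls \<subseteq> {a..<N} \<Longrightarrow> expr_perm ls permutes {a..N}"
proof (induction ls)
  case Nil
  then show ?case by (simp only: expr_perm.simps permutes_id)
next
  case (Cons l ls)
  then have "Transposition.transpose l (l + 1) permutes {a..N}"
    by (intro permutes_swap_id) auto
  with Cons show ?case by (simp del: Suc_eq_plus1 comp_apply add: permutes_compose)
qed

text \<open>Adjacent transpositions carry the letter \<open>a\<close> to its own place, and what is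
  left permutes \<open>{Suc a..N}\<close>. The lower end \<open>a\<close> is kept free because a
  permutation that fixes the letters up to \<open>k\<close> later needs an expression that never
  involves the letter \<open>k\<close>.\<close>

lemma ex_expr_perm:
  assumes "\<sigma> permutes {a..N}"
  shows "\<exists>ls. set ls \<subseteq> {a..<N} \<and> expr_perm ls = \<sigma>"
  using assms
proof (induction "Suc N - a" arbitrary: a \<sigma>)
  case 0
  then show ?case by (intro exI[of _ "[]"]) (auto simp: permutes_empty)
next
  case (Suc m)
  then have aN: "a \<le> N" by simp
  obtain j where j: "j \<in> {a..N}" "\<sigma> j = a"
    using permutes_image[OF Suc.prems] aN by (metis (no_types, lifting) atLeastAtMost_iff imageE order_refl)
  \<comment> \<open>Inner induction on the distance \<open>d\<close> of the letter \<open>a\<close>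
    from its own place.\<close>
  have "\<exists>ls. set ls \<subseteq> {a..<N} \<and> expr_perm ls = \<tau>" if "\<tau> permutes {a..N}" "\<tau> (a + d) = a" "a + d \<le> N" for \<tau> d
    using that
  proof (induction d arbitrary: \<tau>)
    case 0
    then have "\<tau> permutes {Suc a..N}"
      using aN by (intro permutes_superset[OF 0(1)]) (auto simp: not_le Suc_le_eq le_less)
    from Suc.hyps(1)[OF _ this] Suc.hyps(2) obtain ls where "set ls \<subseteq> {Suc a..<N}" "expr_perm ls = \<tau>"
      by (metis Suc_diff_le Suc_inject aN diff_Suc_Suc)
    then show ?case by (intro exI[of _ ls]) auto
  next
    case (Suc d)
    let ?s = "Transposition.transpose (a + d) (a + d + 1)"
    have "\<tau> \<circ> ?s permutes {a..N}"
      using Suc.prems by (intro permutes_compose permutes_swap_id) auto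
    moreover have "(\<tau> \<circ> ?s) (a + d) = a" using Suc.prems by simp
    ultimately obtain ls where "set ls \<subseteq> {a..<N}" "expr_perm ls = \<tau> \<circ> ?s"
      using Suc.IH[of "\<tau> \<circ> ?s"] Suc.prems(3) by fastforce
    moreover then have "expr_perm ((a + d) # ls) = \<tau>" by (simp add: comp_assoc)
    ultimately show ?case using Suc.prems by (intro exI[of _ "(a + d) # ls"]) auto
  qed
  from this[of \<sigma> "j - a"] show ?case using j Suc.prems by auto
qed

text \<open>Abstract maps with the Coxeter relations of the symmetric group on \<open>n + 1\<close>
  letters. The aim is \<open>fold_eqI\<close>: composites of such maps depend only on the
  permutation that the word expresses. Maps on an arbitrary type are allowed because
  \<open>row_step\<close> also carries the permutation that determines its coefficients.\<close>

locale coxeter_maps =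
  fixes n :: nat and g :: "nat \<Rightarrow> 'a \<Rightarrow> 'a"
  assumes inv: "1 \<le> l \<Longrightarrow> l \<le> n \<Longrightarrow> g l (g l x) = x"
    and braid: "1 \<le> l \<Longrightarrow> l < n \<Longrightarrow> g l (g (Suc l) (g l x)) = g (Suc l) (g l (g (Suc l) x))"
    and far: "1 \<le> l \<Longrightarrow> l + 1 < m \<Longrightarrow> m \<le> n \<Longrightarrow> g l (g m x) = g m (g l x)"
begin

text \<open>Every Coxeter relation preserves both images, so they are compared together; a
  permutation can then be used to identify a normal form, and the normal form to compute the
  map.\<close>

definition word_eq :: "nat list \<Rightarrow> nat list \<Rightarrow> bool" where
  "word_eq u v \<longleftrightarrow> fold g u = fold g v \<and> expr_perm u = expr_perm v"

lemma word_eq_refl: "word_eq u u"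
  by (simp add: word_eq_def)

lemma word_eq_sym: "word_eq u v \<Longrightarrow> word_eq v u"
  by (simp add: word_eq_def)

lemma word_eq_trans: "word_eq u v \<Longrightarrow> word_eq v w \<Longrightarrow> word_eq u w"
  by (simp add: word_eq_def)

lemma word_eq_append: "word_eq u u' \<Longrightarrow> word_eq v v' \<Longrightarrow> word_eq (u @ v) (u' @ v')"
  by (simp add: word_eq_def expr_perm_append)

lemma word_eq_inv: "l \<in> {1..n} \<Longrightarrow> word_eq [l, l] []"
  using inv by (auto simp: word_eq_def fun_eq_iff)

lemma word_eq_braid: "l \<in> {1..<n} \<Longrightarrow> word_eq [l, Suc l, l] [Suc l, l, Suc l]"
  using braid by (auto simp: word_eq_def fun_eq_iff Transposition.transpose_def)

lemma word_eq_far1: "l \<in> {1..n} \<Longrightarrow> m \<in> {1..n} \<Longrightarrow> l + 1 < m \<Longrightarrow> word_eq [l, m] [m, l]"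
  using far[of l m] by (auto simp: word_eq_def fun_eq_iff Transposition.transpose_def)

lemma word_eq_far: "l \<in> {1..n} \<Longrightarrow> m \<in> {1..n} \<Longrightarrow> l + 1 < m \<or> m + 1 < l \<Longrightarrow> word_eq [l, m] [m, l]"
  using word_eq_far1[of l m] word_eq_far1[of m l] word_eq_sym by blast

lemma word_eq_far_list:
  assumes "l \<in> {1..n}" "set u \<subseteq> {1..n}" "\<And>m. m \<in> set u \<Longrightarrow> l + 1 < m \<or> m + 1 < l"
  shows "word_eq (u @ [l]) (l # u)"
  using assms
proof (induction u)
  case Nil
  then show ?case by (simp add: word_eq_refl)
next
  case (Cons m u)
  then have "word_eq ([m] @ (u @ [l])) ([m] @ (l # u))"
    by (intro word_eq_append word_eq_refl) auto
  moreover have "word_eq ([m, l] @ u) ([l, m] @ u)"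
    using Cons.prems by (intro word_eq_append word_eq_far word_eq_refl) auto
  ultimately show ?case using word_eq_trans by fastforce
qed

text \<open>The coset representative \<open>m, m - 1, \<dots>, k\<close>; it is empty for \<open>k = m + 1\<close>.\<close>

definition descending :: "nat \<Rightarrow> nat \<Rightarrow> nat list" where
  "descending m k = rev [k..<Suc m]"

lemma descending_snoc: "k \<le> m \<Longrightarrow> descending m k = descending m (Suc k) @ [k]"
  by (simp add: descending_def upt_conv_Cons del: upt_Suc)

lemma descending_split: "1 \<le> k \<Longrightarrow> k \<le> j \<Longrightarrow> j \<le> Suc m \<Longrightarrow> descending m k = descending m j @ descending (j - 1) k"
  using upt_add_eq_append[of k j "Suc m - j"]
  by (cases j) (auto simp: descending_def rev_append[symmetric] simp del: upt_Suc rev_append)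

lemma set_descending: "set (descending m k) = {k..m}"
  by (auto simp: descending_def)

text \<open>A generator \<open>l\<close> appended to \<open>m, ..., k\<close> extends the run if
  \<open>l + 1 = k\<close> and shortens it if \<open>l = k\<close>. If \<open>l + 1 < k\<close>, it
  commutes with the whole run. If \<open>k < l\<close>, it moves left up to the pair
  \<open>l, l - 1\<close>, the braid relation turns it into \<open>l - 1\<close>, and this commutes
  with the rest. What leaves on the left is always a generator below \<open>m\<close>.\<close>

lemma descending_step:
  assumes "m \<le> n" "k \<in> {1..Suc m}" "l \<in> {1..m}"
  shows "\<exists>v k'. set v \<subseteq> {1..<m} \<and> k' \<in> {1..Suc m} \<and> word_eq (descending m k @ [l]) (v @ descending m k')"
proof -
  consider "Suc l = k" | "l = k" | "Suc l < k" | "k < l" by linarith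
  then show ?thesis
  proof cases
    case 1
    then show ?thesis using assms
      by (intro exI[of _ "[]"] exI[of _ l]) (auto simp: descending_snoc[of l] word_eq_refl)
  next
    case 2
    then have "word_eq (descending m (Suc k) @ [k, k]) (descending m (Suc k) @ [])"
      using assms by (intro word_eq_append word_eq_inv word_eq_refl) auto
    then show ?thesis using assms 2
      by (intro exI[of _ "[]"] exI[of _ "Suc k"]) (auto simp: descending_snoc[of k])
  next
    case 3
    then have "word_eq (descending m k @ [l]) (l # descending m k)"
      using assms by (intro word_eq_far_list) (auto simp: set_descending)
    then show ?thesis using assms 3
      by (intro exI[of _ "[l]"] exI[of _ k]) auto
  next
    case 4
    let ?a = "descending m (Suc l)" and ?b = "descending (l - 2) k"
    have ab: "descending m k = ?a @ [l, l - 1] @ ?b"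
      using assms 4 descending_split[of k "Suc l" m] descending_split[of k l l]
        descending_split[of k "l - 1" "l - 1"] descending_snoc[of l l] descending_snoc[of "l - 1" "l - 1"]
      by (simp add: numeral_2_eq_2 descending_def[of "l - Suc 0" l] descending_def[of l "Suc l"])
    have "word_eq (?b @ [l]) (l # ?b)"
      using assms 4 by (intro word_eq_far_list) (auto simp: set_descending)
    then have "word_eq ((?a @ [l, l - 1]) @ (?b @ [l])) ((?a @ [l, l - 1]) @ ([l] @ ?b))"
      by (intro word_eq_append[OF word_eq_refl]) auto
    also have "(?a @ [l, l - 1]) @ ([l] @ ?b) = ?a @ [l, l - 1, l] @ ?b" by simp
    finally have 1: "word_eq (descending m k @ [l]) (?a @ [l, l - 1, l] @ ?b)"
      by (simp add: ab)
    have "l - 1 \<in> {1..<n}" "Suc (l - 1) = l" using assms 4 by auto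
    then have "word_eq [l, l - 1, l] [l - 1, l, l - 1]"
      using word_eq_sym[OF word_eq_braid[of "l - 1"]] by metis
    then have 2: "word_eq (?a @ [l, l - 1, l] @ ?b) (?a @ [l - 1, l, l - 1] @ ?b)"
      by (intro word_eq_append word_eq_refl) auto
    have "word_eq (?a @ [l - 1]) ((l - 1) # ?a)"
      using assms 4 by (intro word_eq_far_list) (auto simp: set_descending)
    then have "word_eq ((?a @ [l - 1]) @ ([l, l - 1] @ ?b)) (((l - 1) # ?a) @ ([l, l - 1] @ ?b))"
      by (intro word_eq_append word_eq_refl) auto
    then have 3: "word_eq (?a @ [l - 1, l, l - 1] @ ?b) ([l - 1] @ descending m k)"
      by (simp add: ab)
    show ?thesis using assms 4 word_eq_trans[OF word_eq_trans[OF 1 2] 3]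
      by (intro exI[of _ "[l - 1]"] exI[of _ k]) auto
  qed
qed

text \<open>The runs \<open>descending m k\<close> represent the cosets of the subgroup generated by
  the generators below \<open>m\<close>. Reading \<open>w\<close> from left to right, each letter
  either changes the representative or is handed on to the left part.\<close>

lemma normal_form:
  assumes "m \<le> n" "set w \<subseteq> {1..m}"
  shows "\<exists>v k. set v \<subseteq> {1..<m} \<and> k \<in> {1..Suc m} \<and> word_eq w (v @ descending m k)"
  using assms(2)
proof (induction w rule: rev_induct)
  case Nil
  then show ?case
    by (intro exI[of _ "[]"] exI[of _ "Suc m"]) (auto simp: descending_def word_eq_refl)
next
  case (snoc l w)
  then obtain v k where vk: "set v \<subseteq> {1..<m}" "k \<in> {1..Suc m}" "word_eq w (v @ descending m k)"
    by auto
  obtain v' k' where v'k': "set v' \<subseteq> {1..<m}" "k' \<in> {1..Suc m}"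
      "word_eq (descending m k @ [l]) (v' @ descending m k')"
    using descending_step[OF assms(1) vk(2), of l] snoc.prems by auto
  have "word_eq (w @ [l]) ((v @ descending m k) @ [l])"
    using vk by (intro word_eq_append word_eq_refl)
  moreover have "word_eq (v @ (descending m k @ [l])) (v @ (v' @ descending m k'))"
    using v'k' by (intro word_eq_append[OF word_eq_refl])
  ultimately have "word_eq (w @ [l]) ((v @ v') @ descending m k')"
    using word_eq_trans by fastforce
  then show ?case using vk v'k' by (intro exI[of _ "v @ v'"] exI[of _ k']) auto
qed

text \<open>Lets the coset be read off the permutation: generators below \<open>m\<close> fix the
  letter \<open>m + 1\<close>, so a word in normal form sends \<open>m + 1\<close> to
  \<open>k\<close>.\<close>

lemma expr_perm_descending:
  assumes "k \<le> Suc m"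
  shows "expr_perm (descending m k) (Suc m) = k"
  using assms
proof (induction "Suc m - k" arbitrary: k)
  case 0
  then show ?case by (simp add: descending_def)
next
  case (Suc d)
  then have "expr_perm (descending m (Suc k)) (Suc m) = Suc k" by simp
  then show ?case using Suc by (simp add: descending_snoc[of k] expr_perm_append)
qed

text \<open>A trivial permutation fixes the top letter, which forces the run in the normal form to
  be empty; the word that remains uses one generator fewer.\<close>

lemma fold_expr_perm_id:
  assumes "m \<le> n" "set w \<subseteq> {1..m}" "expr_perm w = id"
  shows "fold g w = id"
  using assms
proof (induction m arbitrary: w)
  case 0
  then show ?case by (simp add: id_def)
next
  case (Suc m)
  obtain v k where vk: "set v \<subseteq> {1..<Suc m}" "k \<in> {1..Suc (Suc m)}"
      "word_eq w (v @ descending (Suc m) k)"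
    using normal_form[OF Suc.prems(1,2)] by auto
  then have eq: "expr_perm (descending (Suc m) k) \<circ> expr_perm v = id"
    using Suc.prems by (metis word_eq_def expr_perm_append)
  have "expr_perm v permutes {1..Suc m}" using vk by (intro expr_perm_permutes) auto
  then have "expr_perm v (Suc (Suc m)) = Suc (Suc m)" by (rule permutes_not_in) auto
  then have "k = Suc (Suc m)"
    using fun_cong[OF eq, of "Suc (Suc m)"] vk expr_perm_descending[of k "Suc m"] by simp
  then have "word_eq w v" using vk by (simp add: descending_def)
  moreover have "fold g v = id"
    using Suc vk \<open>word_eq w v\<close> by (intro Suc.IH) (auto simp: word_eq_def)
  ultimately show ?case by (simp add: word_eq_def)
qed

lemma fold_rev_cancel:
  assumes "set w \<subseteq> {1..n}"
  shows "fold g (w @ rev w) = id" "expr_perm (w @ rev w) = id"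
proof -
  have "word_eq (w @ rev w) []" using assms
  proof (induction w)
    case Nil
    then show ?case by (simp add: word_eq_refl)
  next
    case (Cons l w)
    then have "word_eq ([l] @ (w @ rev w) @ [l]) ([l] @ [] @ [l])"
      by (intro word_eq_append word_eq_refl) auto
    moreover have "word_eq [l, l] []" using Cons.prems by (intro word_eq_inv) auto
    ultimately show ?case using word_eq_trans by fastforce
  qed
  then show "fold g (w @ rev w) = id" "expr_perm (w @ rev w) = id"
    by (auto simp: word_eq_def id_def)
qed

text \<open>Reversing a word inverts both its permutation and its map, so the claim reduces to the
  word \<open>u @ rev v\<close>, whose permutation is trivial.\<close>

lemma fold_eqI:
  assumes "set u \<subseteq> {1..n}" "set v \<subseteq> {1..n}" "expr_perm u = expr_perm v"
  shows "fold g u = fold g v"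
proof -
  have v: "expr_perm (rev v) \<circ> expr_perm v = id"
    using fold_rev_cancel[OF assms(2)] by (simp add: expr_perm_append)
  have "fold g (u @ rev v) = id"
    using assms v by (intro fold_expr_perm_id[of n]) (auto simp: expr_perm_append)
  then have u: "fold g (rev v) \<circ> fold g u = id" by simp
  have "fold g v \<circ> fold g (rev v) = id"
    using fold_rev_cancel(1)[of "rev v"] assms(2) by simp
  then have "fold g v \<circ> (fold g (rev v) \<circ> fold g u) = fold g u"
    by (simp add: comp_assoc[symmetric])
  then show ?thesis by (simp add: u)
qed

end

section \<open>The matrices as sorting operators\<close>

text \<open>The index is that of the transposition, counted from 1, so the list indices involved are
  \<open>l - 1\<close> and \<open>l\<close>. Beyond the end of the word nothing happens, which keeps
  the relations below valid for words of any length.\<close>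

definition sort_at :: "nat \<Rightarrow> nat list \<Rightarrow> nat list" where
  "sort_at l w = (if l < length w \<and> w ! (l - 1) < w ! l then w[l - 1 := w ! l, l := w ! (l - 1)] else w)"

lemma length_sort_at [simp]: "length (sort_at l w) = length w"
  by (simp add: sort_at_def)

lemma nth_sort_at:
  "1 \<le> l \<Longrightarrow> i < length w \<Longrightarrow> sort_at l w ! i =
    (if l < length w then if i = l - 1 then max (w ! (l - 1)) (w ! l)
       else if i = l then min (w ! (l - 1)) (w ! l) else w ! i else w ! i)"
  by (auto simp: sort_at_def nth_list_update)

lemma set_sort_at [simp]: "set (sort_at l w) = set w"
  by (auto simp: sort_at_def set_swap)

lemma sort_at_words [simp]: "sort_at l w \<in> words N n \<longleftrightarrow> w \<in> words N n"
  by (simp add: words_def)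

lemma sort_at_idem: "1 \<le> l \<Longrightarrow> sort_at l (sort_at l w) = sort_at l w"
  by (rule nth_equalityI) (auto simp: nth_sort_at)

text \<open>If the word is long enough, both sides put the entries at positions \<open>l\<close>,
  \<open>l + 1\<close>, \<open>l + 2\<close> into decreasing order. With idempotence and commutation
  at a distance these are the relations of the 0-Hecke monoid.\<close>

lemma sort_at_braid:
  assumes "1 \<le> l"
  shows "sort_at l (sort_at (Suc l) (sort_at l w)) = sort_at (Suc l) (sort_at l (sort_at (Suc l) w))"
proof -
  obtain k where k: "l = Suc k" using assms by (cases l) auto
  consider "length w \<le> l" | "length w = Suc l" | "Suc l < length w" by linarith
  then show ?thesis
  proof cases
    case 1
    then show ?thesis by (simp add: sort_at_def)
  next
    case 2
    then have "sort_at (Suc l) u = u" if "length u = length w" for u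
      using that by (simp add: sort_at_def)
    then show ?thesis using assms by (simp add: sort_at_idem)
  next
    case 3
    then have *: "k < length w" "Suc k < length w" "Suc (Suc k) < length w" using k by auto
    show ?thesis
    proof (rule nth_equalityI)
      fix i assume "i < length (sort_at l (sort_at (Suc l) (sort_at l w)))"
      then have i: "i < length w" by simp
      show "sort_at l (sort_at (Suc l) (sort_at l w)) ! i = sort_at (Suc l) (sort_at l (sort_at (Suc l) w)) ! i"
      proof (cases "i \<in> {k, Suc k, Suc (Suc k)}")
        case True
        then show ?thesis using * k
          by (elim insertE emptyE) (simp_all add: nth_sort_at)
      next
        case False
        then show ?thesis using i k by (simp add: nth_sort_at)
      qed
    qed simp
  qed
qed

lemma sort_at_far:
  assumes "1 \<le> l" "l + 1 < m"
  shows "sort_at l (sort_at m w) = sort_at m (sort_at l w)"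
proof (rule nth_equalityI)
  obtain k where k: "l = Suc k" using assms by (cases l) auto
  fix i assume "i < length (sort_at l (sort_at m w))"
  then have i: "i < length w" by simp
  show "sort_at l (sort_at m w) ! i = sort_at m (sort_at l w) ! i"
  proof (cases "m < length w")
    case True
    then have *: "k < length w" "Suc k < length w" "m - 1 < length w" "Suc k < m - 1"
      using assms k by auto
    then show ?thesis using i True k
      by (cases "i \<in> {k, Suc k}"; cases "i \<in> {m - 1, m}") (auto simp: nth_sort_at)
  next
    case False
    then show ?thesis by (simp add: sort_at_def)
  qed
qed simp

section \<open>The matrices expressed by sortings, and their action on row vectors\<close>

lemma tensor_power_id_mat: "tensor_power id_mat n = id_mat"
proof (induction n)
  case (Suc n)
  have "(take 1 u = take 1 v \<and> drop 1 u = drop 1 v) \<longleftrightarrow> u = v" for u v :: "nat list"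
    by (metis append_take_drop_id)
  with Suc show ?case by (auto simp: fun_eq_iff tensor_def id_mat_def)
qed simp

text \<open>The reason is \<open>S_coeff = T_coeff - 1\<close>: the summand \<open>- 1\<close> is
  then common to the whole diagonal, and \<open>T_coeff\<close> remains exactly where the row word
  is the sorted column word.\<close>

lemma R_mat_eq:
  assumes "length u = 2" "length v = 2" "\<xi> \<beta> \<noteq> 1"
  shows "R_mat \<xi> \<beta> \<alpha> u v = (if sort_at 1 v = u then T_coeff \<xi> \<beta> \<alpha> else 0) - (if u = v then 1 else 0)"
proof -
  obtain i j l m where [simp]: "u = [i, j]" "v = [l, m]"
    using assms by (auto simp: numeral_2_eq_2 length_Suc_conv)
  have aux: "- ((1 - x) / (1 - y)) = (x - y) / (1 - y) - 1" if "1 - y \<noteq> 0" for x y :: complex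
    using that by (simp add: field_simps)
  have "1 - 1 / \<xi> \<beta> \<noteq> 0" using assms(3) by auto
  then have "S_coeff \<xi> \<beta> \<alpha> = T_coeff \<xi> \<beta> \<alpha> - 1"
    unfolding S_coeff_def T_coeff_def using aux by blast
  then show ?thesis by (auto simp: R_mat_def sort_at_def Let_def)
qed

text \<open>Both words are cut into blocks of lengths \<open>l - 1\<close>, \<open>2\<close> and
  \<open>N - l - 1\<close>. The identity factors force the outer blocks to agree, and
  \<open>sort_at l\<close> acts only on the middle block.\<close>

lemma T_mat_eq:
  assumes "u \<in> words N N" "v \<in> words N N" "l \<in> {1..N - 1}" "\<xi> \<beta> \<noteq> 1"
  shows "T_mat N \<xi> l \<beta> \<alpha> u v = (if sort_at l v = u then T_coeff \<xi> \<beta> \<alpha> else 0) - (if u = v then 1 else 0)"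
proof -
  have len: "length u = N" "length v = N" using assms by (auto simp: words_def)
  obtain k where l: "l = Suc k" using assms(3) by (cases l) auto
  have split: "w = take k w @ take 2 (drop k w) @ drop 2 (drop k w)" for w :: "nat list"
    by (metis append_take_drop_id)
  let ?u1 = "take k u" and ?u2 = "take 2 (drop k u)" and ?u3 = "drop 2 (drop k u)"
  let ?v1 = "take k v" and ?v2 = "take 2 (drop k v)" and ?v3 = "drop 2 (drop k v)"
  have len2: "length ?u2 = 2" "length ?v2 = 2" "length ?u1 = k" "length ?v1 = k"
    using len assms(3) l by auto
  have eqI: "a1 @ a2 @ a3 = b1 @ b2 @ b3 \<longleftrightarrow> a1 = b1 \<and> a2 = b2 \<and> a3 = b3"
    if "length a1 = length b1" "length a2 = length b2" for a1 a2 a3 b1 b2 b3 :: "nat list"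
    using that by auto
  have uv: "u = v \<longleftrightarrow> ?u1 = ?v1 \<and> ?u2 = ?v2 \<and> ?u3 = ?v3"
    using eqI[of ?u1 ?v1 ?u2 ?v2 ?u3 ?v3] split[of u] split[of v] len2 by metis
  have "sort_at l v = ?v1 @ sort_at 1 ?v2 @ ?v3"
  proof (rule nth_equalityI)
    fix i assume "i < length (sort_at l v)"
    then have i: "i < N" using len by simp
    have N: "Suc k < N" using assms(3) l by auto
    consider "i < k" | "i = k" | "i = Suc k" | d where "i = k + (2 + d)"
    proof -
      assume "i < k \<Longrightarrow> thesis" "i = k \<Longrightarrow> thesis" "i = Suc k \<Longrightarrow> thesis"
        "\<And>d. i = k + (2 + d) \<Longrightarrow> thesis"
      moreover have "i < k \<or> i = k \<or> i = Suc k \<or> i = k + (2 + (i - k - 2))" by arith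
      ultimately show thesis by blast
    qed
    then show "sort_at l v ! i = (?v1 @ sort_at 1 ?v2 @ ?v3) ! i"
    proof cases
      case 4
      then show ?thesis using i len l N by (simp add: nth_sort_at nth_append)
    qed (use i len l N in \<open>auto simp: nth_sort_at nth_append\<close>)
  qed (use len assms(3) l in auto)
  then have suv: "sort_at l v = u \<longleftrightarrow> ?v1 = ?u1 \<and> sort_at 1 ?v2 = ?u2 \<and> ?v3 = ?u3"
    using eqI[of ?v1 ?u1 "sort_at 1 ?v2" ?u2 ?v3 ?u3] split[of u] len2 by (metis length_sort_at)
  have "T_mat N \<xi> l \<beta> \<alpha> u v = id_mat ?u1 ?v1 * (R_mat \<xi> \<beta> \<alpha> ?u2 ?v2 * id_mat ?u3 ?v3)"
    by (simp add: T_mat_def tensor_power_id_mat tensor_def l)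
  also have "\<dots> = (if sort_at l v = u then T_coeff \<xi> \<beta> \<alpha> else 0) - (if u = v then 1 else 0)"
    using R_mat_eq[OF len2(1,2), of \<xi> \<beta> \<alpha>] assms(4) suv uv by (auto simp: id_mat_def)
  finally show ?thesis .
qed

text \<open>The matrices act here on row vectors \<open>\<phi>\<close>, together with the permutation reached so far. This
  side is the convenient one, because \<open>T_mat\<close> sends \<open>\<phi>\<close> to a combination of \<open>\<phi>\<close> and
  \<open>\<phi> \<circ> sort_at l\<close>.\<close>

definition row_step :: "(nat \<Rightarrow> complex) \<Rightarrow> nat \<Rightarrow> (nat \<Rightarrow> nat) \<times> (nat list \<Rightarrow> complex) \<Rightarrow>
    (nat \<Rightarrow> nat) \<times> (nat list \<Rightarrow> complex)" where
  "row_step \<xi> l = (\<lambda>(\<rho>, \<phi>). (\<rho> \<circ> Transposition.transpose l (l + 1),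
     \<lambda>w. T_coeff \<xi> (\<rho> l) (\<rho> (l + 1)) * \<phi> (sort_at l w) - \<phi> w))"

lemma T_coeff_eq: "\<xi> \<beta> \<noteq> 1 \<Longrightarrow> T_coeff \<xi> \<beta> \<alpha> = 1 - (1 - 1 / \<xi> \<alpha>) / (1 - 1 / \<xi> \<beta>)"
  by (auto simp: T_coeff_def field_simps)

text \<open>With an idempotent \<open>b\<close>, the product of \<open>T' b - 1\<close> and
  \<open>T b - 1\<close> is the identity if \<open>T + T' = T T'\<close>. In the braid relation the
  coefficients of single sortings match if the coefficient of the outer pair of letters is
  \<open>x + y - x y\<close>, where \<open>x\<close> and \<open>y\<close> belong to the two inner
  pairs. Both follow because \<open>1 - T_coeff\<close> is the quotient
  \<open>c \<alpha> / c \<beta>\<close>.\<close>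

lemma coxeter_maps_row_step:
  assumes "\<And>i. \<xi> i \<noteq> 1"
  shows "coxeter_maps n (row_step \<xi>)"
proof
  define c where "c i = 1 - 1 / \<xi> i" for i
  have c: "c i \<noteq> 0" for i
    using assms[of i] by (auto simp: c_def)
  have T: "T_coeff \<xi> \<beta> \<alpha> = 1 - c \<alpha> / c \<beta>" for \<alpha> \<beta>
    using T_coeff_eq assms c_def by auto
  have T_inv: "T_coeff \<xi> \<alpha> \<beta> + T_coeff \<xi> \<beta> \<alpha> = T_coeff \<xi> \<alpha> \<beta> * T_coeff \<xi> \<beta> \<alpha>" for \<alpha> \<beta>
    using c[of \<alpha>] c[of \<beta>] by (simp add: T algebra_simps)
  have T_mult: "T_coeff \<xi> \<gamma> \<alpha> = T_coeff \<xi> \<gamma> \<beta> + T_coeff \<xi> \<beta> \<alpha> - T_coeff \<xi> \<gamma> \<beta> * T_coeff \<xi> \<beta> \<alpha>"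
    for \<alpha> \<beta> \<gamma>
    using c[of \<beta>] by (simp add: T algebra_simps)
  show "row_step \<xi> l (row_step \<xi> l x) = x" if "1 \<le> l" "l \<le> n" for l x
  proof -
    obtain \<rho> \<phi> where x: "x = (\<rho>, \<phi>)" by force
    have "T_coeff \<xi> (\<rho> (l + 1)) (\<rho> l) * (T_coeff \<xi> (\<rho> l) (\<rho> (l + 1)) * u - u) -
        (T_coeff \<xi> (\<rho> l) (\<rho> (l + 1)) * u - r) = r" for u r
      using arg_cong[OF T_inv[of "\<rho> (l + 1)" "\<rho> l"], of "\<lambda>t. t * u"] by (simp add: algebra_simps)
    then show ?thesis using that by (simp add: x row_step_def fun_eq_iff sort_at_idem)
  qed
  show "row_step \<xi> l (row_step \<xi> (Suc l) (row_step \<xi> l x)) =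
      row_step \<xi> (Suc l) (row_step \<xi> l (row_step \<xi> (Suc l) x))" if "1 \<le> l" "l < n" for l x
  proof -
    obtain \<rho> \<phi> where x: "x = (\<rho>, \<phi>)" by force
    define a b d where "a = \<rho> l" and "b = \<rho> (Suc l)" and "d = \<rho> (Suc (Suc l))"
    \<comment> \<open>The six letters stand for the values of \<open>\<phi>\<close> at the six words
      that composites of the two sortings produce from one word.\<close>
    have *: "T_coeff \<xi> b d * (T_coeff \<xi> a d * (T_coeff \<xi> a b * f - g) - (T_coeff \<xi> a b * h - h)) -
        (T_coeff \<xi> a d * (T_coeff \<xi> a b * r - u) - (T_coeff \<xi> a b * h - w)) =
        T_coeff \<xi> a b * (T_coeff \<xi> a d * (T_coeff \<xi> b d * f - r) - (T_coeff \<xi> b d * u - u)) -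
        (T_coeff \<xi> a d * (T_coeff \<xi> b d * g - h) - (T_coeff \<xi> b d * u - w))" for f g h r u w
      unfolding T_mult[of a d b] by (simp add: algebra_simps)
    have "Transposition.transpose l (Suc l) (Suc (Suc l)) = Suc (Suc l)"
      "Transposition.transpose (Suc l) (Suc (Suc l)) l = l"
      by (simp_all add: Transposition.transpose_def)
    then show ?thesis
      using that sort_at_braid[of l] sort_at_idem[of l] sort_at_idem[of "Suc l"] *
      by (simp add: x row_step_def fun_eq_iff a_def[symmetric] b_def[symmetric] d_def[symmetric])
        (auto simp: Transposition.transpose_def)
  qed
  show "row_step \<xi> l (row_step \<xi> m x) = row_step \<xi> m (row_step \<xi> l x)"
    if "1 \<le> l" "l + 1 < m" "m \<le> n" for l m x
    using that sort_at_far[OF that(1,2)]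
    by (cases x) (auto simp: row_step_def fun_eq_iff Transposition.transpose_def algebra_simps)
qed

lemma finite_words [simp]: "finite (words N n)"
  using finite_lists_length_eq[of "{1..N}" n] by (simp add: words_def conj_commute)

text \<open>The head of the list is the leftmost factor, so it meets the row vector first. Its
  coefficient belongs to the permutation before that letter, whereas the fold starts from the
  complete permutation and undoes it letter by letter; hence \<open>row_step\<close> takes the
  indices \<open>\<rho> l\<close> and \<open>\<rho> (l + 1)\<close> in exchanged order.\<close>

lemma sum_expr_mat:
  assumes "\<And>i. \<xi> i \<noteq> 1" "set ls \<subseteq> {1..N - 1}" "v \<in> words N N"
  shows "(\<Sum>u\<in>words N N. \<phi> u * expr_mat N \<xi> ls u v) = snd (fold (row_step \<xi>) ls (expr_perm ls, \<phi>)) v"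
  using assms(2)
proof (induction ls arbitrary: \<phi>)
  case Nil
  then show ?case using assms(3) by (simp add: id_mat_def sum.delta' if_distrib cong: if_cong)
next
  case (Cons l ls)
  let ?T = "T_coeff \<xi> (expr_perm ls (l + 1)) (expr_perm ls l)"
  let ?s = "Transposition.transpose l (l + 1)"
  let ?\<psi> = "\<lambda>w. ?T * \<phi> (sort_at l w) - \<phi> w"
  have row: "(\<Sum>u\<in>words N N. \<phi> u * T_mat N \<xi> l (expr_perm ls (l + 1)) (expr_perm ls l) u w) = ?\<psi> w"
    if w: "w \<in> words N N" for w
  proof -
    have "(\<Sum>u\<in>words N N. \<phi> u * T_mat N \<xi> l (expr_perm ls (l + 1)) (expr_perm ls l) u w)
      = (\<Sum>u\<in>words N N. (if sort_at l w = u then \<phi> u * ?T else 0) - (if u = w then \<phi> u else 0))"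
      using w Cons.prems assms(1) by (intro sum.cong refl) (auto simp: T_mat_eq algebra_simps)
    then show ?thesis using w by (simp add: sum_subtractf)
  qed
  have "(\<Sum>u\<in>words N N. \<phi> u * expr_mat N \<xi> (l # ls) u v)
    = (\<Sum>w\<in>words N N. (\<Sum>u\<in>words N N. \<phi> u * T_mat N \<xi> l (expr_perm ls (l + 1)) (expr_perm ls l) u w)
        * expr_mat N \<xi> ls w v)"
    by (simp add: mat_mult_def sum_distrib_left sum_distrib_right mult.assoc)
      (subst sum.swap, rule refl)
  also have "\<dots> = (\<Sum>w\<in>words N N. ?\<psi> w * expr_mat N \<xi> ls w v)"
    by (intro sum.cong refl) (simp only: row)
  also have "\<dots> = snd (fold (row_step \<xi>) ls (expr_perm ls, ?\<psi>)) v"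
    using Cons by simp
  also have "(expr_perm ls, ?\<psi>) = row_step \<xi> l (expr_perm (l # ls), \<phi>)"
    by (simp add: row_step_def comp_assoc)
  finally show ?case by (simp add: comp_def)
qed

text \<open>The row vector \<open>\<phi>\<close> times the matrix of \<open>\<sigma>\<close>, with
  the same choice of an expression as in \<open>A_mat\<close>. Unit vectors alone would not do,
  since \<open>\<phi>\<close> gets composed with sortings.\<close>

definition row_amp :: "nat \<Rightarrow> (nat \<Rightarrow> complex) \<Rightarrow> (nat \<Rightarrow> nat) \<Rightarrow> (nat list \<Rightarrow> complex) \<Rightarrow> nat list \<Rightarrow> complex" where
  "row_amp N \<xi> \<sigma> \<phi> =
    snd (fold (row_step \<xi>) (SOME ls. set ls \<subseteq> {1..N - 1} \<and> expr_perm ls = \<sigma>) (\<sigma>, \<phi>))"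

lemma ex_expr_perm':
  assumes "\<sigma> permutes {1..N}"
  shows "\<exists>ls. set ls \<subseteq> {1..N - 1} \<and> expr_perm ls = \<sigma>"
  using ex_expr_perm[OF assms] by (fastforce simp: subset_iff)

lemma some_expr_perm:
  assumes "\<sigma> permutes {1..N}"
  shows "set (SOME ls. set ls \<subseteq> {1..N - 1} \<and> expr_perm ls = \<sigma>) \<subseteq> {1..N - 1} \<and>
    expr_perm (SOME ls. set ls \<subseteq> {1..N - 1} \<and> expr_perm ls = \<sigma>) = \<sigma>"
  by (rule someI_ex[OF ex_expr_perm'[OF assms]])

lemma A_mat_row_amp:
  assumes "\<And>i. \<xi> i \<noteq> 1" "\<sigma> permutes {1..N}" "u \<in> words N N" "v \<in> words N N"
  shows "A_mat N \<xi> \<sigma> u v = row_amp N \<xi> \<sigma> (\<lambda>w. if w = u then 1 else 0) v"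
  using sum_expr_mat[OF assms(1) conjunct1[OF some_expr_perm[OF assms(2)]] assms(4),
      of "\<lambda>w. if w = u then 1 else 0"] some_expr_perm[OF assms(2)] assms(3)
  by (simp add: A_mat_def row_amp_def if_distrib[where f = "\<lambda>x. x * _"] cong: if_cong)

text \<open>Independence of the expression: the Coxeter relations for \<open>row_step\<close> make
  the fold a function of the permutation, so the chosen expression may be exchanged for
  \<open>ls\<close>.\<close>

lemma row_amp_expr:
  assumes "\<And>i. \<xi> i \<noteq> 1" "set ls \<subseteq> {1..N - 1}"
  shows "row_amp N \<xi> (expr_perm ls) \<phi> = snd (fold (row_step \<xi>) ls (expr_perm ls, \<phi>))"
proof -
  interpret coxeter_maps "N - 1" "row_step \<xi>" by (rule coxeter_maps_row_step) (rule assms)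
  have "set ls \<subseteq> {1..<N}" using assms(2) by (force simp: subset_iff)
  then have "expr_perm ls permutes {1..N}" by (rule expr_perm_permutes)
  from some_expr_perm[OF this]
  have "fold (row_step \<xi>) (SOME us. set us \<subseteq> {1..N - 1} \<and> expr_perm us = expr_perm ls) = fold (row_step \<xi>) ls"
    by (intro fold_eqI assms) auto
  then show ?thesis by (simp add: row_amp_def)
qed

lemma row_amp_id: "(\<And>i. \<xi> i \<noteq> 1) \<Longrightarrow> row_amp N \<xi> id \<phi> = \<phi>"
  using row_amp_expr[of \<xi> "[]" N \<phi>] by simp

lemma row_amp_swap:
  assumes "\<And>i. \<xi> i \<noteq> 1" "\<sigma> permutes {1..N}" "l \<in> {1..N - 1}"
  shows "row_amp N \<xi> (\<sigma> \<circ> Transposition.transpose l (l + 1)) \<phi> =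
    row_amp N \<xi> \<sigma> (\<lambda>w. T_coeff \<xi> (\<sigma> (l + 1)) (\<sigma> l) * \<phi> (sort_at l w) - \<phi> w)"
proof -
  obtain ls where ls: "set ls \<subseteq> {1..N - 1}" "expr_perm ls = \<sigma>"
    using ex_expr_perm'[OF assms(2)] by auto
  have "row_amp N \<xi> (expr_perm (l # ls)) \<phi> = snd (fold (row_step \<xi>) (l # ls) (expr_perm (l # ls), \<phi>))"
    using ls assms by (intro row_amp_expr) auto
  also have "\<dots> = snd (fold (row_step \<xi>) ls (expr_perm ls, \<lambda>w. T_coeff \<xi> (\<sigma> (l + 1)) (\<sigma> l) * \<phi> (sort_at l w) - \<phi> w))"
    by (simp add: row_step_def comp_assoc ls)
  also have "\<dots> = row_amp N \<xi> \<sigma> (\<lambda>w. T_coeff \<xi> (\<sigma> (l + 1)) (\<sigma> l) * \<phi> (sort_at l w) - \<phi> w)"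
    using row_amp_expr[OF assms(1) ls(1)] by (simp add: ls)
  finally show ?thesis by (simp add: ls)
qed

lemma fold_row_step_linear:
  "snd (fold (row_step \<xi>) ls (\<rho>, \<lambda>w. c * \<phi> w + d * \<psi> w)) =
    (\<lambda>w. c * snd (fold (row_step \<xi>) ls (\<rho>, \<phi>)) w + d * snd (fold (row_step \<xi>) ls (\<rho>, \<psi>)) w)"
proof (induction ls arbitrary: \<rho> \<phi> \<psi>)
  case (Cons l ls)
  let ?T = "T_coeff \<xi> (\<rho> l) (\<rho> (l + 1))"
  have "(\<lambda>w. ?T * (c * \<phi> (sort_at l w) + d * \<psi> (sort_at l w)) - (c * \<phi> w + d * \<psi> w)) =
    (\<lambda>w. c * (?T * \<phi> (sort_at l w) - \<phi> w) + d * (?T * \<psi> (sort_at l w) - \<psi> w))"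
    by (auto simp: algebra_simps)
  then have "row_step \<xi> l (\<rho>, \<lambda>w. c * \<phi> w + d * \<psi> w) = (\<rho> \<circ> Transposition.transpose l (l + 1),
      \<lambda>w. c * (?T * \<phi> (sort_at l w) - \<phi> w) + d * (?T * \<psi> (sort_at l w) - \<psi> w))"
    by (simp add: row_step_def)
  then show ?case using Cons by (simp add: row_step_def[of _ l] comp_def)
qed simp

lemma row_amp_linear:
  "row_amp N \<xi> \<sigma> (\<lambda>w. c * \<phi> w + d * \<psi> w) = (\<lambda>w. c * row_amp N \<xi> \<sigma> \<phi> w + d * row_amp N \<xi> \<sigma> \<psi> w)"
  unfolding row_amp_def by (rule fold_row_step_linear)

lemma row_amp_swap':
  assumes "\<And>i. \<xi> i \<noteq> 1" "\<sigma> permutes {1..N}" "l \<in> {1..N - 1}"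
  shows "row_amp N \<xi> (\<sigma> \<circ> Transposition.transpose l (l + 1)) \<phi> w =
    T_coeff \<xi> (\<sigma> (l + 1)) (\<sigma> l) * row_amp N \<xi> \<sigma> (\<lambda>w. \<phi> (sort_at l w)) w - row_amp N \<xi> \<sigma> \<phi> w"
  using row_amp_linear[of N \<xi> \<sigma> "T_coeff \<xi> (\<sigma> (l + 1)) (\<sigma> l)" "\<lambda>w. \<phi> (sort_at l w)" "-1" \<phi>]
  by (subst row_amp_swap[OF assms]) simp

section \<open>Iterated integrals over circles\<close>

text \<open>The value \<open>0\<close> outside \<open>{1..n}\<close> matches the base case of
  \<open>circles_integral\<close>, so these are the only points at which an iterated integral
  evaluates its integrand.\<close>

definition torus :: "(nat \<Rightarrow> real) \<Rightarrow> nat \<Rightarrow> (nat \<Rightarrow> complex) set" where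
  "torus R n = {\<xi>. (\<forall>i\<in>{1..n}. cmod (\<xi> i) = R i) \<and> (\<forall>i. i \<notin> {1..n} \<longrightarrow> \<xi> i = 0)}"

lemma torus_upd: "\<xi> \<in> torus R n \<Longrightarrow> cmod z = R (Suc n) \<Longrightarrow> \<xi>(Suc n := z) \<in> torus R (Suc n)"
  by (auto simp: torus_def le_Suc_eq)

lemma circles_integral_cong:
  assumes "\<And>i. i \<in> {1..n} \<Longrightarrow> 0 < R i" "\<And>\<xi>. \<xi> \<in> torus R n \<Longrightarrow> f \<xi> = g \<xi>"
  shows "circles_integral R n f = circles_integral R n g"
  using assms
proof (induction n arbitrary: f g)
  case 0
  then show ?case using 0(2)[of "\<lambda>_. 0"] by (simp add: torus_def)
next
  case (Suc n)
  have R: "0 < R (Suc n)" using Suc.prems(1)[of "Suc n"] by simp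
  show ?case unfolding circles_integral.simps
  proof (intro contour_integral_cong refl Suc.IH)
    fix z \<xi> assume "z \<in> path_image (circlepath 0 (R (Suc n)))" "\<xi> \<in> torus R n"
    then show "f (\<xi>(Suc n := z)) = g (\<xi>(Suc n := z))"
      using R by (intro Suc.prems(2) torus_upd) auto
  qed (use Suc.prems(1) in auto)
qed

definition circle_continuous :: "real \<Rightarrow> (complex \<Rightarrow> complex) set" where
  "circle_continuous r = {g. continuous_on (sphere 0 r) g}"

lemma circle_continuous_integrable:
  "0 < r \<Longrightarrow> g \<in> circle_continuous r \<Longrightarrow> g contour_integrable_on circlepath 0 r"
  by (intro contour_integrable_continuous_circlepath) (simp add: circle_continuous_def)

lemma circle_continuous_mult:
  "g \<in> circle_continuous r \<Longrightarrow> h \<in> circle_continuous r \<Longrightarrow> (\<lambda>z. g z * h z) \<in> circle_continuous r"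
  by (simp add: circle_continuous_def continuous_on_mult)

text \<open>Iterated integrals of these functions reduce to one-variable integrals, so that Fubini's theorem
  is never needed.\<close>

definition separable ::
  "(nat \<Rightarrow> real) \<Rightarrow> nat \<Rightarrow> (nat \<Rightarrow> (complex \<Rightarrow> complex) set) \<Rightarrow> ((nat \<Rightarrow> complex) \<Rightarrow> complex) set" where
  "separable R n G = {f. \<exists>gs. (\<forall>(c, g)\<in>set gs. \<forall>i\<in>{1..n}. g i \<in> G i) \<and>
    (\<forall>\<xi>\<in>torus R n. f \<xi> = (\<Sum>(c, g)\<leftarrow>gs. c * (\<Prod>i=1..n. g i (\<xi> i))))}"

lemma separableE:
  assumes "f \<in> separable R n G"
  obtains gs where "\<And>c g i. (c, g) \<in> set gs \<Longrightarrow> i \<in> {1..n} \<Longrightarrow> g i \<in> G i"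
    "\<And>\<xi>. \<xi> \<in> torus R n \<Longrightarrow> f \<xi> = (\<Sum>(c, g)\<leftarrow>gs. c * (\<Prod>i=1..n. g i (\<xi> i)))"
  using assms by (fastforce simp: separable_def)

lemma separableI:
  assumes "\<And>c g i. (c, g) \<in> set gs \<Longrightarrow> i \<in> {1..n} \<Longrightarrow> g i \<in> G i"
    "\<And>\<xi>. \<xi> \<in> torus R n \<Longrightarrow> f \<xi> = (\<Sum>(c, g)\<leftarrow>gs. c * (\<Prod>i=1..n. g i (\<xi> i)))"
  shows "f \<in> separable R n G"
  using assms by (auto simp: separable_def intro!: exI[of _ gs])

lemma separable_cong:
  "f \<in> separable R n G \<Longrightarrow> (\<And>\<xi>. \<xi> \<in> torus R n \<Longrightarrow> g \<xi> = f \<xi>) \<Longrightarrow> g \<in> separable R n G"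
  by (auto simp: separable_def)

lemma separable_mono:
  assumes "f \<in> separable R n G" "\<And>i. i \<in> {1..n} \<Longrightarrow> G i \<subseteq> H i"
  shows "f \<in> separable R n H"
  using assms(1) by (rule separableE) (rule separableI, use assms(2) in blast, blast)

lemma separable_prod:
  assumes "\<And>i. i \<in> {1..n} \<Longrightarrow> g i \<in> G i"
  shows "(\<lambda>\<xi>. \<Prod>i=1..n. g i (\<xi> i)) \<in> separable R n G"
  by (rule separableI[of "[(1, g)]"]) (use assms in auto)

lemma separable_zero: "(\<lambda>\<xi>. 0) \<in> separable R n G"
  by (rule separableI[of "[]"]) auto

lemma separable_add:
  assumes "f \<in> separable R n G" "g \<in> separable R n G"
  shows "(\<lambda>\<xi>. f \<xi> + g \<xi>) \<in> separable R n G"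
proof -
  from assms(1) obtain fs where fs: "\<And>c g i. (c, g) \<in> set fs \<Longrightarrow> i \<in> {1..n} \<Longrightarrow> g i \<in> G i"
    "\<And>\<xi>. \<xi> \<in> torus R n \<Longrightarrow> f \<xi> = (\<Sum>(c, g)\<leftarrow>fs. c * (\<Prod>i=1..n. g i (\<xi> i)))"
    by (rule separableE) blast
  from assms(2) obtain gs where gs: "\<And>c g i. (c, g) \<in> set gs \<Longrightarrow> i \<in> {1..n} \<Longrightarrow> g i \<in> G i"
    "\<And>\<xi>. \<xi> \<in> torus R n \<Longrightarrow> g \<xi> = (\<Sum>(c, g)\<leftarrow>gs. c * (\<Prod>i=1..n. g i (\<xi> i)))"
    by (rule separableE) blast
  show ?thesis
    by (rule separableI[of "fs @ gs"]) (use fs gs in auto)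
qed

lemma separable_sum:
  assumes "\<And>a. a \<in> A \<Longrightarrow> f a \<in> separable R n G"
  shows "(\<lambda>\<xi>. \<Sum>a\<in>A. f a \<xi>) \<in> separable R n G"
  using assms by (induction A rule: infinite_finite_induct) (auto intro: separable_zero separable_add)

lemma sum_list_mult_product:
  "(\<Sum>(c, g)\<leftarrow>fs. c * F g) * (\<Sum>(c, g)\<leftarrow>gs. c * F g) =
    (\<Sum>((a, f), (b, g))\<leftarrow>List.product fs gs. a * b * (F f * F g :: 'a :: comm_semiring_1))"
  by (induction fs) (auto simp: split_def distrib_right sum_list_const_mult[symmetric] comp_def algebra_simps)

lemma separable_mult:
  assumes "f \<in> separable R n G" "g \<in> separable R n H"
    and "\<And>i u v. i \<in> {1..n} \<Longrightarrow> u \<in> G i \<Longrightarrow> v \<in> H i \<Longrightarrow> (\<lambda>z. u z * v z) \<in> K i"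
  shows "(\<lambda>\<xi>. f \<xi> * g \<xi>) \<in> separable R n K"
proof -
  from assms(1) obtain fs where fs: "\<And>c g i. (c, g) \<in> set fs \<Longrightarrow> i \<in> {1..n} \<Longrightarrow> g i \<in> G i"
    "\<And>\<xi>. \<xi> \<in> torus R n \<Longrightarrow> f \<xi> = (\<Sum>(c, g)\<leftarrow>fs. c * (\<Prod>i=1..n. g i (\<xi> i)))"
    by (rule separableE) blast
  from assms(2) obtain gs where gs: "\<And>c g i. (c, g) \<in> set gs \<Longrightarrow> i \<in> {1..n} \<Longrightarrow> g i \<in> H i"
    "\<And>\<xi>. \<xi> \<in> torus R n \<Longrightarrow> g \<xi> = (\<Sum>(c, g)\<leftarrow>gs. c * (\<Prod>i=1..n. g i (\<xi> i)))"
    by (rule separableE) blast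
  show ?thesis
  proof (rule separableI)
    show "h i \<in> K i" if "(c, h) \<in> set (map (\<lambda>((a, f), (b, g)). (a * b, \<lambda>i z. f i z * g i z)) (List.product fs gs))"
      "i \<in> {1..n}" for c h i
      using that fs(1) gs(1) assms(3) by auto
    show "f \<xi> * g \<xi> = (\<Sum>(c, h)\<leftarrow>map (\<lambda>((a, f), (b, g)). (a * b, \<lambda>i z. f i z * g i z)) (List.product fs gs).
        c * (\<Prod>i=1..n. h i (\<xi> i)))" if "\<xi> \<in> torus R n" for \<xi>
      using that sum_list_mult_product[of "\<lambda>g. \<Prod>i=1..n. g i (\<xi> i)" fs gs]
      by (simp add: fs(2) gs(2) split_def comp_def prod.distrib)
  qed
qed

lemma separable_coordinate:
  assumes "k \<in> {1..n}" "g \<in> G k" "\<And>i. i \<in> {1..n} \<Longrightarrow> i \<noteq> k \<Longrightarrow> (\<lambda>_. 1) \<in> G i"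
  shows "(\<lambda>\<xi>. g (\<xi> k)) \<in> separable R n G"
proof -
  have "(\<lambda>\<xi>. \<Prod>i=1..n. (if i = k then g else (\<lambda>_. 1)) (\<xi> i)) \<in> separable R n G"
    using assms by (intro separable_prod) auto
  moreover have "(\<Prod>i=1..n. (if i = k then g else (\<lambda>_. 1)) (\<xi> i)) = g (\<xi> k)" for \<xi>
  proof -
    have "(\<Prod>i=1..n. (if i = k then g else (\<lambda>_. 1)) (\<xi> i)) = (\<Prod>i\<in>{1..n}. if i = k then g (\<xi> i) else 1)"
      by (intro prod.cong) auto
    also have "\<dots> = g (\<xi> k)" using assms(1) by (simp add: prod.delta)
    finally show ?thesis .
  qed
  ultimately show ?thesis by simp
qed

lemma separable_const:
  assumes "\<And>i. i \<in> {1..n} \<Longrightarrow> (\<lambda>_. 1) \<in> G i"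
  shows "(\<lambda>\<xi>. c) \<in> separable R n G"
  by (rule separableI[of "[(c, \<lambda>_ _. 1)]"]) (use assms in auto)

lemma separable_scale:
  assumes "f \<in> separable R n G"
  shows "(\<lambda>\<xi>. c * f \<xi>) \<in> separable R n G"
proof -
  from assms obtain fs where fs: "\<And>c g i. (c, g) \<in> set fs \<Longrightarrow> i \<in> {1..n} \<Longrightarrow> g i \<in> G i"
    "\<And>\<xi>. \<xi> \<in> torus R n \<Longrightarrow> f \<xi> = (\<Sum>(c, g)\<leftarrow>fs. c * (\<Prod>i=1..n. g i (\<xi> i)))"
    by (rule separableE) blast
  show ?thesis
    by (rule separableI[of "map (\<lambda>(a, f). (c * a, f)) fs"])
      (use fs in \<open>auto simp: split_def comp_def sum_list_const_mult[symmetric] mult.assoc\<close>)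
qed

section \<open>Iterated integrals of separable functions\<close>

lemma contour_integral_sum_list:
  assumes "\<And>c g. (c, g) \<in> set gs \<Longrightarrow> g contour_integrable_on \<gamma>"
  shows "((\<lambda>z. \<Sum>(c, g)\<leftarrow>gs. c * g z) has_contour_integral (\<Sum>(c, g)\<leftarrow>gs. c * contour_integral \<gamma> g)) \<gamma>"
  using assms
proof (induction gs)
  case Nil
  then show ?case by (simp add: has_contour_integral_0)
next
  case (Cons a gs)
  have "(snd a has_contour_integral contour_integral \<gamma> (snd a)) \<gamma>"
    using Cons.prems[of "fst a" "snd a"] by (intro has_contour_integral_integral) simp
  with Cons show ?case
    by (auto simp: split_def intro!: has_contour_integral_add has_contour_integral_lmul)
qed

text \<open>For a fixed outer variable \<open>z\<close> the factor \<open>g (Suc n) z\<close> is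
  absorbed into the coefficient and the induction hypothesis applies. The result is then read the
  other way round, as a combination of the functions \<open>g (Suc n)\<close> with constant
  coefficients, and is integrated over \<open>z\<close>.\<close>

lemma circles_integral_sum_list:
  assumes "\<And>i. i \<in> {1..n} \<Longrightarrow> 0 < R i"
    and "\<And>c g i. (c, g) \<in> set gs \<Longrightarrow> i \<in> {1..n} \<Longrightarrow> g i \<in> circle_continuous (R i)"
  shows "circles_integral R n (\<lambda>\<xi>. \<Sum>(c, g)\<leftarrow>gs. c * (\<Prod>i=1..n. g i (\<xi> i))) =
    (\<Sum>(c, g)\<leftarrow>gs. c * (\<Prod>i=1..n. contour_integral (circlepath 0 (R i)) (g i)))"
  using assms
proof (induction n arbitrary: gs)
  case 0
  then show ?case by simp
next
  case (Suc n)
  let ?I = "\<lambda>i. contour_integral (circlepath 0 (R i))"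
  have inner: "circles_integral R n (\<lambda>\<xi>. \<Sum>(c, g)\<leftarrow>gs. c * (\<Prod>i=1..Suc n. g i ((\<xi>(Suc n := z)) i))) =
    (\<Sum>(c, h)\<leftarrow>map (\<lambda>(c, g). (c * (\<Prod>i=1..n. ?I i (g i)), g (Suc n))) gs. c * h z)" for z
  proof -
    have "circles_integral R n (\<lambda>\<xi>. \<Sum>(c, g)\<leftarrow>gs. c * (\<Prod>i=1..Suc n. g i ((\<xi>(Suc n := z)) i))) =
      circles_integral R n (\<lambda>\<xi>. \<Sum>(c, g)\<leftarrow>map (\<lambda>(c, g). (c * g (Suc n) z, g)) gs. c * (\<Prod>i=1..n. g i (\<xi> i)))"
      by (intro arg_cong[where f = "circles_integral R n"] ext arg_cong[where f = sum_list])
        (auto simp: prod.nat_ivl_Suc' algebra_simps intro!: prod.cong)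
    also have "\<dots> = (\<Sum>(c, g)\<leftarrow>map (\<lambda>(c, g). (c * g (Suc n) z, g)) gs. c * (\<Prod>i=1..n. ?I i (g i)))"
      using Suc.prems by (intro Suc.IH) auto
    also have "\<dots> = (\<Sum>(c, h)\<leftarrow>map (\<lambda>(c, g). (c * (\<Prod>i=1..n. ?I i (g i)), g (Suc n))) gs. c * h z)"
      by (intro arg_cong[where f = sum_list]) (auto simp: algebra_simps)
    finally show ?thesis .
  qed
  have "((\<lambda>z. \<Sum>(c, h)\<leftarrow>map (\<lambda>(c, g). (c * (\<Prod>i=1..n. ?I i (g i)), g (Suc n))) gs. c * h z) has_contour_integral
    (\<Sum>(c, h)\<leftarrow>map (\<lambda>(c, g). (c * (\<Prod>i=1..n. ?I i (g i)), g (Suc n))) gs. c * ?I (Suc n) h)) (circlepath 0 (R (Suc n)))"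
    using Suc.prems by (intro contour_integral_sum_list) (force intro!: circle_continuous_integrable)
  then have "?I (Suc n) (\<lambda>z. \<Sum>(c, h)\<leftarrow>map (\<lambda>(c, g). (c * (\<Prod>i=1..n. ?I i (g i)), g (Suc n))) gs. c * h z) =
    (\<Sum>(c, h)\<leftarrow>map (\<lambda>(c, g). (c * (\<Prod>i=1..n. ?I i (g i)), g (Suc n))) gs. c * ?I (Suc n) h)"
    by (rule contour_integral_unique)
  also have "\<dots> = (\<Sum>(c, g)\<leftarrow>gs. c * (\<Prod>i=1..Suc n. ?I i (g i)))"
    by (auto intro!: arg_cong[where f = sum_list] simp: prod.nat_ivl_Suc' algebra_simps)
  finally show ?case by (simp only: circles_integral.simps inner)
qed

abbreviation separable_continuous :: "(nat \<Rightarrow> real) \<Rightarrow> nat \<Rightarrow> ((nat \<Rightarrow> complex) \<Rightarrow> complex) set" where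
  "separable_continuous R n \<equiv> separable R n (\<lambda>i. circle_continuous (R i))"

lemma circles_integral_add:
  assumes "\<And>i. i \<in> {1..n} \<Longrightarrow> 0 < R i" "f \<in> separable_continuous R n" "g \<in> separable_continuous R n"
  shows "circles_integral R n (\<lambda>\<xi>. f \<xi> + g \<xi>) = circles_integral R n f + circles_integral R n g"
proof -
  from assms(2) obtain fs where fs: "\<And>c g i. (c, g) \<in> set fs \<Longrightarrow> i \<in> {1..n} \<Longrightarrow> g i \<in> circle_continuous (R i)"
    "\<And>\<xi>. \<xi> \<in> torus R n \<Longrightarrow> f \<xi> = (\<Sum>(c, g)\<leftarrow>fs. c * (\<Prod>i=1..n. g i (\<xi> i)))"
    by (rule separableE) blast
  from assms(3) obtain gs where gs: "\<And>c g i. (c, g) \<in> set gs \<Longrightarrow> i \<in> {1..n} \<Longrightarrow> g i \<in> circle_continuous (R i)"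
    "\<And>\<xi>. \<xi> \<in> torus R n \<Longrightarrow> g \<xi> = (\<Sum>(c, g)\<leftarrow>gs. c * (\<Prod>i=1..n. g i (\<xi> i)))"
    by (rule separableE) blast
  have "circles_integral R n (\<lambda>\<xi>. f \<xi> + g \<xi>) =
      circles_integral R n (\<lambda>\<xi>. \<Sum>(c, g)\<leftarrow>fs @ gs. c * (\<Prod>i=1..n. g i (\<xi> i)))"
    using fs gs assms(1) by (intro circles_integral_cong) auto
  also have "\<dots> = (\<Sum>(c, g)\<leftarrow>fs @ gs. c * (\<Prod>i=1..n. contour_integral (circlepath 0 (R i)) (g i)))"
    using fs gs assms(1) by (intro circles_integral_sum_list) auto
  also have "\<dots> = circles_integral R n (\<lambda>\<xi>. \<Sum>(c, g)\<leftarrow>fs. c * (\<Prod>i=1..n. g i (\<xi> i))) +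
      circles_integral R n (\<lambda>\<xi>. \<Sum>(c, g)\<leftarrow>gs. c * (\<Prod>i=1..n. g i (\<xi> i)))"
    using fs gs assms(1) by (subst (1 2) circles_integral_sum_list) auto
  also have "\<dots> = circles_integral R n f + circles_integral R n g"
    using fs gs assms(1) by (intro arg_cong2[where f = "(+)"] circles_integral_cong) auto
  finally show ?thesis .
qed

lemma circles_integral_scale:
  assumes "\<And>i. i \<in> {1..n} \<Longrightarrow> 0 < R i" "f \<in> separable_continuous R n"
  shows "circles_integral R n (\<lambda>\<xi>. c * f \<xi>) = c * circles_integral R n f"
proof -
  from assms(2) obtain fs where fs: "\<And>c g i. (c, g) \<in> set fs \<Longrightarrow> i \<in> {1..n} \<Longrightarrow> g i \<in> circle_continuous (R i)"
    "\<And>\<xi>. \<xi> \<in> torus R n \<Longrightarrow> f \<xi> = (\<Sum>(c, g)\<leftarrow>fs. c * (\<Prod>i=1..n. g i (\<xi> i)))"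
    by (rule separableE) blast
  have "circles_integral R n (\<lambda>\<xi>. c * f \<xi>) =
      circles_integral R n (\<lambda>\<xi>. \<Sum>(c, g)\<leftarrow>map (\<lambda>(a, g). (c * a, g)) fs. c * (\<Prod>i=1..n. g i (\<xi> i)))"
    using fs assms(1)
    by (intro circles_integral_cong) (auto simp: split_def comp_def sum_list_const_mult[symmetric] mult.assoc)
  also have "\<dots> = (\<Sum>(c, g)\<leftarrow>map (\<lambda>(a, g). (c * a, g)) fs. c * (\<Prod>i=1..n. contour_integral (circlepath 0 (R i)) (g i)))"
    using fs assms(1) by (intro circles_integral_sum_list) auto
  also have "\<dots> = c * (\<Sum>(c, g)\<leftarrow>fs. c * (\<Prod>i=1..n. contour_integral (circlepath 0 (R i)) (g i)))"
    by (simp add: split_def comp_def sum_list_const_mult[symmetric] mult.assoc)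
  also have "\<dots> = c * circles_integral R n (\<lambda>\<xi>. \<Sum>(c, g)\<leftarrow>fs. c * (\<Prod>i=1..n. g i (\<xi> i)))"
    using fs assms(1) by (subst circles_integral_sum_list) auto
  also have "\<dots> = c * circles_integral R n f"
    using fs assms(1) by (intro arg_cong2[where f = "(*)"] circles_integral_cong) auto
  finally show ?thesis .
qed

lemma circles_integral_zero: "(\<And>i. i \<in> {1..n} \<Longrightarrow> 0 < R i) \<Longrightarrow> circles_integral R n (\<lambda>_. 0) = 0"
  using circles_integral_sum_list[of n R "[]"] by simp

lemma circles_integral_sum:
  assumes "\<And>i. i \<in> {1..n} \<Longrightarrow> 0 < R i" "\<And>a. a \<in> A \<Longrightarrow> f a \<in> separable_continuous R n"
  shows "circles_integral R n (\<lambda>\<xi>. \<Sum>a\<in>A. f a \<xi>) = (\<Sum>a\<in>A. circles_integral R n (f a))"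
  using assms(2)
proof (induction A rule: infinite_finite_induct)
  case (insert a A)
  then have "circles_integral R n (\<lambda>\<xi>. f a \<xi> + (\<Sum>a\<in>A. f a \<xi>)) =
      circles_integral R n (f a) + circles_integral R n (\<lambda>\<xi>. \<Sum>a\<in>A. f a \<xi>)"
    by (intro circles_integral_add assms(1) separable_sum) auto
  with insert show ?case by simp
qed (use circles_integral_zero[OF assms(1)] in auto)

lemma circles_integral_prod:
  assumes "\<And>i. i \<in> {1..n} \<Longrightarrow> 0 < R i" "\<And>i. i \<in> {1..n} \<Longrightarrow> g i \<in> circle_continuous (R i)"
  shows "circles_integral R n (\<lambda>\<xi>. \<Prod>i=1..n. g i (\<xi> i)) =
    (\<Prod>i=1..n. contour_integral (circlepath 0 (R i)) (g i))"
  using circles_integral_sum_list[of n R "[(1, g)]"] assms by simp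

text \<open>Every product in the sum has a zero factor at \<open>k\<close>, at whatever depth the
  integral over this coordinate is nested. This takes the place of an exchange of the order of
  integration.\<close>

lemma circles_integral_vanish:
  assumes "\<And>i. i \<in> {1..n} \<Longrightarrow> 0 < R i" "k \<in> {1..n}"
    and "f \<in> separable R n (\<lambda>i. if i = k
      then {g \<in> circle_continuous (R i). contour_integral (circlepath 0 (R i)) g = 0}
      else circle_continuous (R i))"
  shows "circles_integral R n f = 0"
proof -
  from assms(3) obtain fs where fs: "\<And>c g i. (c, g) \<in> set fs \<Longrightarrow> i \<in> {1..n} \<Longrightarrow> g i \<in> (if i = k
      then {g \<in> circle_continuous (R i). contour_integral (circlepath 0 (R i)) g = 0}
      else circle_continuous (R i))"
    "\<And>\<xi>. \<xi> \<in> torus R n \<Longrightarrow> f \<xi> = (\<Sum>(c, g)\<leftarrow>fs. c * (\<Prod>i=1..n. g i (\<xi> i)))"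
    by (rule separableE) blast
  have "circles_integral R n f = circles_integral R n (\<lambda>\<xi>. \<Sum>(c, g)\<leftarrow>fs. c * (\<Prod>i=1..n. g i (\<xi> i)))"
    using fs assms(1) by (intro circles_integral_cong) auto
  also have "\<dots> = (\<Sum>(c, g)\<leftarrow>fs. c * (\<Prod>i=1..n. contour_integral (circlepath 0 (R i)) (g i)))"
    using assms(1)
  proof (intro circles_integral_sum_list)
    show "g i \<in> circle_continuous (R i)" if "(c, g) \<in> set fs" "i \<in> {1..n}" for c g i
      using fs(1)[OF that] by (auto split: if_splits)
  qed auto
  also have "\<dots> = (\<Sum>(c, g)\<leftarrow>fs. 0)"
  proof (intro arg_cong[where f = sum_list] map_cong refl)
    fix x assume x: "x \<in> set fs"
    obtain c g where [simp]: "x = (c, g)" by force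
    have "contour_integral (circlepath 0 (R k)) (g k) = 0" using fs(1)[of c g k] x assms(2) by simp
    then have "(\<Prod>i=1..n. contour_integral (circlepath 0 (R i)) (g i)) = 0"
      using assms(2) by (intro prod_zero) auto
    then show "(case x of (c, g) \<Rightarrow> c * (\<Prod>i=1..n. contour_integral (circlepath 0 (R i)) (g i))) = (case x of (c, g) \<Rightarrow> 0)"
      by simp
  qed
  also have "\<dots> = 0" by (simp add: split_def)
  finally show ?thesis .
qed

text \<open>The bound uses the size of \<open>f\<close> as a whole, which bounds for the single
  products would not give. The representation as a sum only keeps the inner functions separable and
  makes the inner integral integrable in the outer variable.\<close>

lemma circles_integral_bound:
  assumes "\<And>i. i \<in> {1..n} \<Longrightarrow> 0 < R i" "f \<in> separable_continuous R n"
    and "\<And>\<xi>. \<xi> \<in> torus R n \<Longrightarrow> cmod (f \<xi>) \<le> B" "0 \<le> B"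
  shows "cmod (circles_integral R n f) \<le> B * (\<Prod>i=1..n. 2 * pi * R i)"
  using assms
proof (induction n arbitrary: f)
  case 0
  then show ?case using 0(3)[of "\<lambda>_. 0"] by (simp add: torus_def)
next
  case (Suc n)
  have R: "0 < R (Suc n)" using Suc.prems(1)[of "Suc n"] by simp
  let ?r = "R (Suc n)"
  let ?I = "\<lambda>i. contour_integral (circlepath 0 (R i))"
  from Suc.prems(2) obtain fs where fs: "\<And>c g i. (c, g) \<in> set fs \<Longrightarrow> i \<in> {1..Suc n} \<Longrightarrow> g i \<in> circle_continuous (R i)"
    "\<And>\<xi>. \<xi> \<in> torus R (Suc n) \<Longrightarrow> f \<xi> = (\<Sum>(c, g)\<leftarrow>fs. c * (\<Prod>i=1..Suc n. g i (\<xi> i)))"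
    by (rule separableE) blast
  define J where "J z = circles_integral R n (\<lambda>\<xi>. f (\<xi>(Suc n := z)))" for z
  let ?fz = "\<lambda>z. map (\<lambda>(c, g). (c * g (Suc n) z, g)) fs"
  have inner: "f (\<xi>(Suc n := z)) = (\<Sum>(c, g)\<leftarrow>?fz z. c * (\<Prod>i=1..n. g i (\<xi> i)))"
    if "cmod z = ?r" "\<xi> \<in> torus R n" for z \<xi>
  proof -
    have "f (\<xi>(Suc n := z)) = (\<Sum>(c, g)\<leftarrow>fs. c * (\<Prod>i=1..Suc n. g i ((\<xi>(Suc n := z)) i)))"
      using that by (intro fs(2) torus_upd)
    also have "\<dots> = (\<Sum>(c, g)\<leftarrow>?fz z. c * (\<Prod>i=1..n. g i (\<xi> i)))"
      by (intro arg_cong[where f = sum_list])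
        (auto simp: prod.nat_ivl_Suc' algebra_simps intro!: prod.cong)
    finally show ?thesis .
  qed
  have sep: "(\<lambda>\<xi>. f (\<xi>(Suc n := z))) \<in> separable_continuous R n" if "cmod z = ?r" for z
    by (rule separableI[of "?fz z"]) (use fs inner that in auto)
  have bd: "cmod (J z) \<le> B * (\<Prod>i=1..n. 2 * pi * R i)" if "cmod z = ?r" for z
    unfolding J_def using Suc.prems that by (intro Suc.IH sep) (auto intro: torus_upd simp del: fun_upd_apply)
  have J_eq: "J z = (\<Sum>(c, h)\<leftarrow>map (\<lambda>(c, g). (c * (\<Prod>i=1..n. ?I i (g i)), g (Suc n))) fs. c * h z)"
    if "cmod z = ?r" for z
  proof -
    have "J z = circles_integral R n (\<lambda>\<xi>. \<Sum>(c, g)\<leftarrow>?fz z. c * (\<Prod>i=1..n. g i (\<xi> i)))"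
      unfolding J_def using Suc.prems(1) that by (intro circles_integral_cong inner) auto
    also have "\<dots> = (\<Sum>(c, g)\<leftarrow>?fz z. c * (\<Prod>i=1..n. ?I i (g i)))"
      using Suc.prems fs by (intro circles_integral_sum_list) auto
    also have "\<dots> = (\<Sum>(c, h)\<leftarrow>map (\<lambda>(c, g). (c * (\<Prod>i=1..n. ?I i (g i)), g (Suc n))) fs. c * h z)"
      by (intro arg_cong[where f = sum_list]) (auto simp: algebra_simps)
    finally show ?thesis .
  qed
  have "(\<lambda>z. \<Sum>(c, h)\<leftarrow>map (\<lambda>(c, g). (c * (\<Prod>i=1..n. ?I i (g i)), g (Suc n))) fs. c * h z) contour_integrable_on circlepath 0 ?r"
    using fs R by (intro has_contour_integral_integrable[OF contour_integral_sum_list])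
      (force intro!: circle_continuous_integrable)
  then have "J contour_integrable_on circlepath 0 ?r"
    by (rule contour_integrable_eq) (use R in \<open>auto simp: J_eq\<close>)
  then have "cmod (?I (Suc n) J) \<le> B * (\<Prod>i=1..n. 2 * pi * R i) * (2 * pi * ?r)"
    using R Suc.prems(1,4) bd
    by (intro has_contour_integral_bound_circlepath[OF has_contour_integral_integral])
      (auto intro!: mult_nonneg_nonneg prod_nonneg simp: less_imp_le)
  then show ?case by (simp add: J_def[abs_def] prod.nat_ivl_Suc' algebra_simps)
qed

section \<open>Integrals of one variable\<close>

lemma continuous_on_power_int_circle: "0 < r \<Longrightarrow> (\<lambda>z. z powi m) \<in> circle_continuous r"
  by (auto simp: circle_continuous_def intro!: continuous_intros)

lemma contour_integral_power_int:
  assumes "0 < r"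
  shows "contour_integral (circlepath 0 r) (\<lambda>z. z powi (m - 1)) = (if m = 0 then 2 * of_real pi * \<i> else 0)"
proof (cases "m = 0")
  case True
  then show ?thesis using contour_integral_circlepath[OF assms, of 0]
    by (simp add: power_int_minus divide_inverse)
next
  case False
  have "((\<lambda>z. z powi (m - 1)) has_contour_integral 0) (circlepath 0 r)"
  proof (rule Cauchy_theorem_primitive)
    show "((\<lambda>z. z powi m / of_int m) has_field_derivative z powi (m - 1)) (at z within - {0})"
      if "z \<in> - {0}" for z :: complex
      using that False by (auto intro!: derivative_eq_intros)
  qed (use assms in auto)
  then show ?thesis using False by (simp add: contour_integral_unique)
qed

text \<open>These are the functions of one coordinate that occur in the amplitudes: numerators of
  \<open>T_coeff\<close> are polynomials in \<open>1 / z\<close>, and its denominators give powers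
  of \<open>1 - 1 / z\<close>. Outside the unit disc they are power series in
  \<open>1 / z\<close>.\<close>

definition inverse_poly :: "nat \<Rightarrow> nat \<Rightarrow> (complex \<Rightarrow> complex) set" where
  "inverse_poly d b = {g. \<exists>P. degree P \<le> d \<and> g = (\<lambda>z. poly P (1 / z) / (1 - 1 / z) ^ b)}"

lemma inverse_poly_mult:
  assumes "g \<in> inverse_poly d b" "h \<in> inverse_poly e c"
  shows "(\<lambda>z. g z * h z) \<in> inverse_poly (d + e) (b + c)"
proof -
  from assms obtain P Q where "degree P \<le> d" "degree Q \<le> e"
    "g = (\<lambda>z. poly P (1 / z) / (1 - 1 / z) ^ b)" "h = (\<lambda>z. poly Q (1 / z) / (1 - 1 / z) ^ c)"
    by (auto simp: inverse_poly_def)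
  then show ?thesis
    unfolding inverse_poly_def using degree_mult_le[of P Q]
    by (auto intro!: exI[of _ "P * Q"] simp: power_add fun_eq_iff)
qed

lemma inverse_poly_one: "(\<lambda>z. 1) \<in> inverse_poly d 0"
  by (auto simp: inverse_poly_def intro!: exI[of _ 1])

lemma inverse_poly_mono: "d \<le> e \<Longrightarrow> inverse_poly d b \<subseteq> inverse_poly e b"
  by (auto simp: inverse_poly_def intro: order_trans)

lemma inverse_poly_inverse: "(\<lambda>z. 1 / z) \<in> inverse_poly 1 0"
  by (auto simp: inverse_poly_def intro!: exI[of _ "[:0, 1:]"])

lemma inverse_poly_geometric: "(\<lambda>z. 1 / (1 - 1 / z)) \<in> inverse_poly 0 1"
  by (auto simp: inverse_poly_def intro!: exI[of _ 1])

lemma inverse_poly_continuous: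
  assumes "1 < r" "g \<in> inverse_poly d b"
  shows "g \<in> circle_continuous r"
proof -
  have "z \<noteq> 0" "1 - 1 / z \<noteq> 0" if "cmod z = r" for z
    using that assms(1) by auto
  then show ?thesis using assms(2)
    by (auto simp: inverse_poly_def circle_continuous_def intro!: continuous_intros)
qed

text \<open>Since \<open>1 / (1 - z\<^sup>-\<^sup>1) = 1 + z\<^sup>-\<^sup>1 / (1 - z\<^sup>-\<^sup>1)\<close>, the integral does not change when the exponent
  is lowered by one, and it tends to zero when the exponent goes to \<open>-\<infinity>\<close>.\<close>

lemma contour_integral_geometric_eq_0:
  assumes "1 < r" "m < 0"
  shows "contour_integral (circlepath 0 r) (\<lambda>z. z powi (m - 1) / (1 - 1 / z) ^ b) = 0"
  using assms(2)
proof (induction b arbitrary: m)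
  case 0
  then show ?case using contour_integral_power_int[of r m] assms(1) by simp
next
  case (Suc b)
  let ?h = "\<lambda>m b z. z powi (m - 1) / (1 - 1 / z) ^ b :: complex"
  let ?I = "contour_integral (circlepath 0 r)"
  have nz: "z \<noteq> 0" "1 - 1 / z \<noteq> 0" if "cmod z = r" for z
    using that assms(1) by auto
  have int: "?h m b contour_integrable_on circlepath 0 r" for m b
    using nz assms(1)
    by (intro circle_continuous_integrable) (auto simp: circle_continuous_def intro!: continuous_intros)
  have step: "?I (?h m (Suc b)) = ?I (?h (m - 1) (Suc b))" if "m < 0" for m
  proof -
    have "?h m (Suc b) z = ?h m b z + ?h (m - 1) (Suc b) z" if "cmod z = r" for z
    proof -
      have "z powi (m - 1) = z powi (m - 1 - 1) * z"
        using nz[OF that] by (simp add: power_int_diff power2_eq_square)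
      then have "z powi (m - 1 - 1) = z powi (m - 1) * (1 / z)" using nz[OF that] by simp
      then show ?thesis
        using nz[OF that] by (simp add: divide_simps) (simp add: algebra_simps)
    qed
    then have "?I (?h m (Suc b)) = ?I (\<lambda>z. ?h m b z + ?h (m - 1) (Suc b) z)"
      using assms(1) by (intro contour_integral_cong) auto
    also have "\<dots> = ?I (?h m b) + ?I (?h (m - 1) (Suc b))"
      by (intro contour_integral_add int)
    finally show ?thesis using Suc.IH[OF that] by simp
  qed
  have const: "?I (?h m (Suc b)) = ?I (?h (m - int k) (Suc b))" for k
  proof (induction k)
    case (Suc k)
    have "m - int k < 0" using \<open>m < 0\<close> by simp
    from step[OF this] Suc show ?case by (simp add: algebra_simps)
  qed simp
  define C where "C = r powi (m - 1) * (1 / (1 - 1 / r)) ^ Suc b * (2 * pi * r)"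
  have bound: "cmod (?I (?h m (Suc b))) \<le> C * (1 / r) ^ k" for k
  proof -
    have "cmod (?I (?h (m - int k) (Suc b))) \<le> (r powi (m - int k - 1) * (1 / (1 - 1 / r)) ^ Suc b) * (2 * pi * r)"
    proof (rule has_contour_integral_bound_circlepath[OF has_contour_integral_integral[OF int]])
      fix z :: complex assume "cmod (z - 0) = r"
      then have z: "cmod z = r" by simp
      \<comment> \<open>On the circle \<open>1 - 1 / z\<close> stays away from zero, so that only
        the factor \<open>(1 / r) ^ k\<close> of the bound depends on \<open>k\<close>.\<close>
      have "1 - 1 / r \<le> cmod (1 - 1 / z)"
        using norm_triangle_ineq2[of 1 "1 / z"] z by (simp add: norm_divide)
      then have "1 / cmod (1 - 1 / z) \<le> 1 / (1 - 1 / r)"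
        using assms(1) by (intro divide_left_mono) (auto intro!: mult_pos_pos simp: nz[OF z])
      then have "(1 / cmod (1 - 1 / z)) ^ Suc b \<le> (1 / (1 - 1 / r)) ^ Suc b"
        by (intro power_mono) auto
      then have "r powi (m - int k - 1) * (1 / cmod (1 - 1 / z)) ^ Suc b \<le> r powi (m - int k - 1) * (1 / (1 - 1 / r)) ^ Suc b"
        using assms(1) by (intro mult_left_mono) auto
      then show "cmod (?h (m - int k) (Suc b) z) \<le> r powi (m - int k - 1) * (1 / (1 - 1 / r)) ^ Suc b"
        using z by (simp add: norm_divide norm_power_int norm_power power_divide del: power_Suc)
    qed (use assms(1) in auto)
    also have "r powi (m - int k - 1) = r powi (m - 1) * (1 / r) ^ k"
      using assms(1) power_int_diff[of r "m - 1" "int k"]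
      by (simp add: power_divide diff_diff_eq add.commute)
    finally show ?thesis using const[of k] by (simp add: C_def mult_ac)
  qed
  have "(\<lambda>k. C * (1 / r) ^ k) \<longlonglongrightarrow> C * 0"
    using assms(1) by (intro tendsto_intros LIMSEQ_power_zero) auto
  then have "cmod (?I (?h m (Suc b))) \<le> 0"
    using bound by (intro LIMSEQ_le_const[of "\<lambda>k. C * (1 / r) ^ k"]) auto
  then show ?case by simp
qed

lemma contour_integral_inverse_poly_expand:
  assumes "1 < r" "degree P \<le> d"
  shows "contour_integral (circlepath 0 r) (\<lambda>z. poly P (1 / z) / (1 - 1 / z) ^ b * z powi (m - 1)) =
    (\<Sum>a\<le>d. coeff P a * contour_integral (circlepath 0 r) (\<lambda>z. z powi (m - int a - 1) / (1 - 1 / z) ^ b))"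
proof -
  have nz: "z \<noteq> 0" "1 - 1 / z \<noteq> 0" if "cmod z = r" for z
    using that assms(1) by auto
  have "poly P (1 / z) / (1 - 1 / z) ^ b * z powi (m - 1) =
    (\<Sum>a\<le>d. coeff P a * (z powi (m - int a - 1) / (1 - 1 / z) ^ b))" if "cmod z = r" for z
  proof -
    have poly: "poly P (1 / z) = (\<Sum>a\<le>d. coeff P a * (1 / z) ^ a)"
      using assms(2) unfolding poly_altdef
      by (intro sum.mono_neutral_left) (auto simp: coeff_eq_0)
    have "(1 / z) ^ a * z powi (m - 1) = z powi (m - int a - 1)" for a
      using nz[OF that] power_int_diff[of z "m - 1" "int a"]
      by (simp add: power_one_over diff_right_commute field_simps)
    then have eq: "coeff P a * (1 / z) ^ a / (1 - 1 / z) ^ b * z powi (m - 1) =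
        coeff P a * (z powi (m - int a - 1) / (1 - 1 / z) ^ b)" for a
    proof -
      have "coeff P a * (1 / z) ^ a / (1 - 1 / z) ^ b * z powi (m - 1) =
          coeff P a * ((1 / z) ^ a * z powi (m - 1)) / (1 - 1 / z) ^ b" by simp
      then show ?thesis using \<open>\<And>a. (1 / z) ^ a * z powi (m - 1) = z powi (m - int a - 1)\<close> by simp
    qed
    show ?thesis
      unfolding poly sum_divide_distrib sum_distrib_right by (intro sum.cong refl eq)
  qed
  then have "contour_integral (circlepath 0 r) (\<lambda>z. poly P (1 / z) / (1 - 1 / z) ^ b * z powi (m - 1)) =
    contour_integral (circlepath 0 r) (\<lambda>z. \<Sum>a\<le>d. coeff P a * (z powi (m - int a - 1) / (1 - 1 / z) ^ b))"
    using assms(1) by (intro contour_integral_cong) auto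
  also have "\<dots> = (\<Sum>a\<le>d. coeff P a * contour_integral (circlepath 0 r) (\<lambda>z. z powi (m - int a - 1) / (1 - 1 / z) ^ b))"
    using assms(1) nz
    by (intro contour_integral_unique has_contour_integral_sum has_contour_integral_lmul has_contour_integral_integral
      circle_continuous_integrable) (auto simp: circle_continuous_def intro!: continuous_intros)
  finally show ?thesis .
qed

lemma contour_integral_inverse_poly_neg:
  assumes "1 < r" "g \<in> inverse_poly d b" "m < 0"
  shows "contour_integral (circlepath 0 r) (\<lambda>z. g z * z powi (m - 1)) = 0"
proof -
  from assms(2) obtain P where P: "degree P \<le> d" "g = (\<lambda>z. poly P (1 / z) / (1 - 1 / z) ^ b)"
    by (auto simp: inverse_poly_def)
  with contour_integral_inverse_poly_expand[OF assms(1) P(1), of b m] show ?thesis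
    using assms by (simp add: contour_integral_geometric_eq_0)
qed

text \<open>All exponents \<open>m - a - 1\<close> with \<open>a \<le> d\<close> are nonnegative, so
  the integrand is a polynomial. The exponent \<open>0\<close> in \<open>inverse_poly d 0\<close>
  excludes the pole at \<open>z = 1\<close>, which lies inside the circle.\<close>

lemma contour_integral_inverse_poly_gt:
  assumes "1 < r" "g \<in> inverse_poly d 0" "int d < m"
  shows "contour_integral (circlepath 0 r) (\<lambda>z. g z * z powi (m - 1)) = 0"
proof -
  from assms(2) obtain P where P: "degree P \<le> d" "g = (\<lambda>z. poly P (1 / z))"
    by (auto simp: inverse_poly_def)
  with contour_integral_inverse_poly_expand[OF assms(1) P(1), of 0 m] show ?thesis
    using assms by (simp add: contour_integral_power_int)
qed

section \<open>The Bethe ansatz\<close>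

text \<open>In the coordinate \<open>k\<close> the degree is recorded and no denominator is allowed;
  in the other coordinates both are arbitrary. As \<open>0\<close> is not a coordinate,
  \<open>k = 0\<close> imposes no restriction at all.\<close>

definition rational_except :: "nat \<Rightarrow> nat \<Rightarrow> nat \<Rightarrow> (complex \<Rightarrow> complex) set" where
  "rational_except k d i = (if i = k then inverse_poly d 0 else (\<Union>e b. inverse_poly e b))"

lemma rational_except_mult:
  "g \<in> rational_except k d i \<Longrightarrow> h \<in> rational_except k e i \<Longrightarrow> (\<lambda>z. g z * h z) \<in> rational_except k (d + e) i"
  using inverse_poly_mult[of g d 0 h e 0] inverse_poly_mult[of g _ _ h]
  by (cases "i = k") (auto simp: rational_except_def, blast)

lemma rational_except_one: "(\<lambda>_. 1) \<in> rational_except k d i"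
  using inverse_poly_one by (auto simp: rational_except_def)

lemma rational_except_mono: "d \<le> e \<Longrightarrow> rational_except k d i \<subseteq> rational_except k e i"
  using inverse_poly_mono by (auto simp: rational_except_def)

text \<open>The denominator of \<open>T_coeff \<xi> \<beta> \<alpha>\<close> involves only the
  coordinate \<open>\<beta>\<close>. For \<open>\<beta> \<noteq> k\<close> it is therefore harmless,
  and the numerator has degree one in \<open>1 / \<xi> k\<close> just when
  \<open>\<alpha> = k\<close>.\<close>

lemma separable_T_coeff:
  assumes "\<alpha> \<in> {1..N}" "\<beta> \<in> {1..N}" "\<beta> \<noteq> k"
  shows "(\<lambda>\<xi>. T_coeff \<xi> \<beta> \<alpha>) \<in> separable R N (rational_except k (if \<alpha> = k then 1 else 0))"
proof -
  let ?d = "if \<alpha> = k then 1 else 0 :: nat"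
  have inv_mem: "(\<lambda>z. 1 / z) \<in> rational_except k (if i = k then 1 else 0) i" for i
    using inverse_poly_inverse by (auto simp: rational_except_def)
  have \<alpha>: "(\<lambda>\<xi>. 1 / \<xi> \<alpha>) \<in> separable R N (rational_except k ?d)"
    using assms inv_mem by (intro separable_coordinate[of \<alpha>] rational_except_one)
  have \<beta>: "(\<lambda>\<xi>. 1 / \<xi> \<beta>) \<in> separable R N (rational_except k ?d)"
    using assms inv_mem[of \<beta>] rational_except_mono[of 0 ?d k \<beta>]
    by (intro separable_coordinate[of \<beta>] rational_except_one) auto
  have g: "(\<lambda>\<xi>. 1 / (1 - 1 / \<xi> \<beta>)) \<in> separable R N (rational_except k 0)"
    using assms inverse_poly_geometric
    by (intro separable_coordinate[of \<beta> N "\<lambda>z. 1 / (1 - 1 / z)"] rational_except_one)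
      (auto simp: rational_except_def)
  have "(\<lambda>\<xi>. 1 / \<xi> \<alpha> * (1 / (1 - 1 / \<xi> \<beta>)) + (- 1) * (1 / \<xi> \<beta> * (1 / (1 - 1 / \<xi> \<beta>))))
      \<in> separable R N (rational_except k ?d)"
    using rational_except_mult[of _ k ?d _ _ 0]
    by (intro separable_add separable_scale separable_mult[OF \<alpha> g] separable_mult[OF \<beta> g]) auto
  then show ?thesis
    by (rule separable_cong) (simp add: T_coeff_def diff_divide_distrib)
qed

text \<open>As long as only letters above \<open>k\<close> are exchanged, no coefficient contains
  \<open>\<xi> k\<close>, and the degree stays zero.\<close>

lemma separable_fold_row_step:
  assumes "set ls \<subseteq> {Suc k..<N}" "\<rho> permutes {Suc k..N}"
    and "\<And>w. (\<lambda>\<xi>. \<phi> \<xi> w) \<in> separable R N (rational_except k 0)"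
  shows "(\<lambda>\<xi>. snd (fold (row_step \<xi>) ls (\<rho>, \<phi> \<xi>)) v) \<in> separable R N (rational_except k 0)"
  using assms
proof (induction ls arbitrary: \<rho> \<phi>)
  case (Cons l ls)
  have l: "l \<in> {Suc k..N}" "l + 1 \<in> {Suc k..N}" using Cons.prems by auto
  then have \<rho>: "\<rho> l \<in> {Suc k..N}" "\<rho> (l + 1) \<in> {Suc k..N}"
    using permutes_in_image[OF Cons.prems(2)] by auto
  have "(\<lambda>\<xi>. snd (fold (row_step \<xi>) ls (\<rho> \<circ> Transposition.transpose l (l + 1),
      \<lambda>w. T_coeff \<xi> (\<rho> l) (\<rho> (l + 1)) * \<phi> \<xi> (sort_at l w) - \<phi> \<xi> w)) v) \<in> separable R N (rational_except k 0)"
  proof (rule Cons.IH)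
    show "\<rho> \<circ> Transposition.transpose l (l + 1) permutes {Suc k..N}"
      using l Cons.prems by (intro permutes_compose permutes_swap_id)
    fix w
    have "(\<lambda>\<xi>. T_coeff \<xi> (\<rho> l) (\<rho> (l + 1))) \<in> separable R N (rational_except k 0)"
      using separable_T_coeff[of "\<rho> (l + 1)" N "\<rho> l" k R] \<rho> by auto
    then have "(\<lambda>\<xi>. T_coeff \<xi> (\<rho> l) (\<rho> (l + 1)) * \<phi> \<xi> (sort_at l w) + (- 1) * \<phi> \<xi> w)
        \<in> separable R N (rational_except k 0)"
      using rational_except_mult[of _ k 0 _ _ 0] Cons.prems(3)
      by (intro separable_add separable_scale separable_mult) auto
    then show "(\<lambda>\<xi>. T_coeff \<xi> (\<rho> l) (\<rho> (l + 1)) * \<phi> \<xi> (sort_at l w) - \<phi> \<xi> w)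
        \<in> separable R N (rational_except k 0)" by simp
  qed (use Cons.prems in auto)
  then show ?case by (simp add: row_step_def[of _ l])
qed simp

lemma torus_ne:
  assumes "\<xi> \<in> torus R N" "\<And>i. i \<in> {1..N} \<Longrightarrow> 1 < R i"
  shows "\<xi> i \<noteq> 1" "i \<in> {1..N} \<Longrightarrow> \<xi> i \<noteq> 0"
proof -
  show "\<xi> i \<noteq> 1"
    using assms by (cases "i \<in> {1..N}") (force simp: torus_def)+
  show "\<xi> i \<noteq> 0" if "i \<in> {1..N}"
    using assms that by (force simp: torus_def)
qed

text \<open>Each transposition that moves the letter \<open>k\<close> one place to the right raises the degree in
  \<open>1 / \<xi> k\<close> by at most one.\<close>

lemma separable_row_amp:
  assumes "\<And>i. i \<in> {1..N} \<Longrightarrow> 1 < R i" "1 \<le> k" "\<sigma> permutes {k..N}" "\<sigma> (k + d) = k" "k + d \<le> N"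
  shows "(\<lambda>\<xi>. row_amp N \<xi> \<sigma> \<phi> v) \<in> separable R N (rational_except k d)"
  using assms(3-)
proof (induction d arbitrary: \<sigma> \<phi>)
  case 0
  \<comment> \<open>For \<open>d = 0\<close> the letter \<open>k\<close> is fixed too, so there is
    an expression that exchanges only letters above \<open>k\<close>.\<close>
  then have \<sigma>: "\<sigma> permutes {Suc k..N}"
    by (intro permutes_superset[OF 0(1)]) (auto simp: not_le Suc_le_eq le_less)
  then obtain ls where ls: "set ls \<subseteq> {Suc k..<N}" "expr_perm ls = \<sigma>"
    using ex_expr_perm by blast
  then have ls': "set ls \<subseteq> {1..N - 1}" by fastforce
  have "(\<lambda>\<xi>. snd (fold (row_step \<xi>) ls (\<sigma>, \<phi>)) v) \<in> separable R N (rational_except k 0)"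
    using ls \<sigma> by (intro separable_fold_row_step separable_const rational_except_one)
  then show ?case
  proof (rule separable_cong)
    fix \<xi> assume "\<xi> \<in> torus R N"
    then have "\<xi> i \<noteq> 1" for i using assms(1) by (rule torus_ne)
    from row_amp_expr[OF this ls', where \<phi> = \<phi>] show "row_amp N \<xi> \<sigma> \<phi> v = snd (fold (row_step \<xi>) ls (\<sigma>, \<phi>)) v"
      by (simp add: ls)
  qed
next
  case (Suc d)
  let ?l = "k + d"
  let ?s = "Transposition.transpose ?l (?l + 1)"
  let ?\<sigma> = "\<sigma> \<circ> ?s"
  have \<sigma>: "?\<sigma> permutes {k..N}" using Suc.prems by (intro permutes_compose permutes_swap_id) auto
  then have \<sigma>1: "?\<sigma> permutes {1..N}" using assms(2) by (auto intro: permutes_subset)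
  have k: "?\<sigma> ?l = k" using Suc.prems by simp
  define \<beta> where "\<beta> = ?\<sigma> (?l + 1)"
  have \<beta>: "\<beta> \<in> {k..N}" unfolding \<beta>_def using permutes_in_image[OF \<sigma>, of "?l + 1"] Suc.prems by auto
  \<comment> \<open>The letter that \<open>k\<close> passes is the first index of the coefficient,
    hence \<open>k\<close> never occurs in a denominator.\<close>
  have "\<beta> \<noteq> k" unfolding \<beta>_def using k injD[OF permutes_inj[OF \<sigma>], of "?l + 1" ?l] by auto
  have IH: "(\<lambda>\<xi>. row_amp N \<xi> ?\<sigma> \<phi> v) \<in> separable R N (rational_except k d)" for \<phi>
    by (rule Suc.IH[OF \<sigma> k]) (use Suc.prems in simp)
  have T: "(\<lambda>\<xi>. T_coeff \<xi> \<beta> k) \<in> separable R N (rational_except k 1)"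
    using separable_T_coeff[of k N \<beta> k R] \<beta> \<open>\<beta> \<noteq> k\<close> assms(2) Suc.prems by auto
  have "(\<lambda>\<xi>. T_coeff \<xi> \<beta> k * row_amp N \<xi> ?\<sigma> (\<lambda>w. \<phi> (sort_at ?l w)) v + (- 1) * row_amp N \<xi> ?\<sigma> \<phi> v)
      \<in> separable R N (rational_except k (Suc d))"
    using rational_except_mult[of _ k 1 _ _ d] rational_except_mono[of d "Suc d" k]
    by (intro separable_add separable_scale separable_mult[OF T IH] separable_mono[OF IH]) auto
  then show ?case
  proof (rule separable_cong)
    fix \<xi> assume "\<xi> \<in> torus R N"
    then have ne: "\<xi> i \<noteq> 1" for i using assms(1) by (rule torus_ne)
    have "row_amp N \<xi> (?\<sigma> \<circ> ?s) \<phi> v =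
        T_coeff \<xi> \<beta> k * row_amp N \<xi> ?\<sigma> (\<lambda>w. \<phi> (sort_at ?l w)) v - row_amp N \<xi> ?\<sigma> \<phi> v"
      unfolding \<beta>_def using row_amp_swap'[OF ne \<sigma>1, where l = ?l and \<phi> = \<phi> and w = v] assms(2) Suc.prems k by auto
    then show "row_amp N \<xi> \<sigma> \<phi> v =
        T_coeff \<xi> \<beta> k * row_amp N \<xi> ?\<sigma> (\<lambda>w. \<phi> (sort_at ?l w)) v + (- 1) * row_amp N \<xi> ?\<sigma> \<phi> v"
      by (simp add: comp_assoc)
  qed
qed

lemma separable_row_amp':
  assumes "\<And>i. i \<in> {1..N} \<Longrightarrow> 1 < R i" "\<sigma> permutes {1..N}"
  shows "(\<lambda>\<xi>. row_amp N \<xi> \<sigma> \<phi> v) \<in> separable R N (rational_except 0 0)"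
proof -
  obtain ls where ls: "set ls \<subseteq> {1..<N}" "expr_perm ls = \<sigma>"
    using ex_expr_perm assms(2) by blast
  then have ls': "set ls \<subseteq> {1..N - 1}" by fastforce
  have "(\<lambda>\<xi>. snd (fold (row_step \<xi>) ls (\<sigma>, \<phi>)) v) \<in> separable R N (rational_except 0 0)"
    using ls assms(2) by (intro separable_fold_row_step separable_const rational_except_one) auto
  then show ?thesis
  proof (rule separable_cong)
    fix \<xi> assume "\<xi> \<in> torus R N"
    then have "\<xi> i \<noteq> 1" for i using assms(1) by (rule torus_ne)
    from row_amp_expr[OF this ls', where \<phi> = \<phi>] show "row_amp N \<xi> \<sigma> \<phi> v = snd (fold (row_step \<xi>) ls (\<sigma>, \<phi>)) v"
      by (simp add: ls)
  qed
qed

section \<open>The wave function, the free equation and the boundary condition\<close>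

locale bethe =
  fixes N :: nat and p q :: real and Y :: "nat \<Rightarrow> int" and v :: "nat list" and R :: "nat \<Rightarrow> real"
  assumes R_gt: "i \<in> {1..N} \<Longrightarrow> 1 < R i"
    and Y_mono: "strict_mono_on {1..N} Y"
begin

definition energy :: "(nat \<Rightarrow> complex) \<Rightarrow> complex" where
  "energy \<xi> = (\<Sum>i=1..N. of_real p / \<xi> i + of_real q * \<xi> i)"

definition plane_wave :: "(nat \<Rightarrow> nat) \<Rightarrow> (nat \<Rightarrow> int) \<Rightarrow> (nat \<Rightarrow> complex) \<Rightarrow> complex" where
  "plane_wave \<sigma> X \<xi> = (\<Prod>i=1..N. \<xi> (\<sigma> i) powi (X i - Y (\<sigma> i) - 1))"

text \<open>The tuple \<open>X\<close> need not be strictly increasing. The free equation produces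
  values outside the set of states, and the boundary condition is what gives them a meaning.\<close>

definition wave :: "(nat \<Rightarrow> int) \<Rightarrow> (nat list \<Rightarrow> complex) \<Rightarrow> (nat \<Rightarrow> complex) \<Rightarrow> complex" where
  "wave X \<phi> \<xi> = (\<Sum>\<sigma> | \<sigma> permutes {1..N}. row_amp N \<xi> \<sigma> \<phi> v * plane_wave \<sigma> X \<xi>)"

definition moment :: "nat \<Rightarrow> (nat \<Rightarrow> int) \<Rightarrow> (nat list \<Rightarrow> complex) \<Rightarrow> complex" where
  "moment n X \<phi> = circles_integral R N (\<lambda>\<xi>. wave X \<phi> \<xi> * energy \<xi> ^ n)"

lemma R_pos: "i \<in> {1..N} \<Longrightarrow> 0 < R i"
  using R_gt[of i] by simp

text \<open>Ordering the factors by letter instead of by position yields one function per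
  coordinate, which is the form required of a separable function.\<close>

lemma plane_wave_inv:
  assumes "\<sigma> permutes {1..N}"
  shows "plane_wave \<sigma> X \<xi> = (\<Prod>k=1..N. \<xi> k powi (X (inv \<sigma> k) - Y k - 1))"
  unfolding plane_wave_def
  using prod.permute[OF assms, of "\<lambda>k. \<xi> k powi (X (inv \<sigma> k) - Y k - 1)"] permutes_inverses(2)[OF assms]
  by (simp add: comp_def)

lemma plane_wave_shift:
  assumes "\<sigma> permutes {1..N}" "i \<in> {1..N}" "\<xi> (\<sigma> i) \<noteq> 0"
  shows "plane_wave \<sigma> (X(i := X i + m)) \<xi> = \<xi> (\<sigma> i) powi m * plane_wave \<sigma> X \<xi>"
proof -
  have "plane_wave \<sigma> (X(i := X i + m)) \<xi> =
      (\<Prod>j=1..N. (if j = i then \<xi> (\<sigma> i) powi m else 1) * \<xi> (\<sigma> j) powi (X j - Y (\<sigma> j) - 1))"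
    unfolding plane_wave_def using assms(3)
    by (intro prod.cong refl) (auto simp: power_int_add[symmetric] algebra_simps)
  then show ?thesis using assms(2) by (simp add: prod.distrib plane_wave_def)
qed

lemma rational_continuous: "i \<in> {1..N} \<Longrightarrow> rational_except k d i \<subseteq> circle_continuous (R i)"
  using inverse_poly_continuous[OF R_gt] by (auto simp: rational_except_def split: if_splits)

lemma separable_plane_wave:
  assumes "\<sigma> permutes {1..N}"
  shows "plane_wave \<sigma> X \<in> separable_continuous R N"
proof -
  have "(\<lambda>\<xi>. \<Prod>k=1..N. (\<lambda>z. z powi (X (inv \<sigma> k) - Y k - 1)) (\<xi> k)) \<in> separable_continuous R N"
    using R_pos by (intro separable_prod continuous_on_power_int_circle)
  then show ?thesis by (rule separable_cong) (simp add: plane_wave_inv[OF assms])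
qed

lemma separable_continuous_mult:
  "f \<in> separable_continuous R N \<Longrightarrow> g \<in> separable_continuous R N \<Longrightarrow>
    (\<lambda>\<xi>. f \<xi> * g \<xi>) \<in> separable_continuous R N"
  by (rule separable_mult) (auto intro: circle_continuous_mult)

lemma separable_row_amp_continuous:
  "\<sigma> permutes {1..N} \<Longrightarrow> (\<lambda>\<xi>. row_amp N \<xi> \<sigma> \<phi> v) \<in> separable_continuous R N"
  using rational_continuous R_gt by (intro separable_mono[OF separable_row_amp']) auto

lemma separable_wave: "wave X \<phi> \<in> separable_continuous R N"
  unfolding wave_def
  by (intro separable_sum separable_continuous_mult separable_row_amp_continuous) (auto intro: separable_plane_wave)

lemma separable_energy: "energy \<in> separable_continuous R N"
proof -
  have "(\<lambda>\<xi>. (\<lambda>z. of_real p / z + of_real q * z) (\<xi> i)) \<in> separable_continuous R N" if "i \<in> {1..N}" for i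
    using that R_pos[OF that] by (intro separable_coordinate) (auto simp: circle_continuous_def intro!: continuous_intros)
  then show ?thesis unfolding energy_def by (intro separable_sum) auto
qed

lemma separable_power:
  "f \<in> separable_continuous R N \<Longrightarrow> (\<lambda>\<xi>. f \<xi> ^ n) \<in> separable_continuous R N"
proof (induction n)
  case 0
  have "(\<lambda>\<xi>. 1) \<in> separable_continuous R N"
    by (intro separable_const) (simp add: circle_continuous_def)
  then show ?case by simp
qed (simp add: separable_continuous_mult)

lemma energy_permute: "\<sigma> permutes {1..N} \<Longrightarrow> energy \<xi> = (\<Sum>i=1..N. of_real p / \<xi> (\<sigma> i) + of_real q * \<xi> (\<sigma> i))"
  unfolding energy_def using sum.permute[of \<sigma> "{1..N}" "\<lambda>i. of_real p / \<xi> i + of_real q * \<xi> i"] by (simp add: comp_def)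

text \<open>A factor \<open>1 / \<xi> (\<sigma> i)\<close> or \<open>\<xi> (\<sigma> i)\<close>
  shifts \<open>X i\<close> by \<open>-1\<close> or \<open>1\<close>. As \<open>energy\<close> is
  symmetric, its sum over letters may be taken over positions, so the same equation holds for every
  \<sigma> and passes to the sum.\<close>

lemma wave_energy:
  assumes "\<xi> \<in> torus R N"
  shows "wave X \<phi> \<xi> * energy \<xi> =
    (\<Sum>i=1..N. p * wave (X(i := X i - 1)) \<phi> \<xi> + q * wave (X(i := X i + 1)) \<phi> \<xi>)"
proof -
  have "plane_wave \<sigma> X \<xi> * energy \<xi> =
      (\<Sum>i=1..N. p * plane_wave \<sigma> (X(i := X i - 1)) \<xi> + q * plane_wave \<sigma> (X(i := X i + 1)) \<xi>)"
    if \<sigma>: "\<sigma> permutes {1..N}" for \<sigma>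
  proof -
    have "\<xi> (\<sigma> i) \<noteq> 0" if "i \<in> {1..N}" for i
      using torus_ne(2)[OF assms R_gt] permutes_in_image[OF \<sigma>] that by auto
    then show ?thesis unfolding energy_permute[OF \<sigma>] sum_distrib_left
      using plane_wave_shift[OF \<sigma>, of _ \<xi> X "-1"] plane_wave_shift[OF \<sigma>, of _ \<xi> X 1]
      by (intro sum.cong refl) (auto simp: power_int_minus field_simps)
  qed
  then have "wave X \<phi> \<xi> * energy \<xi> = (\<Sum>\<sigma> | \<sigma> permutes {1..N}. row_amp N \<xi> \<sigma> \<phi> v *
      (\<Sum>i=1..N. p * plane_wave \<sigma> (X(i := X i - 1)) \<xi> + q * plane_wave \<sigma> (X(i := X i + 1)) \<xi>))"
    unfolding wave_def sum_distrib_right by (intro sum.cong refl) (auto simp: mult.assoc)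
  also have "\<dots> = (\<Sum>i=1..N. p * wave (X(i := X i - 1)) \<phi> \<xi> + q * wave (X(i := X i + 1)) \<phi> \<xi>)"
    unfolding wave_def sum_distrib_left sum.distrib[symmetric]
    by (subst sum.swap) (simp add: algebra_simps)
  finally show ?thesis .
qed

lemma separable_wave_energy: "(\<lambda>\<xi>. wave X \<phi> \<xi> * energy \<xi> ^ n) \<in> separable_continuous R N"
  by (intro separable_continuous_mult separable_wave separable_power separable_energy)

lemma moment_Suc:
  "moment (Suc n) X \<phi> = (\<Sum>i=1..N. p * moment n (X(i := X i - 1)) \<phi> + q * moment n (X(i := X i + 1)) \<phi>)"
proof -
  have "moment (Suc n) X \<phi> = circles_integral R N (\<lambda>\<xi>. \<Sum>i=1..N.
      p * (wave (X(i := X i - 1)) \<phi> \<xi> * energy \<xi> ^ n) + q * (wave (X(i := X i + 1)) \<phi> \<xi> * energy \<xi> ^ n))"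
    unfolding moment_def
  proof (intro circles_integral_cong R_pos)
    fix \<xi> assume "\<xi> \<in> torus R N"
    from wave_energy[OF this] show "wave X \<phi> \<xi> * energy \<xi> ^ Suc n = (\<Sum>i=1..N.
      p * (wave (X(i := X i - 1)) \<phi> \<xi> * energy \<xi> ^ n) + q * (wave (X(i := X i + 1)) \<phi> \<xi> * energy \<xi> ^ n))"
      by (simp add: mult.assoc[symmetric] sum_distrib_right distrib_right)
  qed
  also have "\<dots> = (\<Sum>i=1..N. circles_integral R N (\<lambda>\<xi>.
      p * (wave (X(i := X i - 1)) \<phi> \<xi> * energy \<xi> ^ n) + q * (wave (X(i := X i + 1)) \<phi> \<xi> * energy \<xi> ^ n)))"
    by (intro circles_integral_sum R_pos separable_add separable_scale separable_wave_energy)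
  also have "\<dots> = (\<Sum>i=1..N. p * moment n (X(i := X i - 1)) \<phi> + q * moment n (X(i := X i + 1)) \<phi>)"
    unfolding moment_def
    by (intro sum.cong refl, subst circles_integral_add)
      (auto intro!: R_pos separable_scale separable_wave_energy arg_cong2[where f = "(+)"] circles_integral_scale)
  finally show ?thesis .
qed

lemma plane_wave_transpose:
  assumes "l \<in> {1..<N}"
  shows "plane_wave (\<sigma> \<circ> Transposition.transpose l (l + 1)) X \<xi> =
    plane_wave \<sigma> (X \<circ> Transposition.transpose l (l + 1)) \<xi>"
proof -
  have "Transposition.transpose l (l + 1) permutes {1..N}"
    using assms by (intro permutes_swap_id) auto
  from prod.permute[OF this, of "\<lambda>i. \<xi> (\<sigma> i) powi (X (Transposition.transpose l (l + 1) i) - Y (\<sigma> i) - 1)"]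
  show ?thesis by (simp add: plane_wave_def comp_def)
qed

text \<open>The contributions of \<open>\<sigma>\<close> and \<open>\<sigma> \<circ> (l l+1)\<close> to the two sides agree; the summation over all
  \<open>\<sigma>\<close> counts each such pair twice.\<close>

lemma wave_boundary:
  assumes \<xi>: "\<xi> \<in> torus R N" and l: "l \<in> {1..<N}" and X: "X (l + 1) = X l"
  shows "wave X \<phi> \<xi> = wave (X(l := X l - 1)) (\<lambda>w. \<phi> (sort_at l w)) \<xi>"
proof -
  let ?s = "Transposition.transpose l (l + 1)"
  let ?P = "{\<sigma>. \<sigma> permutes {1..N}}"
  define X' where "X' = X(l := X l - 1)"
  have ne1: "\<xi> i \<noteq> 1" for i using torus_ne[OF \<xi> R_gt] by blast
  have l': "l \<in> {1..N - 1}" using l by auto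
  have s: "?s permutes {1..N}" using l by (intro permutes_swap_id) auto
  have twice: "2 * sum f ?P = (\<Sum>\<sigma>\<in>?P. f \<sigma> + f (\<sigma> \<circ> ?s))" for f :: "_ \<Rightarrow> complex"
  proof -
    have "sum f ?P = (\<Sum>\<sigma>\<in>?P. f (\<sigma> \<circ> ?s))"
      using s by (intro sum.reindex_bij_witness[of _ "\<lambda>\<sigma>. \<sigma> \<circ> ?s" "\<lambda>\<sigma>. \<sigma> \<circ> ?s"])
        (auto simp: comp_assoc intro: permutes_compose)
    then show ?thesis by (simp add: sum.distrib)
  qed
  have pair: "row_amp N \<xi> \<sigma> \<phi> v * plane_wave \<sigma> X \<xi> + row_amp N \<xi> (\<sigma> \<circ> ?s) \<phi> v * plane_wave (\<sigma> \<circ> ?s) X \<xi> =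
      row_amp N \<xi> \<sigma> (\<lambda>w. \<phi> (sort_at l w)) v * plane_wave \<sigma> X' \<xi> +
      row_amp N \<xi> (\<sigma> \<circ> ?s) (\<lambda>w. \<phi> (sort_at l w)) v * plane_wave (\<sigma> \<circ> ?s) X' \<xi>"
    if \<sigma>: "\<sigma> permutes {1..N}" for \<sigma>
  proof -
    define \<alpha> \<beta> where "\<alpha> = \<sigma> l" and "\<beta> = \<sigma> (l + 1)"
    have "\<alpha> \<in> {1..N}" "\<beta> \<in> {1..N}"
      unfolding \<alpha>_def \<beta>_def using permutes_in_image[OF \<sigma>] l by auto
    then have ne0: "\<xi> \<alpha> \<noteq> 0" "\<xi> \<beta> \<noteq> 0" using torus_ne(2)[OF \<xi> R_gt] by auto
    define F where "F = row_amp N \<xi> \<sigma> \<phi> v"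
    define G where "G = row_amp N \<xi> \<sigma> (\<lambda>w. \<phi> (sort_at l w)) v"
    define T where "T = T_coeff \<xi> \<beta> \<alpha>"
    define M where "M = plane_wave \<sigma> X \<xi>"
    \<comment> \<open>Because the two coordinates agree, the plane waves of both permutations
      coincide at \<open>X\<close>.\<close>
    have "X \<circ> ?s = X" using X by (auto simp: fun_eq_iff Transposition.transpose_def)
    then have M1: "plane_wave (\<sigma> \<circ> ?s) X \<xi> = M" using plane_wave_transpose[OF l, of \<sigma> X \<xi>] by (simp add: M_def)
    have M2: "plane_wave \<sigma> X' \<xi> = M / \<xi> \<alpha>"
      using plane_wave_shift[OF \<sigma>, of l \<xi> X "-1"] l ne0 by (simp add: X'_def M_def \<alpha>_def power_int_minus field_simps)
    have "X' \<circ> ?s = X(l + 1 := X (l + 1) - 1)"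
      using X by (auto simp: fun_eq_iff X'_def Transposition.transpose_def)
    then have M3: "plane_wave (\<sigma> \<circ> ?s) X' \<xi> = M / \<xi> \<beta>"
      using plane_wave_shift[OF \<sigma>, of "l + 1" \<xi> X "-1"] plane_wave_transpose[OF l, of \<sigma> X' \<xi>] l ne0
      by (simp add: M_def \<beta>_def power_int_minus field_simps)
    have F1: "row_amp N \<xi> (\<sigma> \<circ> ?s) \<phi> v = T * G - F"
      using row_amp_swap'[where \<xi> = \<xi>, OF ne1 \<sigma> l', where \<phi> = \<phi> and w = v] l by (simp add: T_def \<alpha>_def \<beta>_def F_def G_def)
    have G1: "row_amp N \<xi> (\<sigma> \<circ> ?s) (\<lambda>w. \<phi> (sort_at l w)) v = T * G - G"
      using row_amp_swap'[where \<xi> = \<xi>, OF ne1 \<sigma> l', where \<phi> = "\<lambda>w. \<phi> (sort_at l w)" and w = v] l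
      by (simp add: T_def \<alpha>_def \<beta>_def G_def sort_at_idem)
    \<comment> \<open>This determines \<open>T_coeff\<close>. At \<open>X\<close> the pair
      contributes \<open>T * G * M\<close>, the terms with \<open>F\<close> having cancelled. At
      \<open>X'\<close> it contributes \<open>G * M / \<xi> \<alpha>\<close> and, since sorting
      twice is sorting once, \<open>(T - 1) * G * M / \<xi> \<beta>\<close>.\<close>
    have "T * (1 - 1 / \<xi> \<beta>) = 1 / \<xi> \<alpha> - 1 / \<xi> \<beta>"
      using ne1[of \<beta>] ne0 by (simp add: T_def T_coeff_def)
    then have T: "T = 1 / \<xi> \<alpha> + (T - 1) / \<xi> \<beta>" by (simp add: algebra_simps diff_divide_distrib)
    have "F * M + (T * G - F) * M = T * (G * M)" by (simp add: algebra_simps)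
    also have "\<dots> = (1 / \<xi> \<alpha> + (T - 1) / \<xi> \<beta>) * (G * M)" using T by simp
    also have "\<dots> = G * (M / \<xi> \<alpha>) + (T * G - G) * (M / \<xi> \<beta>)" by (simp add: algebra_simps diff_divide_distrib)
    finally show ?thesis unfolding M1 M2 M3 F1 G1 by (simp add: F_def G_def M_def)
  qed
  have "2 * wave X \<phi> \<xi> = 2 * wave X' (\<lambda>w. \<phi> (sort_at l w)) \<xi>"
    unfolding wave_def twice by (intro sum.cong refl pair) auto
  then show ?thesis by (simp add: X'_def)
qed

lemma moment_boundary:
  assumes "l \<in> {1..<N}" "X (l + 1) = X l"
  shows "moment n X \<phi> = moment n (X(l := X l - 1)) (\<lambda>w. \<phi> (sort_at l w))"
  unfolding moment_def by (intro circles_integral_cong R_pos) (auto simp: wave_boundary[OF _ assms])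

lemma plane_wave_integral_eq_0:
  assumes X: "strict_mono_on {1..N} X" and \<sigma>: "\<sigma> permutes {1..N}" "\<sigma> \<noteq> id"
  shows "circles_integral R N (\<lambda>\<xi>. row_amp N \<xi> \<sigma> \<phi> v * plane_wave \<sigma> X \<xi>) = 0"
proof -
  define k where "k = (LEAST i. \<sigma> i \<noteq> i)"
  obtain i where "\<sigma> i \<noteq> i" using \<sigma>(2) by (auto simp: fun_eq_iff)
  then have k: "\<sigma> k \<noteq> k" unfolding k_def by (rule LeastI[of "\<lambda>i. \<sigma> i \<noteq> i"])
  have less: "\<sigma> i = i" if "i < k" for i using not_less_Least[of i "\<lambda>i. \<sigma> i \<noteq> i"] that k_def by auto
  have kN: "k \<in> {1..N}" using k permutes_not_in[OF \<sigma>(1), of k] by blast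
  have \<sigma>k: "\<sigma> permutes {k..N}"
    using less by (intro permutes_superset[OF \<sigma>(1)]) (auto simp: not_le)
  define j where "j = inv \<sigma> k"
  define m where "m = \<sigma> k"
  have j: "\<sigma> j = k" unfolding j_def using permutes_inverses[OF \<sigma>(1)] by simp
  have "j \<in> {k..N}" using permutes_in_image[OF \<sigma>k, of j] j kN by simp
  then have jk: "k < j" "j \<le> N" using j k by (auto simp: le_less)
  have "m \<in> {k..N}" using permutes_in_image[OF \<sigma>k, of k] kN by (simp add: m_def)
  then have mk: "k < m" "m \<le> N" using k by (auto simp: m_def le_less)
  have invm: "inv \<sigma> m = k" unfolding m_def using permutes_inverses[OF \<sigma>(1)] by simp
  let ?g = "\<lambda>i (z :: complex). z powi (X (inv \<sigma> i) - Y i - 1)"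
  have vanish: "circles_integral R N (\<lambda>\<xi>. row_amp N \<xi> \<sigma> \<phi> v * plane_wave \<sigma> X \<xi>) = 0"
    if i0: "i0 \<in> {1..N}" and zero: "\<And>g. g \<in> rational_except k (j - k) i0 \<Longrightarrow>
      contour_integral (circlepath 0 (R i0)) (\<lambda>z. g z * ?g i0 z) = 0" for i0
  proof (rule circles_integral_vanish[OF R_pos i0])
    have amp: "(\<lambda>\<xi>. row_amp N \<xi> \<sigma> \<phi> v) \<in> separable R N (rational_except k (j - k))"
      using R_gt \<sigma>k jk j kN by (intro separable_row_amp) auto
    have wave: "plane_wave \<sigma> X \<in> separable R N (\<lambda>i. {?g i})"
      by (rule separable_cong[OF separable_prod[of N "\<lambda>i. ?g i"]]) (auto simp: plane_wave_inv[OF \<sigma>(1)])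
    show "(\<lambda>\<xi>. row_amp N \<xi> \<sigma> \<phi> v * plane_wave \<sigma> X \<xi>) \<in> separable R N (\<lambda>i. if i = i0
      then {g \<in> circle_continuous (R i). contour_integral (circlepath 0 (R i)) g = 0} else circle_continuous (R i))"
    proof (rule separable_mult[OF amp wave])
      fix i u w assume i: "i \<in> {1..N}" and u: "u \<in> rational_except k (j - k) i" and w: "w \<in> {?g i}"
      have "(\<lambda>z. u z * w z) \<in> circle_continuous (R i)"
        using i u w rational_continuous[OF i] continuous_on_power_int_circle[OF R_pos[OF i]]
        by (intro circle_continuous_mult) auto
      then show "(\<lambda>z. u z * w z) \<in> (if i = i0
        then {g \<in> circle_continuous (R i). contour_integral (circlepath 0 (R i)) g = 0} else circle_continuous (R i))"
        using zero u w by auto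
    qed
  qed
  have mono: "1 \<le> a \<Longrightarrow> a \<le> b \<Longrightarrow> Z a + (int b - int a) \<le> Z b"
    if Z: "strict_mono_on {1..N} Z" "b \<le> N" for Z :: "nat \<Rightarrow> int" and a b
  proof (induction "b - a" arbitrary: a)
    case (Suc d a)
    have "Z a < Z (Suc a)" using Z Suc.prems Suc.hyps(2) by (intro strict_mono_onD[OF Z(1)]) auto
    moreover have "Z (Suc a) + (int b - int (Suc a)) \<le> Z b"
      using Suc.hyps(2) by (intro Suc.hyps(1)) auto
    ultimately show ?case by simp
  qed auto
  have "X k + (int j - int k) \<le> X j" "Y k + (int m - int k) \<le> Y m"
    using mono[OF X, of j k] mono[OF Y_mono, of m k] kN jk mk by auto
  \<comment> \<open>If \<open>X k \<ge> Y m\<close>, the gaps of the two increasing tuples give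
    \<open>X j - Y k \<ge> (j - k) + (m - k)\<close>, which exceeds the degree \<open>j - k\<close>
    of the amplitude in \<open>1 / \<xi> k\<close>. Otherwise the plane wave has exponent at most
    \<open>-2\<close> in \<open>\<xi> m\<close>, and the amplitude only lowers it further.\<close>
  then consider "X k - Y m < 0" | "int (j - k) < X j - Y k" using mk jk by linarith
  then show ?thesis
  proof cases
    case 1
    show ?thesis
    proof (rule vanish[of m])
      show "m \<in> {1..N}" using mk by auto
      fix g assume "g \<in> rational_except k (j - k) m"
      then show "contour_integral (circlepath 0 (R m)) (\<lambda>z. g z * ?g m z) = 0"
        using 1 mk R_gt[of m] contour_integral_inverse_poly_neg[of "R m" g _ _ "X k - Y m"]
        by (auto simp: rational_except_def invm)
    qed
  next
    case 2
    show ?thesis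
    proof (rule vanish[OF kN])
      fix g assume "g \<in> rational_except k (j - k) k"
      then show "contour_integral (circlepath 0 (R k)) (\<lambda>z. g z * ?g k z) = 0"
        using 2 R_gt[OF kN] contour_integral_inverse_poly_gt[of "R k" g "j - k" "X j - Y k"]
        by (auto simp: rational_except_def j_def[symmetric])
    qed
  qed
qed

lemma moment_0:
  assumes X: "strict_mono_on {1..N} X"
  shows "moment 0 X \<phi> = (if \<forall>i\<in>{1..N}. X i = Y i then (2 * of_real pi * \<i>) ^ N * \<phi> v else 0)"
proof -
  let ?P = "{\<sigma>. \<sigma> permutes {1..N}}"
  let ?f = "\<lambda>\<sigma> \<xi>. row_amp N \<xi> \<sigma> \<phi> v * plane_wave \<sigma> X \<xi>"
  have "moment 0 X \<phi> = (\<Sum>\<sigma>\<in>?P. circles_integral R N (?f \<sigma>))"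
    unfolding moment_def wave_def power_0 mult_1_right
    by (intro circles_integral_sum R_pos separable_continuous_mult separable_row_amp_continuous)
      (auto intro: separable_plane_wave)
  also have "\<dots> = (\<Sum>\<sigma>\<in>?P. if \<sigma> = id then circles_integral R N (?f id) else 0)"
    using plane_wave_integral_eq_0[OF X] by (intro sum.cong) auto
  also have "\<dots> = circles_integral R N (?f id)"
    by (simp add: sum.delta finite_permutations permutes_id del: id_apply)
  also have "\<dots> = circles_integral R N (\<lambda>\<xi>. \<phi> v * plane_wave id X \<xi>)"
    using torus_ne(1)[OF _ R_gt] by (intro circles_integral_cong R_pos) (auto simp: row_amp_id)
  also have "\<dots> = \<phi> v * circles_integral R N (plane_wave id X)"
    using permutes_id by (intro circles_integral_scale R_pos separable_plane_wave)
  also have "circles_integral R N (plane_wave id X) =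
      circles_integral R N (\<lambda>\<xi>. \<Prod>i=1..N. (\<lambda>z. z powi (X i - Y i - 1)) (\<xi> i))"
    by (simp add: plane_wave_def[abs_def])
  also have "\<dots> = (\<Prod>i=1..N. contour_integral (circlepath 0 (R i)) (\<lambda>z. z powi (X i - Y i - 1)))"
    using R_pos by (intro circles_integral_prod continuous_on_power_int_circle)
  also have "\<dots> = (\<Prod>i=1..N. if X i - Y i = 0 then 2 * of_real pi * \<i> else 0)"
    using R_pos by (intro prod.cong refl contour_integral_power_int)
  also have "\<dots> = (if \<forall>i\<in>{1..N}. X i = Y i then (2 * of_real pi * \<i>) ^ N else 0)"
    by (auto intro: prod_zero)
  finally show ?thesis by simp
qed

end

section \<open>Expansion in powers of the time\<close>

text \<open>Comparison term by term. The bound depends on \<open>z\<close> only through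
  \<open>B\<close>, hence it is uniform on a torus.\<close>

lemma norm_exp_tail_le:
  fixes z :: complex
  assumes "cmod z \<le> B"
  shows "cmod (exp z - (\<Sum>m<M. z ^ m / fact m)) \<le> exp B - (\<Sum>m<M. B ^ m / fact m)"
proof -
  have 1: "(\<lambda>m. z ^ m / fact m) sums exp z"
    using exp_converges[of z] by (simp add: scaleR_conv_of_real divide_inverse mult.commute)
  have 2: "(\<lambda>m. B ^ m / fact m) sums exp B"
    using exp_converges[of B] by (simp add: divide_inverse mult.commute)
  show ?thesis
  proof (rule norm_sums_le[OF sums_split_initial_segment[OF 1, of M] sums_split_initial_segment[OF 2, of M]])
    show "cmod (z ^ (m + M) / fact (m + M)) \<le> B ^ (m + M) / fact (m + M)" for m
      unfolding norm_divide norm_power norm_fact using assms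
      by (intro divide_right_mono power_mono) simp_all
  qed
qed

lemma separable_bounded:
  assumes "f \<in> separable_continuous R n"
  shows "\<exists>B\<ge>0. \<forall>\<xi>\<in>torus R n. cmod (f \<xi>) \<le> B"
proof -
  from assms obtain gs where gs: "\<And>c g i. (c, g) \<in> set gs \<Longrightarrow> i \<in> {1..n} \<Longrightarrow> g i \<in> circle_continuous (R i)"
    "\<And>\<xi>. \<xi> \<in> torus R n \<Longrightarrow> f \<xi> = (\<Sum>(c, g)\<leftarrow>gs. c * (\<Prod>i=1..n. g i (\<xi> i)))"
    by (rule separableE) blast
  have "\<exists>B\<ge>0. \<forall>\<xi>\<in>torus R n. cmod (\<Sum>(c, g)\<leftarrow>gs. c * (\<Prod>i=1..n. g i (\<xi> i))) \<le> B"
    using gs(1)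
  proof (induction gs)
    case Nil
    then show ?case by auto
  next
    case (Cons x gs)
    obtain c g where x: "x = (c, g)" by force
    have "\<exists>B\<ge>0. \<forall>\<xi>\<in>torus R n. cmod (\<Sum>(c, g)\<leftarrow>gs. c * (\<Prod>i=1..n. g i (\<xi> i))) \<le> B"
    proof (rule Cons.IH)
      show "g i \<in> circle_continuous (R i)" if "(c, g) \<in> set gs" "i \<in> {1..n}" for c g i
        using Cons.prems[of c g i] that by simp
    qed
    then obtain B where B: "B \<ge> 0" "\<And>\<xi>. \<xi> \<in> torus R n \<Longrightarrow> cmod (\<Sum>(c, g)\<leftarrow>gs. c * (\<Prod>i=1..n. g i (\<xi> i))) \<le> B"
      by blast
    have "\<exists>b. \<forall>z\<in>sphere 0 (R i). cmod (g i z) \<le> b" if "i \<in> {1..n}" for i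
    proof -
      have "continuous_on (sphere 0 (R i)) (g i)"
        using Cons.prems[of c g i] that by (simp add: x circle_continuous_def)
      then have "bounded (g i ` sphere 0 (R i))"
        by (intro compact_imp_bounded compact_continuous_image compact_sphere)
      then show ?thesis unfolding bounded_iff by blast
    qed
    then have "\<forall>i\<in>{1..n}. \<exists>b. \<forall>z\<in>sphere 0 (R i). cmod (g i z) \<le> b" by blast
    then obtain b' where "\<forall>i\<in>{1..n}. \<forall>z\<in>sphere 0 (R i). cmod (g i z) \<le> b' i"
      by (rule bchoice[THEN exE])
    then have b: "cmod (g i z) \<le> b' i" if "i \<in> {1..n}" "cmod z = R i" for i z
      using that by simp
    have "cmod (\<Prod>i=1..n. g i (\<xi> i)) \<le> \<bar>\<Prod>i=1..n. b' i\<bar>" if "\<xi> \<in> torus R n" for \<xi>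
    proof -
      have "cmod (\<Prod>i=1..n. g i (\<xi> i)) \<le> (\<Prod>i=1..n. b' i)"
        unfolding prod_norm[symmetric] using that b by (intro prod_mono) (auto simp: torus_def)
      then show ?thesis by linarith
    qed
    then have "cmod (\<Sum>(c, g)\<leftarrow>x # gs. c * (\<Prod>i=1..n. g i (\<xi> i))) \<le> cmod c * \<bar>\<Prod>i=1..n. b' i\<bar> + B"
      if "\<xi> \<in> torus R n" for \<xi>
      unfolding x using that B(2)[OF that]
      by (simp, intro norm_triangle_mono) (auto simp: norm_mult intro!: mult_left_mono)
    then show ?case using B(1) by (intro exI[of _ "cmod c * \<bar>\<Prod>i=1..n. b' i\<bar> + B"]) auto
  qed
  then show ?thesis using gs(2) by simp
qed

text \<open>Sum and integral are exchanged without a limit theorem for integrals: the remainder of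
  the exponential series is uniformly small on the torus, and \<open>circles_integral_bound\<close>
  carries this through all integrals at once.\<close>

lemma circles_integral_exp_sums:
  assumes R: "\<And>i. i \<in> {1..n} \<Longrightarrow> 0 < R i"
    and f: "f \<in> separable_continuous R n" and e: "e \<in> separable_continuous R n"
    and fe: "\<And>m. (\<lambda>\<xi>. f \<xi> * e \<xi> ^ m) \<in> separable_continuous R n"
    and fexp: "(\<lambda>\<xi>. f \<xi> * exp (e \<xi>)) \<in> separable_continuous R n"
  shows "(\<lambda>m. circles_integral R n (\<lambda>\<xi>. f \<xi> * e \<xi> ^ m) / fact m) sums circles_integral R n (\<lambda>\<xi>. f \<xi> * exp (e \<xi>))"
proof -
  obtain W where W: "W \<ge> 0" "\<And>\<xi>. \<xi> \<in> torus R n \<Longrightarrow> cmod (f \<xi>) \<le> W"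
    using separable_bounded[OF f] by auto
  obtain B where B: "B \<ge> 0" "\<And>\<xi>. \<xi> \<in> torus R n \<Longrightarrow> cmod (e \<xi>) \<le> B"
    using separable_bounded[OF e] by auto
  let ?L = "circles_integral R n"
  define C where "C = (\<Prod>i=1..n. 2 * pi * R i)"
  define r where "r M = exp B - (\<Sum>m<M. B ^ m / fact m)" for M
  have bound: "cmod (?L (\<lambda>\<xi>. f \<xi> * exp (e \<xi>)) - (\<Sum>m<M. ?L (\<lambda>\<xi>. f \<xi> * e \<xi> ^ m) / fact m)) \<le> W * r M * C" for M
  proof -
    have sep: "(\<lambda>\<xi>. \<Sum>m<M. (- 1 / fact m) * (f \<xi> * e \<xi> ^ m)) \<in> separable_continuous R n"
      by (intro separable_sum separable_scale fe)
    have "?L (\<lambda>\<xi>. f \<xi> * exp (e \<xi>)) - (\<Sum>m<M. ?L (\<lambda>\<xi>. f \<xi> * e \<xi> ^ m) / fact m) =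
        ?L (\<lambda>\<xi>. f \<xi> * exp (e \<xi>)) + (\<Sum>m<M. ?L (\<lambda>\<xi>. (- 1 / fact m) * (f \<xi> * e \<xi> ^ m)))"
      by (subst circles_integral_scale[OF R fe]) (auto simp: sum_negf)
    also have "\<dots> = ?L (\<lambda>\<xi>. f \<xi> * exp (e \<xi>) + (\<Sum>m<M. (- 1 / fact m) * (f \<xi> * e \<xi> ^ m)))"
      by (subst circles_integral_add[OF R fexp sep], simp, subst circles_integral_sum[OF R separable_scale[OF fe]]) auto
    also have "cmod \<dots> \<le> W * r M * (\<Prod>i=1..n. 2 * pi * R i)"
    proof (rule circles_integral_bound[OF R separable_add[OF fexp sep]])
      have "cmod 0 \<le> B" using B by simp
      from norm_exp_tail_le[OF this, of M] have "0 \<le> r M" by (smt (verit) norm_ge_zero r_def)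
      then show "0 \<le> W * r M" using W by simp
      fix \<xi> assume \<xi>: "\<xi> \<in> torus R n"
      have "f \<xi> * exp (e \<xi>) + (\<Sum>m<M. (- 1 / fact m) * (f \<xi> * e \<xi> ^ m)) =
          f \<xi> * (exp (e \<xi>) - (\<Sum>m<M. e \<xi> ^ m / fact m))"
        by (simp add: right_diff_distrib sum_distrib_left sum_negf)
      also have "cmod \<dots> \<le> W * r M"
        unfolding norm_mult r_def using W(2)[OF \<xi>] norm_exp_tail_le[OF B(2)[OF \<xi>]] W(1)
        by (intro mult_mono) auto
      finally show "cmod (f \<xi> * exp (e \<xi>) + (\<Sum>m<M. (- 1 / fact m) * (f \<xi> * e \<xi> ^ m))) \<le> W * r M" .
    qed auto
    finally show ?thesis by (simp add: C_def)
  qed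
  have "(\<lambda>m. B ^ m / fact m) sums exp B"
    using exp_converges[of B] by (simp add: divide_inverse mult.commute)
  then have "(\<lambda>M. W * r M * C) \<longlonglongrightarrow> W * (exp B - exp B) * C"
    unfolding r_def sums_def by (intro tendsto_intros)
  then have "(\<lambda>M. W * r M * C) \<longlonglongrightarrow> 0" by simp
  then have "(\<lambda>M. ?L (\<lambda>\<xi>. f \<xi> * exp (e \<xi>)) - (\<Sum>m<M. ?L (\<lambda>\<xi>. f \<xi> * e \<xi> ^ m) / fact m)) \<longlonglongrightarrow> 0"
    by (rule Lim_null_comparison[rotated]) (use bound in auto)
  from tendsto_diff[OF tendsto_const[of "?L (\<lambda>\<xi>. f \<xi> * exp (e \<xi>))"] this]
  show ?thesis unfolding sums_def by simp
qed

lemma (in bethe) separable_exp_energy: "(\<lambda>\<xi>. exp (of_real t * energy \<xi>)) \<in> separable_continuous R N"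
proof -
  have "(\<lambda>\<xi>. \<Prod>i=1..N. (\<lambda>z. exp (of_real t * (of_real p / z + of_real q * z))) (\<xi> i)) \<in> separable_continuous R N"
    using R_pos by (intro separable_prod) (force simp: circle_continuous_def intro!: continuous_intros)
  then show ?thesis
    by (rule separable_cong) (simp add: energy_def sum_distrib_left exp_sum)
qed

lemma (in bethe) moment_exp_sums:
  "(\<lambda>m. of_real t ^ m / fact m * moment m X \<phi>) sums
    circles_integral R N (\<lambda>\<xi>. wave X \<phi> \<xi> * exp (of_real t * energy \<xi>))"
proof -
  let ?e = "\<lambda>\<xi>. of_real t * energy \<xi>"
  have e: "?e \<in> separable_continuous R N" by (intro separable_scale separable_energy)
  have "(\<lambda>m. circles_integral R N (\<lambda>\<xi>. wave X \<phi> \<xi> * ?e \<xi> ^ m) / fact m) sums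
      circles_integral R N (\<lambda>\<xi>. wave X \<phi> \<xi> * exp (?e \<xi>))"
    by (intro circles_integral_exp_sums R_pos separable_wave e separable_continuous_mult separable_power separable_exp_energy)
  moreover have "circles_integral R N (\<lambda>\<xi>. wave X \<phi> \<xi> * ?e \<xi> ^ m) / fact m = of_real t ^ m / fact m * moment m X \<phi>" for m
    using circles_integral_scale[OF R_pos separable_wave_energy[of X \<phi> m], of "of_real t ^ m"]
    by (simp add: moment_def power_mult_distrib mult_ac)
  ultimately show ?thesis by simp
qed

section \<open>The moves in terms of positions and words\<close>

definition names :: "nat \<Rightarrow> (nat \<Rightarrow> int) \<Rightarrow> config \<Rightarrow> nat list" where
  "names N X c = map (\<lambda>i. c (X i)) [1..<Suc N]"

text \<open>The condition on multisets says that every name occurs exactly once, so a sum over the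
  particles that may ring can be rewritten as a sum over positions.\<close>

definition occupies :: "nat \<Rightarrow> (nat \<Rightarrow> int) \<Rightarrow> config \<Rightarrow> bool" where
  "occupies N X c \<longleftrightarrow> strict_mono_on {1..N} X \<and> {x. c x \<noteq> 0} = X ` {1..N} \<and>
    mset (names N X c) = mset [1..<Suc N]"

lemma length_names [simp]: "length (names N X c) = N"
  by (simp add: names_def)

lemma nth_names: "i < N \<Longrightarrow> names N X c ! i = c (X (Suc i))"
  by (simp add: names_def del: upt_Suc)

lemma set_upt_Suc: "set [a..<Suc b] = {a..b}"
  by auto

lemma strict_mono_on_image_eq:
  fixes X Z :: "nat \<Rightarrow> int"
  assumes "strict_mono_on {1..N} X" "strict_mono_on {1..N} Z" "X ` {1..N} = Z ` {1..N}" "i \<in> {1..N}"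
  shows "X i = Z i"
proof -
  have sorted: "sorted (map X [1..<Suc N])" "distinct (map X [1..<Suc N])"
    if "strict_mono_on {1..N} X" for X :: "nat \<Rightarrow> int"
  proof -
    have mono: "mono_on (set [1..<Suc N]) X" using strict_mono_on_imp_mono_on[OF that] by (simp only: set_upt_Suc)
    show "sorted (map X [1..<Suc N])"
      unfolding sorted_map by (rule sorted_wrt_mono_rel[OF _ sorted_upt]) (rule mono_onD[OF mono])
    show "distinct (map X [1..<Suc N])"
      using strict_mono_on_imp_inj_on[OF that] by (simp add: distinct_map set_upt_Suc del: upt_Suc set_upt)
  qed
  have "map X [1..<Suc N] = map Z [1..<Suc N]"
    using assms(3) by (intro sorted_distinct_set_unique sorted assms(1,2)) (simp add: set_upt_Suc del: upt_Suc set_upt)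
  then show ?thesis using assms(4) by (simp add: set_upt_Suc del: upt_Suc set_upt)
qed

lemma occupies_names:
  assumes "occupies N X c"
  shows "distinct (names N X c)" "set (names N X c) = {1..N}"
proof -
  have m: "mset (names N X c) = mset [1..<Suc N]" using assms by (simp add: occupies_def)
  show "distinct (names N X c)" using mset_eq_imp_distinct_iff[OF m] distinct_upt by blast
  show "set (names N X c) = {1..N}" by (simp only: mset_eq_setD[OF m] set_upt_Suc)
qed

lemma bij_betw_occupies:
  assumes "occupies N X c"
  shows "bij_betw (\<lambda>i. c (X i)) {1..N} {1..N}"
proof -
  have "inj_on (\<lambda>i. c (X i)) (set [1..<Suc N])" "(\<lambda>i. c (X i)) ` set [1..<Suc N] = {1..N}"
    using occupies_names[OF assms] by (auto simp: names_def distinct_map simp del: upt_Suc set_upt)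
  then show ?thesis unfolding set_upt_Suc by (simp add: bij_betw_def)
qed

lemma site_of_eq:
  assumes "occupies N X c" "h \<in> {1..N}"
  shows "site_of c (c (X h)) = X h"
  unfolding site_of_def
proof (rule the_equality)
  fix x assume x: "c x = c (X h)"
  have "c (X h) \<noteq> 0" using bij_betwE[OF bij_betw_occupies[OF assms(1)]] assms(2) by fastforce
  then have "x \<in> X ` {1..N}" using x assms(1) by (auto simp: occupies_def)
  then obtain i where i: "i \<in> {1..N}" "x = X i" by blast
  then have "i = h" using x assms(2) bij_betw_imp_inj_on[OF bij_betw_occupies[OF assms(1)]] by (auto dest: inj_onD)
  then show "x = X h" using i by simp
qed simp

lemma strict_mono_on_iff_less:
  fixes X :: "nat \<Rightarrow> int"
  assumes "strict_mono_on {1..N} X" "i \<in> {1..N}" "j \<in> {1..N}"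
  shows "X i < X j \<longleftrightarrow> i < j"
  using strict_mono_onD[OF assms] strict_mono_onD[OF assms(1,3,2)]
  by (cases i j rule: linorder_cases) auto

lemma strict_mono_onI_Suc:
  fixes X :: "nat \<Rightarrow> int"
  assumes "\<And>i. 1 \<le> i \<Longrightarrow> i < N \<Longrightarrow> X i < X (Suc i)"
  shows "strict_mono_on {1..N} X"
proof (rule strict_mono_onI)
  fix a b :: nat assume ab: "a \<in> {1..N}" "b \<in> {1..N}" "a < b"
  have "a + Suc d \<le> N \<Longrightarrow> X a < X (a + Suc d)" for d
  proof (induction d)
    case (Suc d)
    then have "X (a + Suc d) < X (Suc (a + Suc d))" using ab by (intro assms) auto
    with Suc show ?case by simp
  qed (use ab assms[of a] in simp)
  from this[of "b - a - 1"] have "X a < X b" using ab by simp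
  then show "X a < X b" using ab by simp
qed

lemma left_move_free:
  assumes occ: "occupies N X c" and sp: "sp 0 = 0" "\<And>k. k \<in> {1..N} \<Longrightarrow> 1 \<le> sp k" and h: "h \<in> {1..N}"
    and free: "h = 1 \<or> X (h - 1) < X h - 1"
  shows "occupies N (X(h := X h - 1)) (left_move sp (c (X h)) c)"
    "names N (X(h := X h - 1)) (left_move sp (c (X h)) c) = names N X c"
proof -
  let ?X = "X(h := X h - 1)"
  have mono: "strict_mono_on {1..N} X" and set: "{x. c x \<noteq> 0} = X ` {1..N}"
    using occ by (auto simp: occupies_def)
  have less: "X i < X j \<longleftrightarrow> i < j" if "i \<in> {1..N}" "j \<in> {1..N}" for i j
    using strict_mono_on_iff_less[OF mono that] .
  have ne: "X i \<noteq> X h - 1" if "i \<in> {1..N}" for i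
  proof
    assume "X i = X h - 1"
    then have i: "i < h" using less[OF that h] by simp
    then have "h \<noteq> 1" "i \<le> h - 1" using that by auto
    moreover have "h - 1 \<in> {1..N}" using that h calculation by auto
    ultimately have "X i \<le> X (h - 1)" using less[of "h - 1" i] that i h by auto
    then show False using free \<open>h \<noteq> 1\<close> \<open>X i = X h - 1\<close> by simp
  qed
  have "X h - 1 \<notin> {x. c x \<noteq> 0}" unfolding set using ne by fastforce
  then have c0: "c (X h - 1) = 0" by simp
  have ck: "c (X h) \<in> {1..N}" using bij_betwE[OF bij_betw_occupies[OF occ]] h by blast
  have lm: "left_move sp (c (X h)) c = c(X h - 1 := c (X h), X h := 0)"
    using c0 sp(1) sp(2)[OF ck] by (simp add: left_move_def site_of_eq[OF occ h] Let_def)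
  show names: "names N ?X (left_move sp (c (X h)) c) = names N X c"
    unfolding names_def lm
  proof (intro map_cong refl)
    fix i assume "i \<in> set [1..<Suc N]"
    then have "i \<in> {1..N}" by auto
    then show "(c(X h - 1 := c (X h), X h := 0)) (?X i) = c (X i)"
      using ne[of i] less[of i h] less[of h i] h by auto
  qed
  have "?X i < ?X (Suc i)" if "1 \<le> i" "i < N" for i
    using less[of i "Suc i"] ne[of i] h that by auto
  then have "strict_mono_on {1..N} ?X" by (rule strict_mono_onI_Suc)
  moreover have "{x. left_move sp (c (X h)) c x \<noteq> 0} = ?X ` {1..N}"
  proof -
    have "{x. left_move sp (c (X h)) c x \<noteq> 0} = insert (X h - 1) ({x. c x \<noteq> 0} - {X h})"
      using ck by (auto simp: lm)
    also have "\<dots> = insert (X h - 1) (X ` ({1..N} - {h}))"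
      unfolding set using h strict_mono_on_imp_inj_on[OF mono]
      by (simp add: inj_on_image_set_diff[of X "{1..N}"])
    also have "\<dots> = ?X ` {1..N}" using h by auto
    finally show ?thesis .
  qed
  ultimately show "occupies N ?X (left_move sp (c (X h)) c)"
    using occ names by (simp add: occupies_def)
qed

text \<open>The exchange takes place exactly if the left neighbour has the smaller species, which is
  the case in which \<open>sort_at (h - 1)\<close> changes the word; the occupied sites stay the
  same.\<close>

lemma left_move_blocked:
  assumes occ: "occupies N X c" and h: "h \<in> {2..N}" and blocked: "X (h - 1) = X h - 1"
  shows "occupies N X (left_move sp (c (X h)) c)"
    "map sp (names N X (left_move sp (c (X h)) c)) = sort_at (h - 1) (map sp (names N X c))"
proof -
  have mono: "strict_mono_on {1..N} X" and set: "{x. c x \<noteq> 0} = X ` {1..N}"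
    using occ by (auto simp: occupies_def)
  obtain k where k: "h = Suc (Suc k)" using h by (metis Suc_le_D atLeastAtMost_iff numeral_2_eq_2 Suc_le_mono)
  have less: "X i < X j \<longleftrightarrow> i < j" if "i \<in> {1..N}" "j \<in> {1..N}" for i j
    using strict_mono_on_iff_less[OF mono that] .
  have inj: "X i = X j \<longleftrightarrow> i = j" if "i \<in> {1..N}" "j \<in> {1..N}" for i j
    using less[OF that] less[OF that(2,1)] by auto
  have ck: "c (X (Suc k)) \<in> {1..N}" "c (X h) \<in> {1..N}"
    using bij_betwE[OF bij_betw_occupies[OF occ]] h k by auto
  have lm: "left_move sp (c (X h)) c = (if sp (c (X (Suc k))) < sp (c (X h))
      then c(X (Suc k) := c (X h), X h := c (X (Suc k))) else c)"
    using site_of_eq[OF occ, of h] h blocked k by (simp add: left_move_def Let_def)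
  have nm: "names N X (left_move sp (c (X h)) c) = (if sp (c (X (Suc k))) < sp (c (X h))
      then (names N X c)[k := names N X c ! Suc k, Suc k := names N X c ! k] else names N X c)"
  proof (rule nth_equalityI)
    fix i assume "i < length (names N X (left_move sp (c (X h)) c))"
    then have "i < N" by simp
    then show "names N X (left_move sp (c (X h)) c) ! i = (if sp (c (X (Suc k))) < sp (c (X h))
      then (names N X c)[k := names N X c ! Suc k, Suc k := names N X c ! k] else names N X c) ! i"
      using h k inj[of "Suc i" "Suc k"] inj[of "Suc i" h] by (auto simp: nth_names lm[unfolded k] nth_list_update)
  qed simp
  have kN: "Suc k < N" using h k by auto
  show "map sp (names N X (left_move sp (c (X h)) c)) = sort_at (h - 1) (map sp (names N X c))"
    using kN unfolding nm by (simp add: k sort_at_def nth_names map_update)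
  have "mset (names N X (left_move sp (c (X h)) c)) = mset (names N X c)"
    unfolding nm using kN by (simp add: mset_swap)
  moreover have "{x. left_move sp (c (X h)) c x \<noteq> 0} = {x. c x \<noteq> 0}"
    using ck by (auto simp: lm split: if_splits)
  ultimately show "occupies N X (left_move sp (c (X h)) c)"
    using occ by (simp add: occupies_def)
qed

text \<open>The particle \<open>a\<close> is carried along until it meets a smaller species; it
  settles there, and the displaced particle is carried on. The result is the new content of the
  sites to the right, the first empty one included.\<close>

fun bubble :: "(nat \<Rightarrow> nat) \<Rightarrow> nat \<Rightarrow> nat list \<Rightarrow> nat list" where
  "bubble sp a [] = [a]"
| "bubble sp a (b # bs) = (if sp b < sp a then a # bubble sp b bs else b # bubble sp a bs)"

lemma length_bubble [simp]: "length (bubble sp a bs) = Suc (length bs)"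
  by (induction bs arbitrary: a) auto

lemma mset_bubble [simp]: "mset (bubble sp a bs) = add_mset a (mset bs)"
  by (induction bs arbitrary: a) auto

lemma map_bubble: "map sp (bubble sp a bs) = bubble id (sp a) (map sp bs)"
  by (induction bs arbitrary: a) auto

text \<open>Each sorting leaves the larger of the carried entry and its neighbour behind and carries
  the smaller one on, which is the recursion of \<open>bubble\<close>. If the two are equal, both
  branches give the same word.\<close>

lemma fold_sort_at_bubble:
  "fold sort_at [Suc (length us)..<Suc (length us) + length bs] (us @ a # bs @ vs) = us @ bubble id a bs @ vs"
proof (induction bs arbitrary: us a)
  case (Cons b bs)
  have upt: "[Suc (length us)..<Suc (length us) + length (b # bs)] =
      Suc (length us) # [Suc (Suc (length us))..<Suc (Suc (length us)) + length bs]"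
    by (simp add: upt_conv_Cons del: upt_Suc)
  have "sort_at (Suc (length us)) (us @ a # (b # bs) @ vs) =
      (if a < b then us @ b # a # bs @ vs else us @ a # b # bs @ vs)"
    by (simp add: sort_at_def nth_append list_update_append)
  then show ?case
    unfolding upt using Cons[of "us @ [b]" a] Cons[of "us @ [a]" b]
    by (cases "a = b") (auto simp del: upt_Suc)
qed simp

definition place :: "int \<Rightarrow> nat list \<Rightarrow> config \<Rightarrow> config" where
  "place x ks c y = (if x < y \<and> y \<le> x + int (length ks) then ks ! nat (y - x - 1) else c y)"

lemma place_Cons: "place x (k # ks) c = place (x + 1) ks (c(x + 1 := k))"
proof
  fix y
  show "place x (k # ks) c y = place (x + 1) ks (c(x + 1 := k)) y"
  proof (cases "y = x + 1")
    case False
    show ?thesis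
    proof (cases "x + 1 < y")
      case True
      then have "nat (y - x - 1) = Suc (nat (y - (x + 1) - 1))" by auto
      then show ?thesis using False by (auto simp: place_def)
    qed (use False in \<open>auto simp: place_def\<close>)
  qed (simp add: place_def)
qed

lemma nearest_right_next: "sp (c (x + 1)) < l \<Longrightarrow> nearest_right sp c l x = x + 1"
  by (auto simp: nearest_right_def intro!: Least_equality)

text \<open>The list \<open>bs\<close> is the content of the sites from \<open>x + 1\<close> up to
  the first empty one. A smaller species at \<open>x + 1\<close> is the target and gets displaced;
  otherwise the search ignores that site and agrees with the search that starts at
  \<open>x + 1\<close>.\<close>

lemma push_bubble:
  assumes "sp 0 = 0" "1 \<le> sp k" "\<And>b. b \<in> set bs \<Longrightarrow> 1 \<le> sp b"
    and "\<And>j. j < length bs \<Longrightarrow> c (x + 1 + int j) = bs ! j" "c (x + 1 + int (length bs)) = 0"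
  shows "push sp k x c = place x (bubble sp k bs) c"
  using assms(2-)
proof (induction bs arbitrary: k x c)
  case Nil
  then have "nearest_right sp c (sp k) x = x + 1" using assms(1) by (intro nearest_right_next) simp
  then have "push sp k x c = c(x + 1 := k)" using Nil assms(1) by (subst push.simps) (simp add: Let_def)
  moreover have "place x [k] c = c(x + 1 := k)" by (auto simp: place_def fun_eq_iff)
  ultimately show ?case by simp
next
  case (Cons b bs)
  have cb: "c (x + 1) = b" using Cons.prems(3)[of 0] by simp
  have shift: "c (x + 1 + 1 + int j) = bs ! j" if "j < length bs" for j
    using Cons.prems(3)[of "Suc j"] that by (simp add: algebra_simps)
  have last: "c (x + 1 + 1 + int (length bs)) = 0" using Cons.prems(4) by (simp add: algebra_simps)
  show ?case
  proof (cases "sp b < sp k")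
    case True
    then have "push sp k x c = push sp b (x + 1) (c(x + 1 := k))"
      using cb Cons.prems(2)[of b] nearest_right_next[of sp c x "sp k"]
      by (subst push.simps) (simp add: Let_def)
    also have "\<dots> = place (x + 1) (bubble sp b bs) (c(x + 1 := k))"
      using Cons.prems(2) shift last by (intro Cons.IH) auto
    finally show ?thesis using True by (simp add: place_Cons)
  next
    case False
    let ?P = "\<lambda>d. 0 < d \<and> sp (c (x + int d)) < sp k"
    \<comment> \<open>The empty site behind the cluster has species \<open>0\<close>; it is the
      witness that the search ends, as \<open>Least_Suc\<close> requires.\<close>
    have "?P (length (b # bs) + 1)" using Cons.prems(1,4) assms(1) by (simp add: algebra_simps)
    then have "(LEAST d. ?P d) = Suc (LEAST d. ?P (Suc d))"
      by (rule Least_Suc) simp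
    moreover have "?P (Suc d) \<longleftrightarrow> 0 < d \<and> sp (c (x + 1 + int d)) < sp k" for d
      using False cb by (cases d) (auto simp: algebra_simps)
    ultimately have "nearest_right sp c (sp k) x = nearest_right sp c (sp k) (x + 1)"
      by (simp add: nearest_right_def)
    then have "push sp k x c = push sp k (x + 1) c"
      by (subst (1 2) push.simps) simp
    also have "\<dots> = place (x + 1) (bubble sp k bs) c"
      using Cons.prems shift last by (intro Cons.IH) auto
    finally show ?thesis using False cb by (simp add: place_Cons fun_upd_idem)
  qed
qed

text \<open>The particle at \<open>h\<close> vacates its site, and the run from \<open>h\<close> to
  its end \<open>i\<close> then fills the same number of sites one further to the right. Relative to
  the order of positions, the names in this run undergo one pass of \<open>bubble\<close>.\<close>

lemma right_move_cluster:
  assumes occ: "occupies N X c" and sp: "sp 0 = 0" "\<And>k. k \<in> {1..N} \<Longrightarrow> 1 \<le> sp k"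
    and hi: "1 \<le> h" "h \<le> i" "i \<le> N" and cluster: "\<And>j. j \<in> {h..i} \<Longrightarrow> X j = X h + (int j - int h)"
    and last: "i = N \<or> X i + 1 < X (Suc i)"
  defines "X' \<equiv> \<lambda>j. if j \<in> {h..i} then X j + 1 else X j"
  shows "occupies N X' (right_move sp (c (X h)) c)"
    "map sp (names N X' (right_move sp (c (X h)) c)) = fold sort_at [h..<i] (map sp (names N X c))"
proof -
  have h: "h \<in> {1..N}" using hi by auto
  have mono: "strict_mono_on {1..N} X" and set: "{x. c x \<noteq> 0} = X ` {1..N}"
    using occ by (auto simp: occupies_def)
  have less: "X a < X b \<longleftrightarrow> a < b" if "a \<in> {1..N}" "b \<in> {1..N}" for a b
    using strict_mono_on_iff_less[OF mono that] .
  define x where "x = X h"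
  define k where "k = c x"
  define bs where "bs = map (\<lambda>j. c (X j)) [Suc h..<Suc i]"
  define us where "us = map (\<lambda>j. c (X j)) [1..<h]"
  define vs where "vs = map (\<lambda>j. c (X j)) [Suc i..<Suc N]"
  have len: "length bs = i - h" "length us = h - 1" by (simp_all add: bs_def us_def del: upt_Suc)
  have split: "[1..<Suc N] = [1..<h] @ h # [Suc h..<Suc i] @ [Suc i..<Suc N]"
  proof -
    have "[1..<Suc N] = [1..<h] @ [h..<Suc N]" using hi upt_add_eq_append[of 1 h "Suc N - h"] by simp
    moreover have "[h..<Suc N] = h # [Suc h..<Suc N]" using hi by (simp add: upt_conv_Cons del: upt_Suc)
    moreover have "[Suc h..<Suc N] = [Suc h..<Suc i] @ [Suc i..<Suc N]"
      using hi upt_add_eq_append[of "Suc h" "Suc i" "N - i"] by simp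
    ultimately show ?thesis by simp
  qed
  have nm: "names N X c = us @ k # bs @ vs"
    unfolding names_def split by (simp add: us_def k_def x_def bs_def vs_def del: upt_Suc)
  have pos: "c (X j) \<in> {1..N}" if "j \<in> {1..N}" for j
    using bij_betwE[OF bij_betw_occupies[OF occ]] that by blast
  have after: "x + 1 + int (length bs) < X j" if "j \<in> {Suc i..N}" for j
  proof -
    have "X i + 1 < X (Suc i)" using last that by auto
    moreover have "X (Suc i) \<le> X j" using less[of j "Suc i"] that by fastforce
    moreover have "X i = x + int (length bs)" using cluster[of i] hi len by (simp add: x_def)
    ultimately show ?thesis by simp
  qed
  have before: "X j < x" if "j \<in> {1..<h}" for j
    using less[of j h] that hi by (simp add: x_def)
  have empty: "c (x + 1 + int (length bs)) = 0"
  proof (rule ccontr)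
    assume "c (x + 1 + int (length bs)) \<noteq> 0"
    then have "x + 1 + int (length bs) \<in> {x. c x \<noteq> 0}" by simp
    then obtain j where j: "j \<in> {1..N}" "X j = x + 1 + int (length bs)" unfolding set by force
    consider "j < h" | "j \<in> {h..i}" | "i < j" unfolding atLeastAtMost_iff by linarith
    then show False
    proof cases
      case 1 then show False using before[of j] j by simp
    next
      case 2 then show False using cluster[of j] j len by (auto simp: x_def)
    next
      case 3 then show False using after[of j] j by auto
    qed
  qed
  have "push sp k x (c(x := 0)) = place x (bubble sp k bs) (c(x := 0))"
  proof (rule push_bubble)
    show "1 \<le> sp k" using pos[OF h] sp(2) by (simp add: k_def x_def)
    show "1 \<le> sp b" if "b \<in> set bs" for b
      using that pos sp(2) hi by (auto simp: bs_def simp del: upt_Suc)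
    show "(c(x := 0)) (x + 1 + int j) = bs ! j" if "j < length bs" for j
      using cluster[of "Suc (h + j)"] that len by (simp add: bs_def x_def add_ac del: upt_Suc)
    show "(c(x := 0)) (x + 1 + int (length bs)) = 0" using empty by simp
  qed (rule sp)
  then have rm: "right_move sp (c (X h)) c = place x (bubble sp k bs) (c(x := 0))"
    by (simp add: right_move_def Let_def site_of_eq[OF occ h] k_def x_def)
  have nm': "names N X' (right_move sp (c (X h)) c) = us @ bubble sp k bs @ vs"
  proof -
    have "map (\<lambda>j. right_move sp (c (X h)) c (X' j)) [1..<h] = us"
      unfolding us_def
    proof (intro map_cong refl)
      fix j assume "j \<in> set [1..<h]"
      then have "j \<in> {1..<h}" by auto
      from before[OF this] this show "right_move sp (c (X h)) c (X' j) = c (X j)"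
        by (auto simp: rm place_def X'_def)
    qed
    moreover have "map (\<lambda>j. right_move sp (c (X h)) c (X' j)) (h # [Suc h..<Suc i]) = bubble sp k bs"
    proof (rule nth_equalityI)
      fix j assume "j < length (map (\<lambda>j. right_move sp (c (X h)) c (X' j)) (h # [Suc h..<Suc i]))"
      then have j: "j \<le> i - h" by (simp del: upt_Suc)
      have "h # [Suc h..<Suc i] = [h..<Suc i]" using hi by (simp add: upt_conv_Cons del: upt_Suc)
      moreover have "[h..<Suc i] ! j = h + j" using j hi by (intro nth_upt) linarith
      ultimately have "map (\<lambda>j. right_move sp (c (X h)) c (X' j)) (h # [Suc h..<Suc i]) ! j =
          right_move sp (c (X h)) c (X' (h + j))"
        using j hi by (simp only:) (simp del: upt_Suc)
      also have "X' (h + j) = x + 1 + int j" using cluster[of "h + j"] j hi by (simp add: X'_def x_def)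
      finally show "map (\<lambda>j. right_move sp (c (X h)) c (X' j)) (h # [Suc h..<Suc i]) ! j = bubble sp k bs ! j"
        using j len by (simp add: rm place_def)
    qed (simp add: len hi del: upt_Suc)
    moreover have "map (\<lambda>j. right_move sp (c (X h)) c (X' j)) [Suc i..<Suc N] = vs"
      unfolding vs_def
    proof (intro map_cong refl)
      fix j assume "j \<in> set [Suc i..<Suc N]"
      then have "j \<in> {Suc i..N}" by auto
      from after[OF this] this show "right_move sp (c (X h)) c (X' j) = c (X j)"
        by (auto simp: rm place_def X'_def)
    qed
    ultimately show ?thesis unfolding names_def split by (simp del: upt_Suc)
  qed
  have "[h..<i] = [Suc (length us)..<Suc (length us) + length bs]" using len hi by simp
  then show "map sp (names N X' (right_move sp (c (X h)) c)) = fold sort_at [h..<i] (map sp (names N X c))"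
    using fold_sort_at_bubble[of "map sp us" "map sp bs" "sp k" "map sp vs"]
    by (simp add: nm nm' map_bubble)
  have "mset (names N X' (right_move sp (c (X h)) c)) = mset [1..<Suc N]"
    using occ by (simp add: nm' nm occupies_def)
  moreover have "strict_mono_on {1..N} X'"
  proof (rule strict_mono_onI_Suc)
    fix a assume "1 \<le> a" "a < N"
    then show "X' a < X' (Suc a)" using less[of a "Suc a"] last hi by (cases "a = i") (auto simp: X'_def)
  qed
  moreover have "{y. right_move sp (c (X h)) c y \<noteq> 0} = X' ` {1..N}"
  proof (intro equalityI subsetI)
    fix y assume "y \<in> X' ` {1..N}"
    then obtain j where j: "j \<in> {1..N}" "y = X' j" by blast
    have "right_move sp (c (X h)) c (X' j) = (us @ bubble sp k bs @ vs) ! (j - 1)"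
      using j(1) nth_names[of "j - 1" N X' "right_move sp (c (X h)) c"] by (auto simp: nm')
    also have "\<dots> \<in> set (us @ bubble sp k bs @ vs)"
      using j(1) arg_cong[OF nm', of length] by (intro nth_mem) auto
    also have "set (us @ bubble sp k bs @ vs) = set (names N X c)"
      unfolding nm using mset_eq_setD[of "bubble sp k bs" "k # bs"] by simp
    finally have "right_move sp (c (X h)) c (X' j) \<in> {1..N}" unfolding occupies_names(2)[OF occ] .
    then show "y \<in> {y. right_move sp (c (X h)) c y \<noteq> 0}" using j(2) by auto
  next
    fix y assume "y \<in> {y. right_move sp (c (X h)) c y \<noteq> 0}"
    then have y: "place x (bubble sp k bs) (c(x := 0)) y \<noteq> 0" by (simp add: rm)
    show "y \<in> X' ` {1..N}"
    proof (cases "x < y \<and> y \<le> x + int (Suc (length bs))")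
      case True
      define j where "j = h + nat (y - x - 1)"
      have "j \<in> {h..i}" "X' j = y" using True len hi cluster[of j] by (auto simp: j_def X'_def x_def)
      then show ?thesis using hi by force
    next
      case False
      then have "c y \<noteq> 0" "y \<noteq> x" using y by (auto simp: place_def split: if_splits)
      then have "y \<in> {x. c x \<noteq> 0}" by simp
      then obtain j where j: "j \<in> {1..N}" "y = X j" unfolding set by blast
      have "j \<notin> {h..i}"
      proof
        assume "j \<in> {h..i}"
        then show False using cluster[of j] False j len \<open>y \<noteq> x\<close> by (auto simp: x_def)
      qed
      then show ?thesis using j by (intro image_eqI[of _ _ j]) (auto simp: X'_def)
    qed
  qed
  ultimately show "occupies N X' (right_move sp (c (X h)) c)" by (simp add: occupies_def)
qed

section \<open>Sums over sequences of moves\<close>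

text \<open>For the indicator of a word as \<open>\<phi>\<close> this is the indicator of
  \<open>in_state\<close>.\<close>

definition observe ::
  "nat \<Rightarrow> (nat \<Rightarrow> nat) \<Rightarrow> (nat \<Rightarrow> int) \<Rightarrow> (nat list \<Rightarrow> complex) \<Rightarrow> config \<Rightarrow> complex" where
  "observe N sp X \<phi> c = (if {x. c x \<noteq> 0} = X ` {1..N} then \<phi> (map sp (names N X c)) else 0)"

lemma observe_eq:
  assumes "occupies N Z c" "strict_mono_on {1..N} X"
  shows "observe N sp X \<phi> c = (if \<forall>j\<in>{1..N}. X j = Z j then \<phi> (map sp (names N Z c)) else 0)"
proof -
  have "{x. c x \<noteq> 0} = X ` {1..N} \<longleftrightarrow> (\<forall>j\<in>{1..N}. X j = Z j)"
  proof
    assume "{x. c x \<noteq> 0} = X ` {1..N}"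
    then have "X ` {1..N} = Z ` {1..N}" using assms(1) by (simp add: occupies_def)
    then show "\<forall>j\<in>{1..N}. X j = Z j"
      using assms strict_mono_on_image_eq[of N X Z] by (auto simp: occupies_def)
  next
    assume "\<forall>j\<in>{1..N}. X j = Z j"
    then have "X ` {1..N} = Z ` {1..N}" by (intro image_cong) auto
    then show "{x. c x \<noteq> 0} = X ` {1..N}" using assms(1) by (simp add: occupies_def)
  qed
  moreover have "names N X c = names N Z c" if "\<forall>j\<in>{1..N}. X j = Z j"
    unfolding names_def using that by (intro map_cong refl) auto
  ultimately show ?thesis by (auto simp: observe_def)
qed

lemma ex_cluster_end:
  fixes Z :: "nat \<Rightarrow> int"
  assumes Z: "strict_mono_on {1..N} Z" and h: "1 \<le> h" "h \<le> N"
  shows "\<exists>i. h \<le> i \<and> i \<le> N \<and> (\<forall>j\<in>{h..i}. Z j = Z h + (int j - int h)) \<and> (i = N \<or> Z i + 1 < Z (Suc i))"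
  using h
proof (induction "N - h" arbitrary: h)
  case 0
  then show ?case by (intro exI[of _ N]) auto
next
  case (Suc d)
  show ?case
  proof (cases "Z h + 1 < Z (Suc h)")
    case True
    then show ?thesis using Suc.prems by (intro exI[of _ h]) auto
  next
    case False
    have "Z h < Z (Suc h)" using Suc.hyps(2) Suc.prems by (intro strict_mono_onD[OF Z]) auto
    then have step: "Z (Suc h) = Z h + 1" using False by simp
    obtain i where i: "Suc h \<le> i" "i \<le> N" "\<And>j. j \<in> {Suc h..i} \<Longrightarrow> Z j = Z (Suc h) + (int j - int (Suc h))"
        "i = N \<or> Z i + 1 < Z (Suc i)"
    proof -
      have "d = N - Suc h" "1 \<le> Suc h" "Suc h \<le> N" using Suc.hyps(2) Suc.prems by auto
      from Suc.hyps(1)[OF this] show thesis using that by blast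
    qed
    have "Z j = Z h + (int j - int h)" if "j \<in> {h..i}" for j
      using i(3)[of j] step that by (cases "j = h") auto
    moreover have "h \<le> i" using i(1) by simp
    ultimately show ?thesis using i(2,4) by blast
  qed
qed

lemma ex_cluster_start:
  fixes X :: "nat \<Rightarrow> int"
  assumes X: "strict_mono_on {1..N} X" and i: "1 \<le> i" "i \<le> N"
  shows "\<exists>h. 1 \<le> h \<and> h \<le> i \<and> (\<forall>j\<in>{h..i}. X j = X i - (int i - int j)) \<and> (h = 1 \<or> X (h - 1) + 1 < X h)"
  using i
proof (induction i rule: nat_induct_at_least)
  case base
  then show ?case by (intro exI[of _ 1]) auto
next
  case (Suc i)
  show ?case
  proof (cases "X i + 1 < X (Suc i)")
    case True
    then show ?thesis using Suc.prems by (intro exI[of _ "Suc i"]) auto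
  next
    case False
    have "X i < X (Suc i)" using Suc.hyps Suc.prems by (intro strict_mono_onD[OF X]) auto
    then have step: "X (Suc i) = X i + 1" using False by simp
    obtain h where h: "1 \<le> h" "h \<le> i" "\<And>j. j \<in> {h..i} \<Longrightarrow> X j = X i - (int i - int j)"
        "h = 1 \<or> X (h - 1) + 1 < X h"
    proof -
      have "i \<le> N" using Suc.prems by simp
      from Suc.IH[OF this] show thesis using that by blast
    qed
    have "X j = X (Suc i) - (int (Suc i) - int j)" if "j \<in> {h..Suc i}" for j
      using h(3)[of j] step that by (cases "j = Suc i") auto
    moreover have "h \<le> Suc i" using h(2) by simp
    ultimately show ?thesis using h(1,4) by blast
  qed
qed

text \<open>First index of the run of adjacent sites that reaches up to \<open>X i\<close>; the run
  may well continue beyond \<open>i\<close>.\<close>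

definition cluster_start :: "(nat \<Rightarrow> int) \<Rightarrow> nat \<Rightarrow> nat" where
  "cluster_start X i = (SOME h. 1 \<le> h \<and> h \<le> i \<and> (\<forall>j\<in>{h..i}. X j = X i - (int i - int j)) \<and>
    (h = 1 \<or> X (h - 1) + 1 < X h))"

lemma cluster_start:
  assumes "strict_mono_on {1..N} X" "1 \<le> i" "i \<le> N"
  shows "1 \<le> cluster_start X i" "cluster_start X i \<le> i"
    "j \<in> {cluster_start X i..i} \<Longrightarrow> X j = X i - (int i - int j)"
    "cluster_start X i = 1 \<or> X (cluster_start X i - 1) + 1 < X (cluster_start X i)"
  using someI_ex[OF ex_cluster_start[OF assms], folded cluster_start_def] by blast+

text \<open>The positions and the function of the word which \<open>moment_boundary\<close> produces from \<open>X - e\<^sub>i\<close> and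
  \<open>X + e\<^sub>i\<close>.\<close>

definition right_source :: "(nat \<Rightarrow> int) \<Rightarrow> nat \<Rightarrow> nat \<Rightarrow> int" where
  "right_source X i j = (if j \<in> {cluster_start X i..i} then X j - 1 else X j)"

definition right_pullback :: "(nat \<Rightarrow> int) \<Rightarrow> nat \<Rightarrow> (nat list \<Rightarrow> complex) \<Rightarrow> nat list \<Rightarrow> complex" where
  "right_pullback X i \<phi> w = \<phi> (fold sort_at [cluster_start X i..<i] w)"

definition left_source :: "nat \<Rightarrow> (nat \<Rightarrow> int) \<Rightarrow> nat \<Rightarrow> nat \<Rightarrow> int" where
  "left_source N X i = (if i < N \<and> X (Suc i) = X i + 1 then X else X(i := X i + 1))"

definition left_pullback :: "nat \<Rightarrow> (nat \<Rightarrow> int) \<Rightarrow> nat \<Rightarrow> (nat list \<Rightarrow> complex) \<Rightarrow> nat list \<Rightarrow> complex" where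
  "left_pullback N X i \<phi> w = (if i < N \<and> X (Suc i) = X i + 1 then \<phi> (sort_at i w) else \<phi> w)"

lemma strict_mono_right_source:
  assumes X: "strict_mono_on {1..N} X" and i: "1 \<le> i" "i \<le> N"
  shows "strict_mono_on {1..N} (right_source X i)"
proof (rule strict_mono_onI_Suc)
  fix a assume a: "1 \<le> a" "a < N"
  have "X a < X (Suc a)" using a by (intro strict_mono_onD[OF X]) auto
  moreover have "X a + 1 < X (Suc a)" if "cluster_start X i = Suc a"
    using cluster_start(4)[OF X i] that a by auto
  ultimately show "right_source X i a < right_source X i (Suc a)"
    by (cases "cluster_start X i = Suc a") (auto simp: right_source_def)
qed

lemma strict_mono_left_source:
  assumes X: "strict_mono_on {1..N} X"
  shows "strict_mono_on {1..N} (left_source N X i)"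
proof (rule strict_mono_onI_Suc)
  fix a assume a: "1 \<le> a" "a < N"
  have "X a < X (Suc a)" using a by (intro strict_mono_onD[OF X]) auto
  then show "left_source N X i a < left_source N X i (Suc a)"
    using a by (auto simp: left_source_def)
qed

text \<open>Moving \<open>X i\<close> back by one may make it coincide with
  \<open>X (i - 1)\<close>. The boundary condition then moves that coordinate back as well, which
  may cause the next coincidence, and so on down to the start of the run. Every use puts one more
  sorting in front of the others.\<close>

lemma (in bethe) moment_right_source:
  assumes X: "strict_mono_on {1..N} X" and i: "1 \<le> i" "i \<le> N"
  shows "moment n (X(i := X i - 1)) \<phi> = moment n (right_source X i) (right_pullback X i \<phi>)"
proof -
  have "moment n (X(i := X i - 1)) \<phi> = moment n (\<lambda>j. if j \<in> {i - d..i} then X j - 1 else X j)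
      (\<lambda>w. \<phi> (fold sort_at [i - d..<i] w))" if "d \<le> i - cluster_start X i" for d
    using that
  proof (induction d)
    case 0
    have "X(i := X i - 1) = (\<lambda>j. if j \<in> {i - 0..i} then X j - 1 else X j)" by auto
    then show ?case by simp
  next
    case (Suc d)
    let ?l = "i - Suc d"
    have l: "Suc ?l = i - d" "?l \<in> {cluster_start X i..i}" "Suc ?l \<in> {cluster_start X i..i}" "?l \<in> {1..<N}"
      using Suc.prems cluster_start(1,2)[OF X i] i by auto
    let ?X = "\<lambda>j. if j \<in> {i - d..i} then X j - 1 else X j"
    have "X (Suc ?l) = X ?l + 1"
      using cluster_start(3)[OF X i l(2)] cluster_start(3)[OF X i l(3)] by simp
    then have "?X (?l + 1) = ?X ?l" using l by auto
    from moment_boundary[OF l(4) this]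
    have "moment n ?X (\<lambda>w. \<phi> (fold sort_at [i - d..<i] w)) =
        moment n (?X(?l := ?X ?l - 1)) (\<lambda>w. \<phi> (fold sort_at [i - d..<i] (sort_at ?l w)))" .
    moreover have "?X(?l := ?X ?l - 1) = (\<lambda>j. if j \<in> {?l..i} then X j - 1 else X j)"
      using l Suc.prems by (auto simp: fun_eq_iff)
    moreover have "[?l..<i] = ?l # [i - d..<i]"
      using l Suc.prems upt_conv_Cons[of ?l i] by simp
    ultimately show ?case using Suc by simp
  qed
  from this[of "i - cluster_start X i"] cluster_start(2)[OF X i] show ?thesis
    by (simp add: right_source_def[abs_def] right_pullback_def[abs_def])
qed

text \<open>If \<open>X i + 1\<close> is the site of the next particle, one use of the boundary
  condition returns \<open>X\<close> itself together with a sorting; this corresponds to the blocked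
  left move of particle \<open>i + 1\<close> in the order of positions.\<close>

lemma (in bethe) moment_left_source:
  assumes i: "1 \<le> i" "i \<le> N"
  shows "moment n (X(i := X i + 1)) \<phi> = moment n (left_source N X i) (left_pullback N X i \<phi>)"
proof (cases "i < N \<and> X (Suc i) = X i + 1")
  case True
  then have "moment n (X(i := X i + 1)) \<phi> =
      moment n ((X(i := X i + 1))(i := (X(i := X i + 1)) i - 1)) (\<lambda>w. \<phi> (sort_at i w))"
    using i by (intro moment_boundary) auto
  then show ?thesis using True by (simp add: left_source_def left_pullback_def[abs_def])
next
  case False
  then have "left_pullback N X i \<phi> = \<phi>" "left_source N X i = X(i := X i + 1)"
    by (auto simp: left_source_def left_pullback_def fun_eq_iff)
  then show ?thesis by simp
qed

lemma sum_single:
  assumes "finite A" "a \<in> A" "\<And>b. b \<in> A \<Longrightarrow> b \<noteq> a \<Longrightarrow> f b = 0"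
  shows "sum f A = f a"
  using assms by (subst sum.remove[of _ a]) (auto intro: sum.neutral)

text \<open>Both sides are sums over pairs \<open>(h, i)\<close> with at most one nonzero term for
  each index: a right move of the particle at \<open>h\<close> pushes the run from \<open>h\<close>
  to \<open>i\<close>. Starting from \<open>Z\<close>, \<open>h\<close> determines \<open>i\<close>
  as the end of the run; looking back from \<open>X\<close>, \<open>i\<close> determines
  \<open>h\<close> as the start of a run.\<close>

lemma sum_right_moves:
  assumes occ: "occupies N Z c" and sp: "sp 0 = 0" "\<And>k. k \<in> {1..N} \<Longrightarrow> 1 \<le> sp k"
    and X: "strict_mono_on {1..N} X"
  shows "(\<Sum>k=1..N. observe N sp X \<phi> (right_move sp k c)) =
    (\<Sum>i=1..N. observe N sp (right_source X i) (right_pullback X i \<phi>) c)"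
proof -
  define w where "w = map sp (names N Z c)"
  have Z: "strict_mono_on {1..N} Z" using occ by (simp add: occupies_def)
  \<comment> \<open>\<open>J h i\<close> says that \<open>X\<close> arises from \<open>Z\<close> by
    pushing the run from \<open>h\<close> to its end \<open>i\<close>.\<close>
  define J where "J h i \<longleftrightarrow> h \<le> i \<and> (\<forall>j\<in>{h..i}. Z j = Z h + (int j - int h)) \<and>
    (i = N \<or> Z i + 1 < Z (Suc i)) \<and> (\<forall>j\<in>{1..N}. X j = (if j \<in> {h..i} then Z j + 1 else Z j))" for h i
  have JD: "h \<le> i" "\<And>j. j \<in> {h..i} \<Longrightarrow> Z j = Z h + (int j - int h)" "i = N \<or> Z i + 1 < Z (Suc i)"
    "\<And>j. j \<in> {1..N} \<Longrightarrow> X j = (if j \<in> {h..i} then Z j + 1 else Z j)" if "J h i" for h i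
    using that unfolding J_def by blast+
  define T where "T h i = (if J h i then \<phi> (fold sort_at [h..<i] w) else 0)" for h i
  have source: "observe N sp X \<phi> (right_move sp (c (Z h)) c) = (\<Sum>i=1..N. T h i)" if "h \<in> {1..N}" for h
  proof -
    have h: "1 \<le> h" "h \<le> N" using that by auto
    obtain e where e: "h \<le> e" "e \<le> N" "\<And>j. j \<in> {h..e} \<Longrightarrow> Z j = Z h + (int j - int h)"
        "e = N \<or> Z e + 1 < Z (Suc e)"
      using ex_cluster_end[OF Z h] by blast
    have unique: "i = e" if "J h i" "i \<in> {1..N}" for i
    proof (rule ccontr)
      assume "i \<noteq> e"
      then consider "i < e" | "e < i" by linarith
      then show False
      proof cases
        case 1
        then have "i \<in> {h..e}" "Suc i \<in> {h..e}" using JD(1)[OF that(1)] by auto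
        then have "Z (Suc i) = Z i + 1" using e(3)[of i] e(3)[of "Suc i"] by simp
        then show False using JD(3)[OF that(1)] 1 e(2) by simp
      next
        case 2
        then have "Z e = Z h + (int e - int h)" "Z (Suc e) = Z h + (int (Suc e) - int h)"
          using JD(2)[OF that(1), of e] JD(2)[OF that(1), of "Suc e"] e(1) by auto
        moreover have "e < N" using 2 that(2) by simp
        ultimately show False using e(4) by simp
      qed
    qed
    have "(\<Sum>i=1..N. T h i) = T h e"
    proof (rule sum_single)
      show "e \<in> {1..N}" using e(1,2) h by simp
      show "T h b = 0" if "b \<in> {1..N}" "b \<noteq> e" for b
        using unique[of b] that unfolding T_def by (metis (full_types))
    qed simp
    moreover have "J h e \<longleftrightarrow> (\<forall>j\<in>{1..N}. X j = (if j \<in> {h..e} then Z j + 1 else Z j))"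
      unfolding J_def using e by blast
    ultimately show ?thesis
      using right_move_cluster(2)[where sp = sp, OF occ sp h(1) e] observe_eq[OF right_move_cluster(1)[where sp = sp, OF occ sp h(1) e] X, of sp \<phi>]
      unfolding T_def w_def by presburger
  qed
  have target: "observe N sp (right_source X i) (right_pullback X i \<phi>) c = (\<Sum>h=1..N. T h i)" if "i \<in> {1..N}" for i
  proof -
    have i: "1 \<le> i" "i \<le> N" using that by auto
    define s where "s = cluster_start X i"
    note s = cluster_start[OF X i, folded s_def]
    have unique: "h = s" if "J h i" "h \<in> {1..N}" for h
    proof -
      have Xi: "X j = X i - (int i - int j)" if "j \<in> {h..i}" for j
      proof -
        have "Z j = Z h + (int j - int h)" "Z i = Z h + (int i - int h)" "X j = Z j + 1" "X i = Z i + 1"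
          using JD(2)[OF \<open>J h i\<close>, of j] JD(2)[OF \<open>J h i\<close>, of i] JD(4)[OF \<open>J h i\<close>, of j] JD(4)[OF \<open>J h i\<close>, of i]
            that i \<open>h \<in> {1..N}\<close> by auto
        then show ?thesis by simp
      qed
      \<comment> \<open>After the move the vacated site separates the pushed run from whatever lies
        to its left, so the run in \<open>X\<close> cannot begin before \<open>h\<close>.\<close>
      have prev: "h = 1 \<or> X (h - 1) + 1 < X h"
      proof (cases "h = 1")
        case False
        then have h1: "h - 1 \<in> {1..N}" "h - 1 < h" using that(2) by auto
        then have "X (h - 1) = Z (h - 1)" "X h = Z h + 1" "Z (h - 1) < Z h"
          using JD(4)[OF that(1) h1(1)] JD(4)[OF that] JD(1)[OF that(1)]
            strict_mono_onD[OF Z h1(1) that(2) h1(2)] by auto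
        then show ?thesis by simp
      qed simp
      have hi: "h \<le> i" by (rule JD(1)[OF that(1)])
      show "h = s"
      proof (rule ccontr)
        assume "h \<noteq> s"
        then consider "h < s" | "s < h" by linarith
        then show False
        proof cases
          case 1
          then have "s - 1 \<in> {h..i}" "s \<in> {h..i}" "s \<noteq> 1" using s(2) that(2) by auto
          then have "X (s - 1) = X i - (int i - int (s - 1))" "X s = X i - (int i - int s)"
            using Xi by blast+
          then show False using s(1,4) \<open>s \<noteq> 1\<close> by simp
        next
          case 2
          then have "h - 1 \<in> {s..i}" "h \<in> {s..i}" "h \<noteq> 1" using hi s(1) by auto
          then have "X (h - 1) = X i - (int i - int (h - 1))" "X h = X i - (int i - int h)"
            using s(3) by blast+
          then show False using prev \<open>h \<noteq> 1\<close> that(2) by simp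
        qed
      qed
    qed
    have "(\<Sum>h=1..N. T h i) = T s i"
    proof (rule sum_single)
      show "s \<in> {1..N}" using s(1,2) i by simp
      show "T b i = 0" if "b \<in> {1..N}" "b \<noteq> s" for b
        using unique[of b] that unfolding T_def by (metis (full_types))
    qed simp
    moreover have "J s i \<longleftrightarrow> (\<forall>j\<in>{1..N}. right_source X i j = Z j)"
    proof
      assume J: "J s i"
      show "\<forall>j\<in>{1..N}. right_source X i j = Z j"
      proof
        fix j assume "j \<in> {1..N}"
        from JD(4)[OF J this] have "X j = (if j \<in> {s..i} then Z j + 1 else Z j)" .
        then show "right_source X i j = Z j" by (auto simp: right_source_def s_def[symmetric])
      qed
    next
      assume eq: "\<forall>j\<in>{1..N}. right_source X i j = Z j"
      have Xj: "X j = (if j \<in> {s..i} then Z j + 1 else Z j)" if "j \<in> {1..N}" for j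
        using bspec[OF eq that] by (simp add: right_source_def s_def[symmetric] split: if_splits)
      have "Z j = Z s + (int j - int s)" if "j \<in> {s..i}" for j
      proof -
        have "s \<in> {s..i}" "s \<in> {1..N}" "j \<in> {1..N}" using that s(1,2) i by auto
        then show ?thesis using s(3)[OF that] s(3)[of s] Xj[of j] Xj[of s] that by simp
      qed
      moreover have "i = N \<or> Z i + 1 < Z (Suc i)"
      proof (cases "i = N")
        case False
        then have i': "i \<in> {1..N}" "Suc i \<in> {1..N}" using i by auto
        then show ?thesis
          using Xj[OF i'(1)] Xj[OF i'(2)] s(2) strict_mono_onD[OF X i'] by simp
      qed simp
      ultimately show "J s i" unfolding J_def using Xj s(2) by blast
    qed
    ultimately show ?thesis
      using observe_eq[OF occ strict_mono_right_source[OF X i]]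
      by (simp add: T_def w_def right_pullback_def s_def)
  qed
  have "(\<Sum>k=1..N. observe N sp X \<phi> (right_move sp k c)) =
      (\<Sum>h=1..N. observe N sp X \<phi> (right_move sp (c (Z h)) c))"
    by (rule sum.reindex_bij_betw[OF bij_betw_occupies[OF occ], symmetric])
  also have "\<dots> = (\<Sum>h=1..N. \<Sum>i=1..N. T h i)" by (intro sum.cong refl source)
  also have "\<dots> = (\<Sum>i=1..N. \<Sum>h=1..N. T h i)" by (rule sum.swap)
  also have "\<dots> = (\<Sum>i=1..N. observe N sp (right_source X i) (right_pullback X i \<phi>) c)"
    by (intro sum.cong refl target[symmetric])
  finally show ?thesis .
qed

text \<open>A free left move of the particle at \<open>h\<close> belongs to the index
  \<open>i = h\<close>, but a blocked one to \<open>i = h - 1\<close>: there \<open>X + e_i\<close>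
  had to be corrected, and \<open>left_source\<close> gave back \<open>X\<close> with a sorting at
  \<open>i\<close>.\<close>

lemma sum_left_moves:
  assumes occ: "occupies N Z c" and sp: "sp 0 = 0" "\<And>k. k \<in> {1..N} \<Longrightarrow> 1 \<le> sp k"
    and X: "strict_mono_on {1..N} X"
  shows "(\<Sum>k=1..N. observe N sp X \<phi> (left_move sp k c)) =
    (\<Sum>i=1..N. observe N sp (left_source N X i) (left_pullback N X i \<phi>) c)"
proof -
  define w where "w = map sp (names N Z c)"
  have Z: "strict_mono_on {1..N} Z" using occ by (simp add: occupies_def)
  have Z_Suc: "Z a < Z (Suc a)" if "1 \<le> a" "a < N" for a
    using that by (intro strict_mono_onD[OF Z]) auto
  have X_Suc: "X a < X (Suc a)" if "1 \<le> a" "a < N" for a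
    using that by (intro strict_mono_onD[OF X]) auto
  \<comment> \<open>\<open>B\<close> describes the blocked moves, which keep all positions, and
    \<open>F\<close> the free ones.\<close>
  define B where "B h i \<longleftrightarrow> h = Suc i \<and> Z (Suc i) = Z i + 1 \<and> (\<forall>j\<in>{1..N}. X j = Z j)" for h i
  define F where "F h i \<longleftrightarrow> h = i \<and> (h = 1 \<or> Z (h - 1) < Z h - 1) \<and> (\<forall>j\<in>{1..N}. X j = (Z(h := Z h - 1)) j)" for h i
  define T where "T h i = (if B h i then \<phi> (sort_at i w) else 0) + (if F h i then \<phi> w else 0)" for h i
  have source: "observe N sp X \<phi> (left_move sp (c (Z h)) c) = (\<Sum>i=1..N. T h i)" if "h \<in> {1..N}" for h
  proof (cases "h = 1 \<or> Z (h - 1) < Z h - 1")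
    case True
    have notB: "\<not> B h i" if "i \<in> {1..N}" for i
      using True that by (auto simp: B_def)
    have "(\<Sum>i=1..N. T h i) = T h h"
      using that notB by (intro sum_single) (auto simp: T_def F_def)
    then show ?thesis
      using observe_eq[OF left_move_free(1)[where sp = sp, OF occ sp that True] X] left_move_free(2)[where sp = sp, OF occ sp that True]
        notB[OF that] True
      by (simp add: T_def F_def w_def)
  next
    case False
    then have h: "h \<in> {2..N}" using that by auto
    have "h - 1 \<in> {1..N}" "h \<in> {1..N}" "h - 1 < h" using h by auto
    from strict_mono_onD[OF Z this] have blocked: "Z (h - 1) = Z h - 1" using False by simp
    have "\<not> F h i" for i using False by (auto simp: F_def)
    then have "(\<Sum>i=1..N. T h i) = T h (h - 1)"
      using h by (intro sum_single) (auto simp: T_def B_def)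
    moreover have "B h (h - 1) \<longleftrightarrow> (\<forall>j\<in>{1..N}. X j = Z j)"
      using blocked h by (auto simp: B_def)
    ultimately show ?thesis
      using observe_eq[OF left_move_blocked(1)[OF occ h blocked] X] left_move_blocked(2)[OF occ h blocked] \<open>\<not> F h (h - 1)\<close>
      by (simp add: T_def w_def)
  qed
  have target: "observe N sp (left_source N X i) (left_pullback N X i \<phi>) c = (\<Sum>h=1..N. T h i)" if "i \<in> {1..N}" for i
  proof (cases "i < N \<and> X (Suc i) = X i + 1")
    case True
    have "\<not> F h i" for h
    proof
      assume "F h i"
      then have "X i = Z i - 1" "X (Suc i) = Z (Suc i)" using that True by (auto simp: F_def)
      moreover have "Z i < Z (Suc i)" using that True by (intro Z_Suc) auto
      ultimately show False using True by simp
    qed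
    then have "(\<Sum>h=1..N. T h i) = T (Suc i) i"
      using that True by (intro sum_single) (auto simp: T_def B_def)
    moreover have "B (Suc i) i \<longleftrightarrow> (\<forall>j\<in>{1..N}. X j = Z j)"
    proof -
      have "Z (Suc i) = Z i + 1" if "\<forall>j\<in>{1..N}. X j = Z j"
        using True \<open>i \<in> {1..N}\<close> bspec[OF that, of i] bspec[OF that, of "Suc i"] by auto
      then show ?thesis by (auto simp: B_def)
    qed
    ultimately show ?thesis
      using observe_eq[OF occ X, of sp "\<lambda>w. \<phi> (sort_at i w)"] True \<open>\<not> F (Suc i) i\<close>
      by (simp add: T_def w_def left_source_def left_pullback_def[abs_def])
  next
    case False
    have notB: "\<not> B h i" if "h \<in> {1..N}" for h
    proof
      assume B: "B h i"
      then have "X i = Z i" "X (Suc i) = Z (Suc i)" using that \<open>i \<in> {1..N}\<close> by (auto simp: B_def)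
      then show False using False B that by (auto simp: B_def)
    qed
    then have "(\<Sum>h=1..N. T h i) = T i i"
      using that by (intro sum_single) (auto simp: T_def F_def)
    moreover have "F i i \<longleftrightarrow> (\<forall>j\<in>{1..N}. (X(i := X i + 1)) j = Z j)"
    proof
      assume "F i i"
      then show "\<forall>j\<in>{1..N}. (X(i := X i + 1)) j = Z j" by (auto simp: F_def)
    next
      assume eq: "\<forall>j\<in>{1..N}. (X(i := X i + 1)) j = Z j"
      have "i = 1 \<or> Z (i - 1) < Z i - 1"
      proof (cases "i = 1")
        case False
        then have i1: "i - 1 \<in> {1..N}" "i - 1 < i" using that by auto
        then have "X (i - 1) < X i" using strict_mono_onD[OF X i1(1) that i1(2)] by simp
        moreover have "X (i - 1) = Z (i - 1)" "X i + 1 = Z i"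
          using bspec[OF eq i1(1)] bspec[OF eq that] i1(2) by auto
        ultimately show ?thesis by simp
      qed simp
      moreover have "\<forall>j\<in>{1..N}. X j = (Z(i := Z i - 1)) j"
      proof
        fix j assume "j \<in> {1..N}"
        then show "X j = (Z(i := Z i - 1)) j" using bspec[OF eq, of j] by (auto split: if_splits)
      qed
      ultimately show "F i i" by (simp add: F_def)
    qed
    moreover have src: "left_pullback N X i \<phi> = \<phi>" "left_source N X i = X(i := X i + 1)"
      using False by (auto simp: left_source_def left_pullback_def fun_eq_iff)
    ultimately show ?thesis
      using observe_eq[OF occ strict_mono_left_source[OF X, of i], of sp \<phi>] notB[OF that]
      unfolding src by (simp add: T_def w_def del: fun_upd_apply)
  qed
  have "(\<Sum>k=1..N. observe N sp X \<phi> (left_move sp k c)) =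
      (\<Sum>h=1..N. observe N sp X \<phi> (left_move sp (c (Z h)) c))"
    by (rule sum.reindex_bij_betw[OF bij_betw_occupies[OF occ], symmetric])
  also have "\<dots> = (\<Sum>h=1..N. \<Sum>i=1..N. T h i)" by (intro sum.cong refl source)
  also have "\<dots> = (\<Sum>i=1..N. \<Sum>h=1..N. T h i)" by (rule sum.swap)
  also have "\<dots> = (\<Sum>i=1..N. observe N sp (left_source N X i) (left_pullback N X i \<phi>) c)"
    by (intro sum.cong refl target[symmetric])
  finally show ?thesis .
qed

section \<open>Iterated averages over one ring\<close>

definition move :: "(nat \<Rightarrow> nat) \<Rightarrow> nat \<times> bool \<Rightarrow> config \<Rightarrow> config" where
  "move sp = (\<lambda>(k, d). if d then right_move sp k else left_move sp k)"

text \<open>This is \<open>N\<close> times the expectation after one ring of a uniformly chosen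
  particle. Leaving out the division by \<open>N\<close> makes the weight of \<open>n\<close> rings
  \<open>t ^ n\<close> instead of \<open>(N * t) ^ n\<close>, in agreement with the exponential
  series of the wave function.\<close>

definition move_average ::
  "nat \<Rightarrow> real \<Rightarrow> (nat \<Rightarrow> nat) \<Rightarrow> (config \<Rightarrow> complex) \<Rightarrow> config \<Rightarrow> complex" where
  "move_average N p sp f c =
    (\<Sum>k=1..N. of_real p * f (right_move sp k c) + of_real (1 - p) * f (left_move sp k c))"

lemma occupies_move:
  assumes occ: "occupies N X c" and sp: "sp 0 = 0" "\<And>k. k \<in> {1..N} \<Longrightarrow> 1 \<le> sp k" and k: "k \<in> {1..N}"
  shows "\<exists>X'. occupies N X' (right_move sp k c)" "\<exists>X'. occupies N X' (left_move sp k c)"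
proof -
  have X: "strict_mono_on {1..N} X" using occ by (simp add: occupies_def)
  obtain h where h: "h \<in> {1..N}" "k = c (X h)"
    using bij_betw_imp_surj_on[OF bij_betw_occupies[OF occ]] k by (metis (no_types, lifting) imageE)
  then have h': "1 \<le> h" "h \<le> N" by auto
  obtain e where e: "h \<le> e" "e \<le> N" "\<And>j. j \<in> {h..e} \<Longrightarrow> X j = X h + (int j - int h)"
      "e = N \<or> X e + 1 < X (Suc e)"
    using ex_cluster_end[OF X h'] by blast
  from right_move_cluster(1)[where sp = sp, OF occ sp h'(1) e] show "\<exists>X'. occupies N X' (right_move sp k c)"
    unfolding h(2) by blast
  show "\<exists>X'. occupies N X' (left_move sp k c)"
  proof (cases "h = 1 \<or> X (h - 1) < X h - 1")
    case True
    from left_move_free(1)[where sp = sp, OF occ sp h(1) True] show ?thesis unfolding h(2) by blast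
  next
    case False
    have h2: "h \<in> {2..N}" using h(1) False by auto
    have "X (h - 1) < X h" using h2 by (intro strict_mono_onD[OF X]) auto
    then have "X (h - 1) = X h - 1" using False by simp
    from left_move_blocked(1)[OF occ h2 this] show ?thesis unfolding h(2) by blast
  qed
qed

text \<open>The identity \<open>move_average_observe\<close> holds only where \<open>N\<close>
  distinct particles occupy the sites. It may be used under an iterate because all moves preserve
  this.\<close>

lemma move_average_funpow_cong:
  assumes sp: "sp 0 = 0" "\<And>k. k \<in> {1..N} \<Longrightarrow> 1 \<le> sp k"
    and fg: "\<And>X c. occupies N X c \<Longrightarrow> f c = g c" and occ: "occupies N X c"
  shows "(move_average N p sp ^^ n) f c = (move_average N p sp ^^ n) g c"
  using occ
proof (induction n arbitrary: X c)
  case 0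
  then show ?case using fg by simp
next
  case (Suc n)
  have "(move_average N p sp ^^ n) f (right_move sp k c) = (move_average N p sp ^^ n) g (right_move sp k c)"
    "(move_average N p sp ^^ n) f (left_move sp k c) = (move_average N p sp ^^ n) g (left_move sp k c)"
    if "k \<in> {1..N}" for k
    using occupies_move[where sp = sp, OF Suc.prems sp that] Suc.IH by auto
  then show ?case
    by (simp add: move_average_def[of N p sp "(move_average N p sp ^^ n) f" c]
      move_average_def[of N p sp "(move_average N p sp ^^ n) g" c])
qed

lemma move_average_sum:
  "move_average N p sp (\<lambda>c. \<Sum>i\<in>A. a i * f i c + b i * g i c) c =
    (\<Sum>i\<in>A. a i * move_average N p sp (f i) c + b i * move_average N p sp (g i) c)"
proof -
  have "(\<Sum>i\<in>A. a i * move_average N p sp (f i) c + b i * move_average N p sp (g i) c) =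
    (\<Sum>i\<in>A. \<Sum>k=1..N. a i * (of_real p * f i (right_move sp k c) + of_real (1 - p) * f i (left_move sp k c)) +
      b i * (of_real p * g i (right_move sp k c) + of_real (1 - p) * g i (left_move sp k c)))"
    by (simp only: move_average_def sum_distrib_left sum.distrib[symmetric])
  also have "\<dots> = (\<Sum>k=1..N. \<Sum>i\<in>A. a i * (of_real p * f i (right_move sp k c) + of_real (1 - p) * f i (left_move sp k c)) +
      b i * (of_real p * g i (right_move sp k c) + of_real (1 - p) * g i (left_move sp k c)))"
    by (rule sum.swap)
  also have "\<dots> = move_average N p sp (\<lambda>c. \<Sum>i\<in>A. a i * f i c + b i * g i c) c"
    unfolding move_average_def sum_distrib_left sum.distrib[symmetric]
    by (intro sum.cong refl) (simp add: algebra_simps)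
  finally show ?thesis by simp
qed

lemma move_average_funpow_sum:
  "(move_average N p sp ^^ n) (\<lambda>c. \<Sum>i\<in>A. a i * f i c + b i * g i c) =
    (\<lambda>c. \<Sum>i\<in>A. a i * (move_average N p sp ^^ n) (f i) c + b i * (move_average N p sp ^^ n) (g i) c)"
proof (induction n)
  case (Suc n)
  show ?case
    unfolding funpow.simps(2) comp_apply Suc by (rule ext) (rule move_average_sum)
qed simp

lemma move_average_observe:
  assumes "occupies N Z c" "sp 0 = 0" "\<And>k. k \<in> {1..N} \<Longrightarrow> 1 \<le> sp k" "strict_mono_on {1..N} X"
  shows "move_average N p sp (observe N sp X \<phi>) c =
    (\<Sum>i=1..N. of_real p * observe N sp (right_source X i) (right_pullback X i \<phi>) c +
      of_real (1 - p) * observe N sp (left_source N X i) (left_pullback N X i \<phi>) c)"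
  unfolding move_average_def sum.distrib sum_distrib_left[symmetric]
  using sum_right_moves[where sp = sp, OF assms] sum_left_moves[where sp = sp, OF assms] by simp

lemma occupies_initial_config:
  assumes "strict_mono_on {1..N} Y"
  shows "occupies N Y (initial_config N Y)" "names N Y (initial_config N Y) = [1..<Suc N]"
proof -
  have inj: "inj_on Y {1..N}" using assms by (rule strict_mono_on_imp_inj_on)
  have c: "initial_config N Y (Y i) = i" if "i \<in> {1..N}" for i
    using that inj by (auto simp: initial_config_def inv_into_f_f)
  show names: "names N Y (initial_config N Y) = [1..<Suc N]"
    unfolding names_def by (rule map_idI) (auto intro: c)
  have "{x. initial_config N Y x \<noteq> 0} = Y ` {1..N}"
  proof (intro equalityI subsetI)
    fix x assume "x \<in> {x. initial_config N Y x \<noteq> 0}"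
    then show "x \<in> Y ` {1..N}" by (simp add: initial_config_def split: if_splits)
  next
    fix x assume "x \<in> Y ` {1..N}"
    then show "x \<in> {x. initial_config N Y x \<noteq> 0}" using c by auto
  qed
  then show "occupies N Y (initial_config N Y)" using assms names by (simp add: occupies_def del: upt_Suc)
qed

text \<open>The free equation, rewritten with \<open>right_source\<close> and
  \<open>left_source\<close>, is term by term the equation for the last ring. Both sources are
  strictly increasing again, so the induction hypothesis applies to them with the pulled back test
  functions.\<close>

lemma moment_eq_move_average:
  assumes "bethe N Y R" and v: "v \<in> words N N" and X: "strict_mono_on {1..N} X"
  shows "bethe.moment N p (1 - p) Y v R n X \<phi> = (2 * of_real pi * \<i>) ^ N *
    (move_average N p (species v) ^^ n) (observe N (species v) X \<phi>) (initial_config N Y)"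
proof -
  interpret bethe N p "1 - p" Y v R by fact
  let ?c0 = "initial_config N Y" and ?sp = "species v" and ?a = "(2 * of_real pi * \<i>) ^ N :: complex"
  let ?K = "move_average N p ?sp"
  have sp: "?sp 0 = 0" "\<And>k. k \<in> {1..N} \<Longrightarrow> 1 \<le> ?sp k"
  proof -
    show "1 \<le> ?sp k" if "k \<in> {1..N}" for k
    proof -
      have "v ! (k - 1) \<in> set v" using v that by (intro nth_mem) (auto simp: words_def)
      then show ?thesis using v that by (auto simp: words_def species_def)
    qed
  qed (simp add: species_def)
  note occ = occupies_initial_config[OF Y_mono]
  have word: "map ?sp (names N Y ?c0) = v"
    using v by (intro nth_equalityI) (auto simp: occ(2) words_def species_def simp del: upt_Suc)
  show ?thesis using X
  proof (induction n arbitrary: X \<phi>)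
    case 0
    then show ?case by (simp add: moment_0 observe_eq[OF occ(1)] word)
  next
    case (Suc n)
    have "(?K ^^ Suc n) (observe N ?sp X \<phi>) ?c0 = (?K ^^ n) (?K (observe N ?sp X \<phi>)) ?c0"
      by (simp only: funpow_Suc_right comp_apply)
    also have "\<dots> = (?K ^^ n) (\<lambda>c. \<Sum>i=1..N. of_real p * observe N ?sp (right_source X i) (right_pullback X i \<phi>) c +
      of_real (1 - p) * observe N ?sp (left_source N X i) (left_pullback N X i \<phi>) c) ?c0"
      using move_average_observe[where sp = ?sp, OF _ sp Suc.prems] by (intro move_average_funpow_cong[where sp = ?sp, OF sp _ occ(1)])
    finally have "?a * (?K ^^ Suc n) (observe N ?sp X \<phi>) ?c0 = ?a * \<dots>" by (rule arg_cong)
    also have "\<dots> = (\<Sum>i=1..N. of_real p * (?a * (?K ^^ n) (observe N ?sp (right_source X i) (right_pullback X i \<phi>)) ?c0) +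
      of_real (1 - p) * (?a * (?K ^^ n) (observe N ?sp (left_source N X i) (left_pullback N X i \<phi>)) ?c0))"
      unfolding move_average_funpow_sum sum_distrib_left by (intro sum.cong refl) (simp add: algebra_simps)
    also have "\<dots> = (\<Sum>i=1..N. of_real p * moment n (X(i := X i - 1)) \<phi> + of_real (1 - p) * moment n (X(i := X i + 1)) \<phi>)"
    proof (intro sum.cong refl)
      fix i assume "i \<in> {1..N}"
      then have i: "1 \<le> i" "i \<le> N" by auto
      show "of_real p * (?a * (?K ^^ n) (observe N ?sp (right_source X i) (right_pullback X i \<phi>)) ?c0) +
        of_real (1 - p) * (?a * (?K ^^ n) (observe N ?sp (left_source N X i) (left_pullback N X i \<phi>)) ?c0) =
        of_real p * moment n (X(i := X i - 1)) \<phi> + of_real (1 - p) * moment n (X(i := X i + 1)) \<phi>"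
        by (simp only: moment_right_source[OF Suc.prems i] moment_left_source[OF i, where X = X]
          Suc.IH[OF strict_mono_right_source[OF Suc.prems i]] Suc.IH[OF strict_mono_left_source[OF Suc.prems]])
    qed
    also have "\<dots> = moment (Suc n) X \<phi>" by (rule moment_Suc[symmetric])
    finally show ?case by (rule sym)
  qed
qed

section \<open>The law of the sequence of rings\<close>

definition wait_dist :: "real \<Rightarrow> (real \<times> bool) measure" where
  "wait_dist p = density lborel (exponential_density 1) \<Otimes>\<^sub>M measure_pmf (bernoulli_pmf p)"

lemma prob_space_wait_dist: "prob_space (wait_dist p)"
proof -
  interpret A: prob_space "density lborel (exponential_density 1)"
    by (rule prob_space_exponential_density) simp
  interpret pair_prob_space "density lborel (exponential_density 1)" "measure_pmf (bernoulli_pmf p)" ..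
  show ?thesis unfolding wait_dist_def by (rule P.prob_space_axioms)
qed

lemma space_wait_dist [simp]: "space (wait_dist p) = UNIV"
  by (simp add: wait_dist_def space_pair_measure)

lemma measurable_fst_wait_dist [measurable]: "fst \<in> borel_measurable (wait_dist p)"
proof -
  have "fst \<in> wait_dist p \<rightarrow>\<^sub>M density lborel (exponential_density 1)"
    unfolding wait_dist_def by (rule measurable_fst)
  then show ?thesis by (simp cong: measurable_cong_sets)
qed

lemma measurable_snd_wait_dist [measurable]: "snd \<in> wait_dist p \<rightarrow>\<^sub>M count_space UNIV"
proof -
  have "snd \<in> wait_dist p \<rightarrow>\<^sub>M measure_pmf (bernoulli_pmf p)"
    unfolding wait_dist_def by (rule measurable_snd)
  then show ?thesis by (simp cong: measurable_cong_sets)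
qed

definition direction_weight :: "real \<Rightarrow> bool \<Rightarrow> real" where
  "direction_weight p d = (if d then p else 1 - p)"

lemma nn_integral_wait_dist:
  assumes p: "0 \<le> p" "p \<le> 1" and h [measurable]: "h \<in> borel_measurable borel"
  shows "(\<integral>\<^sup>+x. (if snd x = d then h (fst x) else 0) \<partial>wait_dist p) =
    ennreal (direction_weight p d) * (\<integral>\<^sup>+y. ennreal (exponential_density 1 y) * h y \<partial>lborel)"
proof -
  let ?A = "density lborel (exponential_density 1)" and ?B = "measure_pmf (bernoulli_pmf p)"
  interpret A: prob_space ?A by (rule prob_space_exponential_density) simp
  have [measurable]: "(\<lambda>x. if snd x = d then h (fst x) else 0) \<in> borel_measurable (?A \<Otimes>\<^sub>M ?B)"
    using measurable_fst_wait_dist[of p] measurable_snd_wait_dist[of p] unfolding wait_dist_def by measurable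
  have "(\<integral>\<^sup>+x. (if snd x = d then h (fst x) else 0) \<partial>wait_dist p) =
      (\<integral>\<^sup>+y. \<integral>\<^sup>+b. (if b = d then h y else 0) \<partial>?B \<partial>?A)"
    unfolding wait_dist_def
    by (subst measure_pmf.nn_integral_fst[symmetric]) (simp_all cong: if_cong)
  also have "\<dots> = (\<integral>\<^sup>+y. ennreal (direction_weight p d) * h y \<partial>?A)"
  proof (intro nn_integral_cong)
    fix y
    have "(\<integral>\<^sup>+b. (if b = d then h y else 0) \<partial>?B) = (\<integral>\<^sup>+b. h y * indicator {d} b \<partial>?B)"
      by (intro nn_integral_cong) (auto simp: indicator_def)
    also have "\<dots> = h y * emeasure ?B {d}" by (simp add: nn_integral_cmult_indicator)
    also have "emeasure ?B {d} = ennreal (direction_weight p d)"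
      using p by (cases d) (simp_all add: emeasure_pmf_single direction_weight_def)
    finally show "(\<integral>\<^sup>+b. (if b = d then h y else 0) \<partial>?B) = ennreal (direction_weight p d) * h y"
      by (simp add: mult.commute)
  qed
  also have "\<dots> = ennreal (direction_weight p d) * (\<integral>\<^sup>+y. h y \<partial>?A)"
    by (rule nn_integral_cmult) simp
  also have "(\<integral>\<^sup>+y. h y \<partial>?A) = (\<integral>\<^sup>+y. ennreal (exponential_density 1 y) * h y \<partial>lborel)"
    by (rule nn_integral_density) auto
  finally show ?thesis .
qed

text \<open>The density at \<open>y\<close> and the factor \<open>exp (- (t - (a + y)))\<close>
  multiply to a constant in \<open>y\<close>. What is left is the integral of a power, which raises
  the exponent and the factorial by one.\<close>

lemma nn_integral_ring:
  fixes a s t K :: real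
  assumes "a \<le> s" "s \<le> t" "0 \<le> K"
  shows "(\<integral>\<^sup>+y. ennreal (exponential_density 1 y) *
      (if s < a + y \<and> a + y \<le> t then ennreal (K * exp (- (t - (a + y))) * (t - (a + y)) ^ n / fact n) else 0) \<partial>lborel) =
    ennreal (K * exp (- (t - a)) * (t - s) ^ Suc n / fact (Suc n))"
proof -
  let ?f = "\<lambda>y. K * exp (- (t - a)) * (t - (a + y)) ^ n / fact n"
  let ?F = "\<lambda>y. - (K * exp (- (t - a)) * (t - (a + y)) ^ Suc n / fact (Suc n))"
  have "(\<integral>\<^sup>+y. ennreal (exponential_density 1 y) *
      (if s < a + y \<and> a + y \<le> t then ennreal (K * exp (- (t - (a + y))) * (t - (a + y)) ^ n / fact n) else 0) \<partial>lborel) =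
    (\<integral>\<^sup>+y. ennreal (?f y) * indicator {s - a..t - a} y \<partial>lborel)"
  proof (intro nn_integral_cong_AE)
    \<comment> \<open>The point \<open>y = s - a\<close> lies in the closed interval but does not
      satisfy the strict inequality; it is a null set.\<close>
    show "AE y in lborel. ennreal (exponential_density 1 y) *
      (if s < a + y \<and> a + y \<le> t then ennreal (K * exp (- (t - (a + y))) * (t - (a + y)) ^ n / fact n) else 0) =
      ennreal (?f y) * indicator {s - a..t - a} y"
      using AE_lborel_singleton[of "s - a"]
    proof eventually_elim
      case (elim y)
      show ?case
      proof (cases "s < a + y \<and> a + y \<le> t")
        case True
        then have "0 \<le> y" using assms by simp
        have "exp (- y) * exp (- (t - (a + y))) = exp (- (t - a))" by (simp add: exp_add[symmetric])
        then have "exp (- y) * (K * exp (- (t - (a + y))) * (t - (a + y)) ^ n / fact n) = ?f y"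
          by (metis (no_types, opaque_lifting) mult.assoc mult.left_commute times_divide_eq_right)
        then show ?thesis using True \<open>0 \<le> y\<close> assms
          by (simp add: exponential_density_def ennreal_mult'[symmetric])
      next
        case False
        then show ?thesis using elim by (auto simp: indicator_def)
      qed
    qed
  qed
  also have "\<dots> = ennreal (?F (t - a) - ?F (s - a))"
  proof (rule nn_integral_FTC_Icc)
    fix y assume y: "y \<in> {s - a..t - a}"
    show "0 \<le> ?f y" using y assms by simp
    have "((\<lambda>y. (t - (a + y)) ^ Suc n) has_real_derivative - (real (Suc n) * (t - (a + y)) ^ n)) (at y)"
      by (rule derivative_eq_intros refl | simp)+
    from DERIV_cmult[OF this, of "- (K * exp (- (t - a)) / fact (Suc n))"]
    have "((\<lambda>y. - (K * exp (- (t - a)) / fact (Suc n)) * (t - (a + y)) ^ Suc n) has_real_derivative ?f y) (at y)"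
      by (rule DERIV_cong) (simp add: divide_simps)
    then show "(?F has_real_derivative ?f y) (at y)" by simp
  qed (use assms in auto)
  finally show ?thesis by simp
qed

text \<open>\<open>history N t ks m a s\<close>: between the times \<open>s\<close> and \<open>t\<close> the rings are those of the particles and
  directions in \<open>ks\<close>, in this order, when particle \<open>k\<close> has already rung \<open>m k\<close> times, for the last
  time at \<open>a k\<close>.\<close>

fun history :: "nat \<Rightarrow> real \<Rightarrow> (nat \<times> bool) list \<Rightarrow> (nat \<Rightarrow> nat) \<Rightarrow> (nat \<Rightarrow> real) \<Rightarrow> real \<Rightarrow> sample \<Rightarrow> bool" where
  "history N t [] m a s \<omega> \<longleftrightarrow> (\<forall>k\<in>{1..N}. t < a k + fst (\<omega> (k, m k)))"
| "history N t ((k, d) # ks) m a s \<omega> \<longleftrightarrow>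
    s < a k + fst (\<omega> (k, m k)) \<and> a k + fst (\<omega> (k, m k)) \<le> t \<and> snd (\<omega> (k, m k)) = d \<and>
    history N t ks (m(k := Suc (m k))) (a(k := a k + fst (\<omega> (k, m k)))) (a k + fst (\<omega> (k, m k))) \<omega>"

lemma history_cong:
  assumes "\<And>k j. m k \<le> j \<Longrightarrow> \<omega> (k, j) = \<omega>' (k, j)"
  shows "history N t ks m a s \<omega> = history N t ks m a s \<omega>'"
  using assms
proof (induction ks arbitrary: m a s)
  case Nil
  then show ?case by simp
next
  case (Cons x ks)
  obtain k d where x: "x = (k, d)" by force
  have "\<omega> (k, m k) = \<omega>' (k, m k)" using Cons.prems by simp
  moreover have "history N t ks (m(k := Suc (m k))) a' s' \<omega> = history N t ks (m(k := Suc (m k))) a' s' \<omega>'" for a' s'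
    using Cons.prems by (intro Cons.IH) (auto split: if_splits dest: Suc_leD)
  ultimately show ?case by (simp add: x del: fun_upd_apply)
qed

lemma measurable_history:
  assumes "\<And>k j. k \<in> {1..N} \<Longrightarrow> m k \<le> j \<Longrightarrow> (k, j) \<in> I" "fst ` set ks \<subseteq> {1..N}"
    and "\<And>k. (\<lambda>x. a x k) \<in> borel_measurable M" "s \<in> borel_measurable M" and w: "w \<in> M \<rightarrow>\<^sub>M PiM I (\<lambda>_. wait_dist p)"
  shows "Measurable.pred M (\<lambda>x. history N t ks m (a x) (s x) (w x))"
proof -
  have wait: "(\<lambda>x. fst (w x i)) \<in> borel_measurable M" "(\<lambda>x. snd (w x i)) \<in> M \<rightarrow>\<^sub>M count_space UNIV" if "i \<in> I" for i
    using measurable_compose[OF w measurable_component_singleton[OF that]] by measurable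
  show ?thesis using assms(1-4)
  proof (induction ks arbitrary: m a s)
    case Nil
    have "Measurable.pred M (\<lambda>x. t < a x k + fst (w x (k, m k)))" if "k \<in> {1..N}" for k
      using wait(1)[of "(k, m k)"] Nil that by measurable
    then show ?case by (simp add: pred_intros_finite)
  next
    case (Cons x ks)
    obtain k d where x: "x = (k, d)" by force
    have k: "k \<in> {1..N}" using Cons.prems by (auto simp: x)
    have [measurable]: "(\<lambda>x. fst (w x (k, m k))) \<in> borel_measurable M" "(\<lambda>x. snd (w x (k, m k))) \<in> M \<rightarrow>\<^sub>M count_space UNIV"
      "(\<lambda>x. a x k) \<in> borel_measurable M" "s \<in> borel_measurable M"
      using wait[of "(k, m k)"] Cons.prems k by auto
    have [measurable]: "Measurable.pred M (\<lambda>x. history N t ks (m(k := Suc (m k)))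
        ((a x)(k := a x k + fst (w x (k, m k)))) (a x k + fst (w x (k, m k))) (w x))"
    proof (rule Cons.IH)
      show "(k', j) \<in> I" if "k' \<in> {1..N}" "(m(k := Suc (m k))) k' \<le> j" for k' j
        using that Cons.prems(1)[of k' j] by (auto split: if_splits)
      show "(\<lambda>x. ((a x)(k := a x k + fst (w x (k, m k)))) k') \<in> borel_measurable M" for k'
        using Cons.prems(3)[of k'] by (cases "k' = k") auto
    qed (use Cons.prems in auto)
    show ?case unfolding x history.simps by measurable
  qed
qed

text \<open>The first ring is integrated out, and the remaining history uses only the other
  coordinates; so the index set \<open>I\<close> varies in the induction together with
  \<open>m\<close>, \<open>a\<close> and \<open>s\<close>. The factor of particle \<open>k\<close>
  starts at its last ring \<open>a k\<close> and not at \<open>s\<close>, because its silence in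
  between is part of the event and not a condition.\<close>

lemma emeasure_history:
  assumes p: "0 \<le> p" "p \<le> 1" and I: "\<And>k j. k \<in> {1..N} \<Longrightarrow> m k \<le> j \<Longrightarrow> (k, j) \<in> I"
    and a: "\<And>k. k \<in> {1..N} \<Longrightarrow> a k \<le> s" and st: "s \<le> t" and ks: "fst ` set ks \<subseteq> {1..N}"
  shows "emeasure (PiM I (\<lambda>_. wait_dist p)) {\<omega> \<in> space (PiM I (\<lambda>_. wait_dist p)). history N t ks m a s \<omega>} =
    ennreal ((\<Prod>(k, d)\<leftarrow>ks. direction_weight p d) * (\<Prod>k=1..N. exp (- (t - a k))) * (t - s) ^ length ks / fact (length ks))"
  using I a st ks
proof (induction ks arbitrary: I m a s)
  case Nil
  interpret product_prob_space "\<lambda>_. wait_dist p" I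
    unfolding product_prob_space_def product_prob_space_axioms_def product_sigma_finite_def
    using prob_space_wait_dist prob_space_imp_sigma_finite by blast
  interpret W: prob_space "wait_dist p" by (rule prob_space_wait_dist)
  let ?J = "(\<lambda>k. (k, m k)) ` {1..N}"
  have single: "emeasure (wait_dist p) {x. t < a k + fst x} = ennreal (exp (- (t - a k)))" if "k \<in> {1..N}" for k
  proof -
    have ak: "a k \<le> t" using Nil.prems that by force
    have "emeasure (wait_dist p) {x \<in> space (wait_dist p). t < a k + fst x} =
        (\<integral>\<^sup>+x. indicator {x \<in> space (wait_dist p). t < a k + fst x} x \<partial>wait_dist p)"
      by (intro nn_integral_indicator[symmetric]) measurable
    \<comment> \<open>The direction of this ring is irrelevant; splitting by direction brings the
      integral into the form of \<open>nn_integral_wait_dist\<close>, and the two weights add up to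
      one.\<close>
    also have "\<dots> = (\<integral>\<^sup>+x. (if snd x = True then indicator {t - a k<..} (fst x) else 0) +
        (if snd x = False then indicator {t - a k<..} (fst x) else 0) \<partial>wait_dist p)"
      by (intro nn_integral_cong) (auto simp: indicator_def)
    also have "\<dots> = (ennreal (direction_weight p True) + ennreal (direction_weight p False)) *
        (\<integral>\<^sup>+y. ennreal (exponential_density 1 y) * indicator {t - a k<..} y \<partial>lborel)"
      using nn_integral_wait_dist[OF p, of "indicator {t - a k<..}" True]
        nn_integral_wait_dist[OF p, of "indicator {t - a k<..}" False]
      by (subst nn_integral_add) (auto simp: distrib_right)
    also have "ennreal (direction_weight p True) + ennreal (direction_weight p False) = 1"
      using p by (simp add: direction_weight_def ennreal_plus[symmetric] del: ennreal_plus)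
    also have "(\<integral>\<^sup>+y. ennreal (exponential_density 1 y) * indicator {t - a k<..} y \<partial>lborel) =
        (\<integral>\<^sup>+y. ennreal (exp (- y)) * indicator {t - a k..} y \<partial>lborel)"
    proof (rule nn_integral_cong_AE)
      show "AE y in lborel. ennreal (exponential_density 1 y) * indicator {t - a k<..} y =
          ennreal (exp (- y)) * indicator {t - a k..} y"
        using AE_lborel_singleton[of "t - a k"]
        by eventually_elim (use ak in \<open>auto simp: indicator_def exponential_density_def\<close>)
    qed
    also have "\<dots> = ennreal (0 - (- exp (- (t - a k))))"
    proof (rule nn_integral_FTC_atLeast)
      show "((\<lambda>y. - exp (- y)) has_real_derivative exp (- y)) (at y)" for y :: real
        by (auto intro!: derivative_eq_intros)
      have "((\<lambda>y::real. - exp (- y)) \<longlongrightarrow> - 0) at_top"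
        by (intro tendsto_minus filterlim_compose[OF exp_at_bot] filterlim_uminus_at_bot_at_top)
      then show "((\<lambda>y::real. - exp (- y)) \<longlongrightarrow> 0) at_top" by simp
    qed auto
    finally show ?thesis by simp
  qed
  have "{\<omega> \<in> space (PiM I (\<lambda>_. wait_dist p)). history N t [] m a s \<omega>} =
      {\<omega> \<in> space (PiM I (\<lambda>_. wait_dist p)). \<forall>i\<in>?J. \<omega> i \<in> (\<lambda>(k, j). {x. t < a k + fst x}) i}" by auto
  also have "emeasure (PiM I (\<lambda>_. wait_dist p)) \<dots> =
      (\<Prod>i\<in>?J. emeasure (wait_dist p) ((\<lambda>(k, j). {x. t < a k + fst x}) i))"
  proof (rule emeasure_PiM_Collect)
    show "(\<lambda>(k, j). {x. t < a k + fst x}) i \<in> sets (wait_dist p)" for i :: "nat \<times> nat"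
    proof -
      have "{x \<in> space (wait_dist p). t < a (fst i) + fst x} \<in> sets (wait_dist p)" by measurable
      then show ?thesis by (simp add: split_def)
    qed
  qed (use Nil.prems in auto)
  also have "\<dots> = (\<Prod>k=1..N. emeasure (wait_dist p) {x. t < a k + fst x})"
    by (subst prod.reindex) (auto simp: inj_on_def)
  also have "\<dots> = (\<Prod>k=1..N. ennreal (exp (- (t - a k))))"
    by (intro prod.cong refl single)
  also have "\<dots> = ennreal (\<Prod>k=1..N. exp (- (t - a k)))"
    by (intro prod_ennreal) auto
  finally show ?case by simp
next
  case (Cons x ks)
  obtain k0 d0 where x: "x = (k0, d0)" by force
  have k0: "k0 \<in> {1..N}" using Cons.prems(4) by (auto simp: x)
  let ?W = "wait_dist p"
  define i0 where "i0 = (k0, m k0)"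
  define I' where "I' = I - {i0}"
  have I': "insert i0 I' = I" using Cons.prems(1)[OF k0, of "m k0"] by (auto simp: I'_def i0_def)
  let ?P = "PiM I (\<lambda>_. ?W)" and ?P' = "PiM I' (\<lambda>_. ?W)"
  \<comment> \<open>\<open>T\<close> puts the coordinate \<open>i0\<close> back into a sample over
    the other coordinates. Its image measure is the product measure over \<open>I\<close>, which
    separates the first ring from the rest.\<close>
  define T :: "(real \<times> bool) \<times> sample \<Rightarrow> sample" where "T = (\<lambda>z. fun_upd (snd z) i0 (fst z))"
  interpret P': prob_space ?P' by (rule prob_space_PiM) (rule prob_space_wait_dist)
  define m' where "m' = m(k0 := Suc (m k0))"
  define wt where "wt = (\<Prod>(k, d)\<leftarrow>ks. direction_weight p d)"
  define K where "K = wt * (\<Prod>k\<in>{1..N} - {k0}. exp (- (t - a k)))"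
  define n where "n = length ks"
  have wt: "0 \<le> wt" unfolding wt_def using p
    by (intro prod_list_nonneg) (auto simp: direction_weight_def)
  define A where "A = {\<omega> \<in> space ?P. history N t (x # ks) m a s \<omega>}"
  have A: "A \<in> sets ?P"
  proof -
    have "Measurable.pred ?P (\<lambda>\<omega>. history N t (x # ks) m a s \<omega>)"
      using Cons.prems by (intro measurable_history[where I = I and p = p]) auto
    then show ?thesis unfolding A_def by simp
  qed
  have T: "T \<in> ?W \<Otimes>\<^sub>M ?P' \<rightarrow>\<^sub>M ?P"
    unfolding I'[symmetric] T_def by measurable
  have "emeasure ?P A = emeasure (distr (?W \<Otimes>\<^sub>M ?P') ?P T) A"
    using distr_pair_PiM_eq_PiM[of I' "\<lambda>_. ?W" i0] prob_space_wait_dist by (simp add: I' T_def split_def)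
  also have "\<dots> = emeasure (?W \<Otimes>\<^sub>M ?P') (T -` A \<inter> space (?W \<Otimes>\<^sub>M ?P'))"
    by (rule emeasure_distr[OF T A])
  also have "\<dots> = (\<integral>\<^sup>+y. emeasure ?P' (Pair y -` (T -` A \<inter> space (?W \<Otimes>\<^sub>M ?P'))) \<partial>?W)"
    by (rule P'.emeasure_pair_measure_alt) (rule measurable_sets[OF T A])
  also have "\<dots> = (\<integral>\<^sup>+y. (if snd y = d0 then (if s < a k0 + fst y \<and> a k0 + fst y \<le> t
      then ennreal (K * exp (- (t - (a k0 + fst y))) * (t - (a k0 + fst y)) ^ n / fact n) else 0) else 0) \<partial>?W)"
  proof (intro nn_integral_cong)
    fix y :: "real \<times> bool"
    define \<tau> where "\<tau> = a k0 + fst y"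
    let ?a = "a(k0 := \<tau>)"
    \<comment> \<open>The rest of the history reads only coordinates with counters at least
      \<open>m'\<close>, and \<open>i0\<close> lies just below that.\<close>
    have inner: "history N t ks m' ?a \<tau> (fun_upd \<omega> i0 y) = history N t ks m' ?a \<tau> \<omega>" for \<omega>
      by (rule history_cong) (auto simp: m'_def i0_def split: if_splits)
    have upd: "fun_upd \<omega> i0 y \<in> space ?P" if "\<omega> \<in> space ?P'" for \<omega>
      using measurable_space[OF T, of "(y, \<omega>)"] that by (simp add: space_pair_measure T_def)
    have "Pair y -` (T -` A \<inter> space (?W \<Otimes>\<^sub>M ?P')) =
        {\<omega> \<in> space ?P'. history N t (x # ks) m a s (fun_upd \<omega> i0 y)}"
      using upd by (auto simp: A_def space_pair_measure T_def)
    also have "\<dots> = (if s < \<tau> \<and> \<tau> \<le> t \<and> snd y = d0 then {\<omega> \<in> space ?P'. history N t ks m' ?a \<tau> \<omega>} else {})"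
      using inner by (auto simp: x i0_def[symmetric] m'_def[symmetric] \<tau>_def[symmetric])
    finally have eq: "Pair y -` (T -` A \<inter> space (?W \<Otimes>\<^sub>M ?P')) =
        (if s < \<tau> \<and> \<tau> \<le> t \<and> snd y = d0 then {\<omega> \<in> space ?P'. history N t ks m' ?a \<tau> \<omega>} else {})" .
    have "emeasure ?P' {\<omega> \<in> space ?P'. history N t ks m' ?a \<tau> \<omega>} =
        ennreal (K * exp (- (t - \<tau>)) * (t - \<tau>) ^ n / fact n)" if "s < \<tau>" "\<tau> \<le> t"
    proof -
      have "emeasure ?P' {\<omega> \<in> space ?P'. history N t ks m' ?a \<tau> \<omega>} =
          ennreal (wt * (\<Prod>k=1..N. exp (- (t - ?a k))) * (t - \<tau>) ^ length ks / fact (length ks))"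
        unfolding wt_def
      proof (rule Cons.IH)
        show "(k, j) \<in> I'" if "k \<in> {1..N}" "m' k \<le> j" for k j
          using that Cons.prems(1)[of k j] by (auto simp: I'_def i0_def m'_def split: if_splits)
        show "?a k \<le> \<tau>" if "k \<in> {1..N}" for k
          using Cons.prems(2)[OF that] \<open>s < \<tau>\<close> by auto
        show "\<tau> \<le> t" by fact
        show "fst ` set ks \<subseteq> {1..N}" using Cons.prems by auto
      qed
      also have "(\<Prod>k=1..N. exp (- (t - ?a k))) = exp (- (t - \<tau>)) * (\<Prod>k\<in>{1..N} - {k0}. exp (- (t - a k)))"
        using k0 by (subst prod.remove[of _ k0]) (auto intro!: prod.cong)
      finally show ?thesis by (simp add: K_def n_def mult_ac del: fun_upd_apply)
    qed
    then show "emeasure ?P' (Pair y -` (T -` A \<inter> space (?W \<Otimes>\<^sub>M ?P'))) =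
        (if snd y = d0 then (if s < a k0 + fst y \<and> a k0 + fst y \<le> t
      then ennreal (K * exp (- (t - (a k0 + fst y))) * (t - (a k0 + fst y)) ^ n / fact n) else 0) else 0)"
      unfolding eq \<tau>_def[symmetric] by auto
  qed
  also have "\<dots> = ennreal (direction_weight p d0) * (\<integral>\<^sup>+y. ennreal (exponential_density 1 y) *
      (if s < a k0 + y \<and> a k0 + y \<le> t then ennreal (K * exp (- (t - (a k0 + y))) * (t - (a k0 + y)) ^ n / fact n) else 0) \<partial>lborel)"
    by (rule nn_integral_wait_dist[OF p]) measurable
  also have "\<dots> = ennreal (direction_weight p d0) * ennreal (K * exp (- (t - a k0)) * (t - s) ^ Suc n / fact (Suc n))"
    using Cons.prems(2)[OF k0] Cons.prems(3) wt
    by (subst nn_integral_ring) (auto simp: K_def intro!: mult_nonneg_nonneg prod_nonneg)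
  also have "\<dots> = ennreal (direction_weight p d0 * (K * exp (- (t - a k0)) * (t - s) ^ Suc n / fact (Suc n)))"
    using p by (intro ennreal_mult'[symmetric]) (auto simp: direction_weight_def)
  also have "direction_weight p d0 * (K * exp (- (t - a k0)) * (t - s) ^ Suc n / fact (Suc n)) =
      (\<Prod>(k, d)\<leftarrow>x # ks. direction_weight p d) * (\<Prod>k=1..N. exp (- (t - a k))) * (t - s) ^ length (x # ks) / fact (length (x # ks))"
    using k0 by (subst prod.remove[of _ k0]) (simp_all add: K_def wt_def n_def x mult_ac)
  finally show ?case by (simp add: A_def)
qed

section \<open>The rings of the clocks\<close>

fun ring_indices :: "(nat \<times> bool) list \<Rightarrow> (nat \<Rightarrow> nat) \<Rightarrow> (nat \<times> nat) list" where
  "ring_indices [] m = []"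
| "ring_indices ((k, d) # ks) m = (k, m k) # ring_indices ks (m(k := Suc (m k)))"

definition ring_moves :: "sample \<Rightarrow> (nat \<times> nat) list \<Rightarrow> (nat \<times> bool) list" where
  "ring_moves \<omega> rs = map (\<lambda>(k, j). (k, snd (\<omega> (k, j)))) rs"

text \<open>Since \<open>a k\<close> is the sum of the waiting times already used, the times
  compared in \<open>history\<close> are values of \<open>ring_time\<close>. Nonnegative waiting
  times make these monotone for each particle, so a next ring after \<open>t\<close> excludes all
  later ones up to \<open>t\<close>.\<close>

lemma history_ring_indices:
  assumes nonneg: "\<And>i. i \<in> {1..N} \<times> UNIV \<Longrightarrow> 0 \<le> fst (\<omega> i)"
    and hist: "history N t ks m a s \<omega>"
    and a: "\<And>k. k \<in> {1..N} \<Longrightarrow> a k = (\<Sum>i<m k. fst (\<omega> (k, i)))"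
    and ks: "fst ` set ks \<subseteq> {1..N}"
  shows "sorted_wrt (<) (map (ring_time \<omega>) (ring_indices ks m)) \<and>
    (\<forall>r\<in>set (ring_indices ks m). s < ring_time \<omega> r) \<and>
    set (ring_indices ks m) = {(k, j). k \<in> {1..N} \<and> m k \<le> j \<and> ring_time \<omega> (k, j) \<le> t} \<and>
    ring_moves \<omega> (ring_indices ks m) = ks"
  using hist a ks
proof (induction ks arbitrary: m a s)
  case Nil
  have "t < ring_time \<omega> (k, j)" if "k \<in> {1..N}" "m k \<le> j" for k j
  proof -
    have "t < a k + fst (\<omega> (k, m k))" using Nil.prems(1) that(1) by simp
    also have "\<dots> = (\<Sum>i\<le>m k. fst (\<omega> (k, i)))"
      using Nil.prems(2)[OF that(1)] by (simp add: lessThan_Suc_atMost[symmetric])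
    also have "\<dots> \<le> (\<Sum>i\<le>j. fst (\<omega> (k, i)))"
      using that nonneg by (intro sum_mono2) auto
    finally show ?thesis by (simp add: ring_time_def)
  qed
  then show ?case by (force simp: ring_moves_def)
next
  case (Cons x ks)
  obtain k d where x: "x = (k, d)" by force
  have k: "k \<in> {1..N}" using Cons.prems(3) by (simp add: x)
  let ?m = "m(k := Suc (m k))"
  define \<tau> where "\<tau> = ring_time \<omega> (k, m k)"
  have \<tau>: "a k + fst (\<omega> (k, m k)) = \<tau>"
    using Cons.prems(2)[OF k] by (simp add: \<tau>_def ring_time_def lessThan_Suc_atMost[symmetric])
  have h: "s < \<tau>" "\<tau> \<le> t" "snd (\<omega> (k, m k)) = d" "history N t ks ?m (a(k := \<tau>)) \<tau> \<omega>"
    using Cons.prems(1) by (simp_all add: x \<tau> del: fun_upd_apply)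
  have "(a(k := \<tau>)) k' = (\<Sum>i<?m k'. fst (\<omega> (k', i)))" if "k' \<in> {1..N}" for k'
    using Cons.prems(2)[OF that] Cons.prems(2)[OF k] \<tau> by (cases "k' = k") auto
  moreover have "fst ` set ks \<subseteq> {1..N}" using Cons.prems(3) by simp
  ultimately have IH: "sorted_wrt (<) (map (ring_time \<omega>) (ring_indices ks ?m))"
    "\<And>r. r \<in> set (ring_indices ks ?m) \<Longrightarrow> \<tau> < ring_time \<omega> r"
    "set (ring_indices ks ?m) = {(k, j). k \<in> {1..N} \<and> ?m k \<le> j \<and> ring_time \<omega> (k, j) \<le> t}"
    "ring_moves \<omega> (ring_indices ks ?m) = ks"
    using Cons.IH[OF h(4)] by blast+
  have "{(k, j). k \<in> {1..N} \<and> m k \<le> j \<and> ring_time \<omega> (k, j) \<le> t} =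
      insert (k, m k) {(k, j). k \<in> {1..N} \<and> ?m k \<le> j \<and> ring_time \<omega> (k, j) \<le> t}"
  proof (intro set_eqI, clarify)
    fix k' j
    show "(k', j) \<in> {(k, j). k \<in> {1..N} \<and> m k \<le> j \<and> ring_time \<omega> (k, j) \<le> t} \<longleftrightarrow>
      (k', j) \<in> insert (k, m k) {(k, j). k \<in> {1..N} \<and> ?m k \<le> j \<and> ring_time \<omega> (k, j) \<le> t}"
    proof (cases "k' = k \<and> j = m k")
      case True
      then show ?thesis using k h(2) by (simp add: \<tau>_def)
    next
      case False
      then have m: "m k' \<le> j \<longleftrightarrow> ?m k' \<le> j" by auto
      show ?thesis
        unfolding mem_Collect_eq insert_iff prod.inject case_prod_conv m using False by blast
    qed
  qed
  then have "set (ring_indices (x # ks) m) = {(k, j). k \<in> {1..N} \<and> m k \<le> j \<and> ring_time \<omega> (k, j) \<le> t}"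
    using IH(3) by (simp add: x)
  moreover have "sorted_wrt (<) (map (ring_time \<omega>) (ring_indices (x # ks) m))"
    using IH(1,2) by (simp add: x \<tau>_def[symmetric] del: fun_upd_apply)
  moreover have "\<forall>r\<in>set (ring_indices (x # ks) m). s < ring_time \<omega> r"
    using IH(2) h(1) by (auto simp: x \<tau>_def[symmetric] simp del: fun_upd_apply intro: less_trans)
  moreover have "ring_moves \<omega> (ring_indices (x # ks) m) = x # ks"
    using IH(4) h(3) by (simp add: x ring_moves_def del: fun_upd_apply)
  ultimately show ?case by blast
qed

definition is_ring_list :: "nat \<Rightarrow> real \<Rightarrow> sample \<Rightarrow> (nat \<times> nat) list \<Rightarrow> bool" where
  "is_ring_list N t \<omega> rs \<longleftrightarrow> sorted_wrt (<) (map (ring_time \<omega>) rs) \<and>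
    set rs = {r \<in> {1..N} \<times> UNIV. ring_time \<omega> r \<le> t}"

lemma is_ring_list_unique:
  assumes "is_ring_list N t \<omega> rs" "is_ring_list N t \<omega> rs'"
  shows "rs = rs'"
proof -
  have s: "sorted_wrt (<) (map (ring_time \<omega>) rs)" "sorted_wrt (<) (map (ring_time \<omega>) rs')" "set rs = set rs'"
    using assms by (auto simp: is_ring_list_def)
  have "map (ring_time \<omega>) rs = map (ring_time \<omega>) rs'"
    using s by (intro sorted_distinct_set_unique) (auto simp: strict_sorted_iff)
  moreover have "inj_on (ring_time \<omega>) (set rs \<union> set rs')"
    using s by (simp add: strict_sorted_iff distinct_map)
  ultimately show ?thesis by (rule map_inj_on)
qed

lemma rings_eq: "is_ring_list N t \<omega> rs \<Longrightarrow> rings N t \<omega> = rs"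
  unfolding rings_def is_ring_list_def[symmetric] by (intro the_equality is_ring_list_unique)

text \<open>Where no such list exists, \<open>rings\<close> has the fixed value
  \<open>THE rs. False\<close>. Including this case makes the event measurable on the whole sample
  space and not only up to a null set.\<close>

lemma rings_eq_iff:
  "rings N t \<omega> = rs \<longleftrightarrow> is_ring_list N t \<omega> rs \<or>
    ((\<forall>rs'. \<not> is_ring_list N t \<omega> rs') \<and> rs = (THE rs. False))"
proof (cases "\<exists>rs'. is_ring_list N t \<omega> rs'")
  case True
  then obtain rs' where rs': "is_ring_list N t \<omega> rs'" by blast
  have eq: "is_ring_list N t \<omega> u \<longleftrightarrow> u = rs'" for u
    using rs' is_ring_list_unique[OF rs', of u] by blast
  show ?thesis unfolding rings_eq[OF rs'] eq by blast
next
  case False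
  then have "rings N t \<omega> = (THE rs. False)"
    unfolding rings_def is_ring_list_def[symmetric] by simp
  with False show ?thesis by auto
qed

lemma config_at_eq:
  "config_at N Y v t \<omega> = fold (move (species v)) (ring_moves \<omega> (rings N t \<omega>)) (initial_config N Y)"
  unfolding config_at_def ring_moves_def fold_map
  by (intro arg_cong[where f = "\<lambda>g. fold g (rings N t \<omega>) (initial_config N Y)"]) (auto simp: fun_eq_iff move_def)

lemma history_rings:
  assumes "\<And>i. i \<in> {1..N} \<times> UNIV \<Longrightarrow> 0 \<le> fst (\<omega> i)"
    and "history N t ks (\<lambda>_. 0) (\<lambda>_. 0) 0 \<omega>" "fst ` set ks \<subseteq> {1..N}"
  shows "ring_moves \<omega> (rings N t \<omega>) = ks"
proof -
  note h = history_ring_indices[OF assms(1,2) _ assms(3)]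
  have "is_ring_list N t \<omega> (ring_indices ks (\<lambda>_. 0))"
    unfolding is_ring_list_def using h by auto
  then show ?thesis using rings_eq h by fastforce
qed

section \<open>Measurability and nonnegative waiting times\<close>

lemma clocks_eq: "clocks N p = PiM ({1..N} \<times> UNIV) (\<lambda>_. wait_dist p)"
  by (simp add: clocks_def wait_dist_def)

lemma prob_space_clocks: "prob_space (clocks N p)"
  unfolding clocks_eq by (intro prob_space_PiM prob_space_wait_dist)

lemma measurable_coordinate_clocks:
  assumes "r \<in> {1..N} \<times> UNIV"
  shows "(\<lambda>\<omega>. fst (\<omega> r)) \<in> borel_measurable (clocks N p)" "(\<lambda>\<omega>. snd (\<omega> r)) \<in> clocks N p \<rightarrow>\<^sub>M count_space UNIV"
  unfolding clocks_eq
  using measurable_compose[OF measurable_component_singleton[OF assms] measurable_fst_wait_dist]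
    measurable_compose[OF measurable_component_singleton[OF assms] measurable_snd_wait_dist] by auto

lemma measurable_ring_time:
  assumes "r \<in> {1..N} \<times> UNIV"
  shows "(\<lambda>\<omega>. ring_time \<omega> r) \<in> borel_measurable (clocks N p)"
proof -
  obtain k j where r: "r = (k, j)" by force
  have "(\<lambda>\<omega>. \<Sum>i\<le>j. fst (\<omega> (k, i))) \<in> borel_measurable (clocks N p)"
    using assms r by (intro borel_measurable_sum measurable_coordinate_clocks) auto
  then show ?thesis by (simp add: r ring_time_def)
qed

lemma measurable_is_ring_list: "Measurable.pred (clocks N p) (\<lambda>\<omega>. is_ring_list N t \<omega> rs)"
proof (cases "set rs \<subseteq> {1..N} \<times> UNIV")
  case True
  have 1: "Measurable.pred (clocks N p) (\<lambda>\<omega>. ring_time \<omega> (rs ! i) < ring_time \<omega> (rs ! j))"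
    if "i < length rs" "j < length rs" for i j
  proof -
    have "rs ! i \<in> {1..N} \<times> UNIV" "rs ! j \<in> {1..N} \<times> UNIV" using True that nth_mem by blast+
    note [measurable] = measurable_ring_time[OF this(1)] measurable_ring_time[OF this(2)]
    show ?thesis by measurable
  qed
  have 2: "Measurable.pred (clocks N p) (\<lambda>\<omega>. r \<in> {1..N} \<times> UNIV \<longrightarrow> (r \<in> set rs \<longleftrightarrow> ring_time \<omega> r \<le> t))" for r
  proof (cases "r \<in> {1..N} \<times> UNIV")
    case True
    note [measurable] = measurable_ring_time[OF True]
    show ?thesis by measurable
  qed simp
  have "is_ring_list N t \<omega> rs \<longleftrightarrow> (\<forall>i\<in>{..<length rs}. \<forall>j\<in>{..<length rs}. i < j \<longrightarrow> ring_time \<omega> (rs ! i) < ring_time \<omega> (rs ! j)) \<and>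
      (\<forall>r. r \<in> {1..N} \<times> UNIV \<longrightarrow> (r \<in> set rs \<longleftrightarrow> ring_time \<omega> r \<le> t))" for \<omega>
    unfolding is_ring_list_def sorted_wrt_iff_nth_less using True by (auto simp: less_trans)
  moreover have "Measurable.pred (clocks N p) (\<lambda>\<omega>.
      (\<forall>i\<in>{..<length rs}. \<forall>j\<in>{..<length rs}. i < j \<longrightarrow> ring_time \<omega> (rs ! i) < ring_time \<omega> (rs ! j)) \<and>
      (\<forall>r. r \<in> {1..N} \<times> UNIV \<longrightarrow> (r \<in> set rs \<longleftrightarrow> ring_time \<omega> r \<le> t)))"
  proof -
    have 3: "Measurable.pred (clocks N p) (\<lambda>\<omega>. i < j \<longrightarrow> ring_time \<omega> (rs ! i) < ring_time \<omega> (rs ! j))"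
      if "i \<in> {..<length rs}" "j \<in> {..<length rs}" for i j
      using 1[of i j] that by (cases "i < j") auto
    have [measurable]: "Measurable.pred (clocks N p) (\<lambda>\<omega>.
        \<forall>i\<in>{..<length rs}. \<forall>j\<in>{..<length rs}. i < j \<longrightarrow> ring_time \<omega> (rs ! i) < ring_time \<omega> (rs ! j))"
      by (intro pred_intros_finite 3 finite_lessThan)
    have [measurable]: "Measurable.pred (clocks N p) (\<lambda>\<omega>.
        \<forall>r. r \<in> {1..N} \<times> UNIV \<longrightarrow> (r \<in> set rs \<longleftrightarrow> ring_time \<omega> r \<le> t))"
      by (intro pred_intros_countable 2)
    show ?thesis by (rule pred_intros_logic) fact+
  qed
  ultimately show ?thesis by (simp only:)
next
  case False
  then have "\<not> is_ring_list N t \<omega> rs" for \<omega> by (auto simp: is_ring_list_def)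
  then show ?thesis by simp
qed

lemma measurable_ring_moves: "Measurable.pred (clocks N p) (\<lambda>\<omega>. ring_moves \<omega> rs = ks)"
proof -
  have 1: "Measurable.pred (clocks N p) (\<lambda>\<omega>. (case rs ! i of (k, j) \<Rightarrow> (k, snd (\<omega> (k, j)))) = ks ! i)" for i
  proof -
    obtain k j where r: "rs ! i = (k, j)" by force
    have "Measurable.pred (clocks N p) (\<lambda>\<omega>. snd (\<omega> (k, j)) = snd (ks ! i))"
    proof (cases "(k, j) \<in> {1..N} \<times> (UNIV :: nat set)")
      case True
      note [measurable] = measurable_coordinate_clocks(2)[OF True]
      show ?thesis by measurable
    next
      \<comment> \<open>Outside the index set a sample takes the value \<open>undefined\<close>, so
        the event is constant.\<close>
      case False
      have undef: "\<omega> (k, j) = undefined" if "\<omega> \<in> space (clocks N p)" for \<omega>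
        using that False unfolding clocks_eq space_PiM by (rule PiE_arb)
      have "Measurable.pred (clocks N p) (\<lambda>\<omega>. snd (\<omega> (k, j)) = snd (ks ! i)) \<longleftrightarrow>
          Measurable.pred (clocks N p) (\<lambda>\<omega>. snd (undefined :: real \<times> bool) = snd (ks ! i))"
        by (rule measurable_cong) (simp only: undef)
      then show ?thesis by simp
    qed
    then have "Measurable.pred (clocks N p) (\<lambda>\<omega>. k = fst (ks ! i) \<and> snd (\<omega> (k, j)) = snd (ks ! i))"
      by (intro pred_intros_logic(3)) simp_all
    also have "(\<lambda>\<omega>. k = fst (ks ! i) \<and> snd (\<omega> (k, j)) = snd (ks ! i)) =
        (\<lambda>\<omega> :: sample. (case rs ! i of (k, j) \<Rightarrow> (k, snd (\<omega> (k, j)))) = ks ! i)"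
      by (rule ext) (simp add: r prod_eq_iff)
    finally show ?thesis .
  qed
  have "ring_moves \<omega> rs = ks \<longleftrightarrow> length rs = length ks \<and>
      (\<forall>i\<in>{..<length rs}. (case rs ! i of (k, j) \<Rightarrow> (k, snd (\<omega> (k, j)))) = ks ! i)" for \<omega>
    by (auto simp: ring_moves_def list_eq_iff_nth_eq)
  moreover have "Measurable.pred (clocks N p) (\<lambda>\<omega>. length rs = length ks \<and>
      (\<forall>i\<in>{..<length rs}. (case rs ! i of (k, j) \<Rightarrow> (k, snd (\<omega> (k, j)))) = ks ! i))"
    by (intro pred_intros_logic(3) pred_intros_finite finite_lessThan 1) simp
  ultimately show ?thesis by (simp only:)
qed

text \<open>The configuration depends on the sample only through the list of rings and the list of
  moves. There are countably many such lists, so the event is a countable union for any predicate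
  \<open>Q\<close>.\<close>

lemma measurable_config_at: "Measurable.pred (clocks N p) (\<lambda>\<omega>. Q (config_at N Y v t \<omega>))"
proof -
  have 1: "Measurable.pred (clocks N p) (\<lambda>\<omega>. rings N t \<omega> = rs)" for rs
    unfolding rings_eq_iff
    by (intro pred_intros_logic(2,3,5) pred_intros_countable(1) measurable_is_ring_list) simp
  have "Q (config_at N Y v t \<omega>) \<longleftrightarrow> (\<exists>rs ks. rings N t \<omega> = rs \<and> ring_moves \<omega> rs = ks \<and>
      Q (fold (move (species v)) ks (initial_config N Y)))" for \<omega>
    by (simp add: config_at_eq)
  moreover have "Measurable.pred (clocks N p) (\<lambda>\<omega>. \<exists>rs ks. rings N t \<omega> = rs \<and> ring_moves \<omega> rs = ks \<and>
      Q (fold (move (species v)) ks (initial_config N Y)))"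
    by (intro pred_intros_countable(2) pred_intros_logic(3) 1 measurable_ring_moves) simp
  ultimately show ?thesis by (simp only:)
qed

lemma AE_wait_nonneg: "AE x in wait_dist p. 0 \<le> fst x"
proof -
  interpret A: prob_space "density lborel (exponential_density 1)"
    by (rule prob_space_exponential_density) simp
  interpret pair_prob_space "density lborel (exponential_density 1)" "measure_pmf (bernoulli_pmf p)" ..
  have "AE y in density lborel (exponential_density 1). 0 \<le> y"
    by (subst AE_density) (auto simp: exponential_density_def split: if_splits)
  then have "AE y in density lborel (exponential_density 1). AE b in measure_pmf (bernoulli_pmf p). 0 \<le> fst (y, b)"
    by eventually_elim simp
  moreover have "{x \<in> space (wait_dist p). 0 \<le> fst x} \<in> sets (wait_dist p)" by measurable
  ultimately show ?thesis unfolding wait_dist_def by (intro AE_pair_measure)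
qed

lemma AE_clocks_nonneg: "AE \<omega> in clocks N p. \<forall>i\<in>{1..N} \<times> UNIV. 0 \<le> fst (\<omega> i)"
proof -
  have "AE \<omega> in clocks N p. 0 \<le> fst (\<omega> i)" if "i \<in> {1..N} \<times> UNIV" for i
    unfolding clocks_eq
    using AE_PiM_component[of "{1..N} \<times> UNIV" "\<lambda>_. wait_dist p" i "\<lambda>x. 0 \<le> fst x"]
      prob_space_wait_dist that AE_wait_nonneg by blast
  then show ?thesis by (subst AE_ball_countable) auto
qed

section \<open>Summation over the number of rings\<close>

definition move_lists :: "nat \<Rightarrow> nat \<Rightarrow> (nat \<times> bool) list set" where
  "move_lists N n = {ks. set ks \<subseteq> {1..N} \<times> UNIV \<and> length ks = n}"

lemma finite_move_lists [simp]: "finite (move_lists N n)"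
  unfolding move_lists_def by (rule finite_lists_length_eq) simp

lemma sum_move_lists_Suc:
  "(\<Sum>ks\<in>move_lists N (Suc n). F ks) = (\<Sum>x\<in>{1..N} \<times> UNIV. \<Sum>ks\<in>move_lists N n. F (x # ks))"
proof -
  have "(\<Sum>x\<in>{1..N} \<times> UNIV. \<Sum>ks\<in>move_lists N n. F (x # ks)) =
      (\<Sum>(x, ks)\<in>({1..N} \<times> UNIV) \<times> move_lists N n. F (x # ks))"
    by (rule sum.cartesian_product)
  also have "\<dots> = (\<Sum>ks\<in>move_lists N (Suc n). F ks)"
    by (rule sum.reindex_bij_witness[of _ "\<lambda>ks. (hd ks, tl ks)" "\<lambda>(x, ks). x # ks"])
      (auto simp: move_lists_def length_Suc_conv)
  finally show ?thesis by simp
qed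

definition list_weight :: "real \<Rightarrow> (nat \<times> bool) list \<Rightarrow> real" where
  "list_weight p ks = (\<Prod>(k, d)\<leftarrow>ks. direction_weight p d)"

lemma list_weight_simps [simp]:
  "list_weight p [] = 1" "list_weight p ((k, d) # ks) = direction_weight p d * list_weight p ks"
  by (simp_all add: list_weight_def)

text \<open>\<open>fold\<close> performs the head of the list first, so here the first ring is split
  off as the outermost factor of the iterate; hence the induction is over all starting
  configurations \<open>c\<close>.\<close>

lemma sum_list_weight:
  "(\<Sum>ks\<in>move_lists N n. of_real (list_weight p ks) * f (fold (move sp) ks c)) = (move_average N p sp ^^ n) f c"
proof (induction n arbitrary: c)
  case 0
  have "move_lists N 0 = {[]}" by (auto simp: move_lists_def)
  then show ?case by simp
next
  case (Suc n)
  have "(\<Sum>ks\<in>move_lists N (Suc n). of_real (list_weight p ks) * f (fold (move sp) ks c)) =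
      (\<Sum>x\<in>{1..N} \<times> UNIV. of_real (direction_weight p (snd x)) *
        (\<Sum>ks\<in>move_lists N n. of_real (list_weight p ks) * f (fold (move sp) ks (move sp x c))))"
    unfolding sum_move_lists_Suc sum_distrib_left
    by (intro sum.cong refl) (auto simp: mult.assoc)
  also have "\<dots> = (\<Sum>x\<in>{1..N} \<times> UNIV. of_real (direction_weight p (snd x)) * (move_average N p sp ^^ n) f (move sp x c))"
    by (simp only: Suc)
  also have "\<dots> = (\<Sum>k=1..N. \<Sum>d\<in>UNIV. of_real (direction_weight p d) * (move_average N p sp ^^ n) f (move sp (k, d) c))"
    by (subst sum.cartesian_product) (auto simp: split_def intro!: sum.cong)
  also have "\<dots> = move_average N p sp ((move_average N p sp ^^ n) f) c"
    unfolding move_average_def[of N p sp "(move_average N p sp ^^ n) f" c]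
    by (simp add: UNIV_bool direction_weight_def move_def add.commute)
  finally show ?case by simp
qed

lemma sum_list_weight_one: "(\<Sum>ks\<in>move_lists N n. list_weight p ks) = real N ^ n"
proof (induction n)
  case 0
  have "move_lists N 0 = {[]}" by (auto simp: move_lists_def)
  then show ?case by simp
next
  case (Suc n)
  have "(\<Sum>ks\<in>move_lists N (Suc n). list_weight p ks) =
      (\<Sum>x\<in>{1..N} \<times> UNIV. direction_weight p (snd x) * (\<Sum>ks\<in>move_lists N n. list_weight p ks))"
    unfolding sum_move_lists_Suc sum_distrib_left by (intro sum.cong refl) auto
  also have "\<dots> = (\<Sum>x\<in>{1..N} \<times> UNIV. direction_weight p (snd x)) * real N ^ n"
    by (simp add: Suc sum_distrib_right)
  also have "(\<Sum>x\<in>{1..N} \<times> UNIV. direction_weight p (snd x)) = (\<Sum>k=1..N. \<Sum>d\<in>UNIV. direction_weight p d)"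
    by (subst sum.cartesian_product) (auto simp: split_def intro!: sum.cong)
  also have "\<dots> = real N" by (simp add: UNIV_bool direction_weight_def)
  finally show ?case by simp
qed

text \<open>The samples are classified by their histories. A history determines the list of moves,
  so different histories exclude each other almost surely; their probabilities add up to one, so
  almost surely some history occurs. Thus finiteness and absence of ties need no separate
  argument.\<close>

lemma transition_prob_sums:
  assumes p: "0 \<le> p" "p \<le> 1" and t: "0 \<le> t"
  shows "(\<lambda>n. exp (- (real N * t)) * t ^ n / fact n *
      (\<Sum>ks\<in>move_lists N n. list_weight p ks *
        (if in_state N (species v) (fold (move (species v)) ks (initial_config N Y)) X w then 1 else 0)))
    sums transition_prob N p Y v X w t"
proof -
  interpret prob_space "clocks N p" by (rule prob_space_clocks)
  let ?h = "\<lambda>ks \<omega>. history N t ks (\<lambda>_. 0) (\<lambda>_. 0) 0 \<omega>"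
  let ?end = "\<lambda>ks. in_state N (species v) (fold (move (species v)) ks (initial_config N Y)) X w"
  have ev: "Measurable.pred (clocks N p) (?h ks)" if "ks \<in> move_lists N n" for ks n
    unfolding clocks_eq using that
    by (intro measurable_history[where I = "{1..N} \<times> UNIV" and p = p]) (auto simp: move_lists_def)
  have ev_and: "Measurable.pred (clocks N p) (\<lambda>\<omega>. ?h ks \<omega> \<and> q ks)" if "ks \<in> move_lists N n" for ks n q
    using ev[OF that] by (cases "q ks") simp_all
  have ev_ex: "Measurable.pred (clocks N p) (\<lambda>\<omega>. \<exists>ks\<in>move_lists N n. ?h ks \<omega> \<and> q ks)" for n q
    by (intro pred_intros_finite finite_move_lists ev_and)
  have ev_ex2: "Measurable.pred (clocks N p) (\<lambda>\<omega>. \<exists>n. \<exists>ks\<in>move_lists N n. ?h ks \<omega> \<and> q ks)" for q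
    by (intro pred_intros_countable(2) ev_ex)
  have prob_ev: "prob {\<omega> \<in> space (clocks N p). ?h ks \<omega>} = exp (- (real N * t)) * t ^ n / fact n * list_weight p ks"
    if "ks \<in> move_lists N n" for ks n
  proof -
    have "emeasure (clocks N p) {\<omega> \<in> space (clocks N p). ?h ks \<omega>} =
      ennreal (list_weight p ks * (\<Prod>k=1..N. exp (- (t - 0))) * (t - 0) ^ length ks / fact (length ks))"
      unfolding clocks_eq list_weight_def
      using that t by (intro emeasure_history[OF p]) (auto simp: move_lists_def)
    also have "(\<Prod>k=1..N. exp (- (t - 0))) = exp (- (real N * t))"
      by (simp add: exp_of_nat_mult[symmetric])
    also have "list_weight p ks * exp (- (real N * t)) * (t - 0) ^ length ks / fact (length ks) =
      exp (- (real N * t)) * t ^ n / fact n * list_weight p ks"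
      using that by (simp add: move_lists_def mult_ac)
    finally have "emeasure (clocks N p) {\<omega> \<in> space (clocks N p). ?h ks \<omega>} =
      ennreal (exp (- (real N * t)) * t ^ n / fact n * list_weight p ks)" .
    moreover have "0 \<le> list_weight p ks"
      unfolding list_weight_def using p by (intro prod_list_nonneg) (auto simp: direction_weight_def)
    ultimately show ?thesis using t by (simp add: measure_def)
  qed
  have moves: "AE \<omega> in clocks N p. \<forall>n. \<forall>ks\<in>move_lists N n. ?h ks \<omega> \<longrightarrow> ring_moves \<omega> (rings N t \<omega>) = ks"
    using AE_clocks_nonneg
  proof eventually_elim
    case (elim \<omega>)
    show ?case
      using elim by (intro allI ballI impI history_rings) (auto simp: move_lists_def)
  qed
  have sum_event: "prob {\<omega> \<in> space (clocks N p). \<exists>ks\<in>move_lists N n. ?h ks \<omega> \<and> q ks} =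
      exp (- (real N * t)) * t ^ n / fact n * (\<Sum>ks\<in>move_lists N n. list_weight p ks * (if q ks then 1 else 0))" for n q
  proof -
    have "prob {\<omega> \<in> space (clocks N p). \<exists>ks\<in>move_lists N n. ?h ks \<omega> \<and> q ks} =
        (\<Sum>ks\<in>move_lists N n. prob {\<omega> \<in> space (clocks N p). ?h ks \<omega> \<and> q ks})"
    proof (rule prob_sum)
      show "{\<omega> \<in> space (clocks N p). ?h ks \<omega> \<and> q ks} \<in> events" if "ks \<in> move_lists N n" for ks
        using ev_and[OF that] unfolding pred_def .
      show "{\<omega> \<in> space (clocks N p). \<exists>ks\<in>move_lists N n. ?h ks \<omega> \<and> q ks} \<in> events"
        using ev_ex unfolding pred_def .
      show "AE \<omega> in clocks N p. (\<forall>ks\<in>move_lists N n. ?h ks \<omega> \<and> q ks \<longrightarrow> (\<exists>ks\<in>move_lists N n. ?h ks \<omega> \<and> q ks)) \<and>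
          ((\<exists>ks\<in>move_lists N n. ?h ks \<omega> \<and> q ks) \<longrightarrow> (\<exists>!ks. ks \<in> move_lists N n \<and> ?h ks \<omega> \<and> q ks))"
        using moves by eventually_elim blast
    qed simp
    also have "\<dots> = (\<Sum>ks\<in>move_lists N n. exp (- (real N * t)) * t ^ n / fact n * (list_weight p ks * (if q ks then 1 else 0)))"
      by (intro sum.cong refl) (auto simp: prob_ev)
    finally show ?thesis by (simp add: sum_distrib_left)
  qed
  have series: "(\<lambda>n. exp (- (real N * t)) * t ^ n / fact n *
        (\<Sum>ks\<in>move_lists N n. list_weight p ks * (if q ks then 1 else 0))) sums
      prob {\<omega> \<in> space (clocks N p). \<exists>n. \<exists>ks\<in>move_lists N n. ?h ks \<omega> \<and> q ks}" for q
    unfolding sum_event[symmetric]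
  proof (rule prob_sums)
    show "{\<omega> \<in> space (clocks N p). \<exists>ks\<in>move_lists N n. ?h ks \<omega> \<and> q ks} \<in> events" for n
      using ev_ex unfolding pred_def .
    show "{\<omega> \<in> space (clocks N p). \<exists>n. \<exists>ks\<in>move_lists N n. ?h ks \<omega> \<and> q ks} \<in> events"
      using ev_ex2 unfolding pred_def .
    show "AE \<omega> in clocks N p. (\<forall>n. (\<exists>ks\<in>move_lists N n. ?h ks \<omega> \<and> q ks) \<longrightarrow> (\<exists>n. \<exists>ks\<in>move_lists N n. ?h ks \<omega> \<and> q ks)) \<and>
        ((\<exists>n. \<exists>ks\<in>move_lists N n. ?h ks \<omega> \<and> q ks) \<longrightarrow> (\<exists>!n. \<exists>ks\<in>move_lists N n. ?h ks \<omega> \<and> q ks))"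
      using moves
    proof eventually_elim
      case (elim \<omega>)
      have "n = n'" if "ks \<in> move_lists N n" "?h ks \<omega>" "ks' \<in> move_lists N n'" "?h ks' \<omega>" for n n' ks ks'
      proof -
        have "ks = ks'" using elim that by blast
        then show ?thesis using that by (simp add: move_lists_def)
      qed
      then show ?case by blast
    qed
  qed
  \<comment> \<open>The total mass: there are weights \<open>real N ^ n\<close> for \<open>n\<close>
    rings, and the Poisson probabilities with parameter \<open>real N * t\<close> sum to
    one.\<close>
  have "(\<lambda>n. exp (- (real N * t)) * t ^ n / fact n * real N ^ n) sums
      prob {\<omega> \<in> space (clocks N p). \<exists>n. \<exists>ks\<in>move_lists N n. ?h ks \<omega>}"
    using series[of "\<lambda>_. True"] by (simp add: sum_list_weight_one)
  moreover have "(\<lambda>n. exp (- (real N * t)) * ((real N * t) ^ n / fact n)) sums (exp (- (real N * t)) * exp (real N * t))"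
    using exp_converges[of "real N * t"] by (intro sums_mult) (simp add: divide_inverse mult.commute)
  ultimately have "prob {\<omega> \<in> space (clocks N p). \<exists>n. \<exists>ks\<in>move_lists N n. ?h ks \<omega>} = 1"
    by (simp add: power_mult_distrib mult_ac exp_minus_inverse sums_iff)
  then have ex: "AE \<omega> in clocks N p. \<exists>n. \<exists>ks\<in>move_lists N n. ?h ks \<omega>"
    using ev_ex2[of "\<lambda>_. True"] by (subst prob_Collect_eq_1[symmetric]) (simp_all add: pred_def)
  have "transition_prob N p Y v X w t =
      prob {\<omega> \<in> space (clocks N p). \<exists>n. \<exists>ks\<in>move_lists N n. ?h ks \<omega> \<and> ?end ks}"
    unfolding transition_prob_def
  proof (rule finite_measure_eq_AE)
    show "AE \<omega> in clocks N p. \<omega> \<in> {\<omega> \<in> space (clocks N p). in_state N (species v) (config_at N Y v t \<omega>) X w} \<longleftrightarrow>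
        \<omega> \<in> {\<omega> \<in> space (clocks N p). \<exists>n. \<exists>ks\<in>move_lists N n. ?h ks \<omega> \<and> ?end ks}"
      using ex moves
    proof eventually_elim
      case (elim \<omega>)
      then obtain n ks where ks: "ks \<in> move_lists N n" "?h ks \<omega>" by blast
      have unique: "ks' = ks" if "ks' \<in> move_lists N n'" "?h ks' \<omega>" for ks' n'
        using elim(2) that ks by blast
      have config: "config_at N Y v t \<omega> = fold (move (species v)) ks (initial_config N Y)"
        unfolding config_at_eq using elim(2) ks by simp
      have "(\<exists>n. \<exists>ks\<in>move_lists N n. ?h ks \<omega> \<and> ?end ks) \<longleftrightarrow> ?end ks"
        using ks unique by blast
      then show ?case unfolding mem_Collect_eq config by blast
    qed
    show "{\<omega> \<in> space (clocks N p). in_state N (species v) (config_at N Y v t \<omega>) X w} \<in> events"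
      using measurable_config_at[where Q = "\<lambda>c. in_state N (species v) c X w"] unfolding pred_def .
    show "{\<omega> \<in> space (clocks N p). \<exists>n. \<exists>ks\<in>move_lists N n. ?h ks \<omega> \<and> ?end ks} \<in> events"
      using ev_ex2[of ?end] unfolding pred_def .
  qed
  then show ?thesis using series[of ?end] by simp
qed

theorem theorem4p3:
  fixes N :: nat and p q t :: real
    and X Y :: "nat \<Rightarrow> int" and \<pi> \<nu> :: "nat list" and R :: "nat \<Rightarrow> real"
  assumes "N \<ge> 2" and "0 \<le> p" and "p \<le> 1" and "q = 1 - p"
    and "1 < R 1" and "strict_mono_on {1..N} R"
    and "is_state N Y \<nu>" and "is_state N X \<pi>" and "t \<ge> 0"
  shows "complex_of_real (transition_prob N p Y \<nu> X \<pi> t) =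
    (1 / (2 * complex_of_real pi * \<i>)) ^ N *
    circles_integral R N (\<lambda>\<xi>. \<Sum>\<sigma> | \<sigma> permutes {1..N}.
      A_mat N \<xi> \<sigma> \<pi> \<nu> *
      (\<Prod>i = 1..N. \<xi> (\<sigma> i) powi (X i - Y (\<sigma> i) - 1) * exp (epsilon p q (\<xi> i) * of_real t)))"
proof -
  have R_gt: "1 < R i" if "i \<in> {1..N}" for i
  proof (cases "i = 1")
    case False
    then have "R 1 < R i" using that by (intro strict_mono_onD[OF assms(6)]) auto
    then show ?thesis using assms(5) by simp
  qed (use assms(5) in simp)
  have Y: "strict_mono_on {1..N} Y" and X: "strict_mono_on {1..N} X"
    and words: "\<nu> \<in> words N N" "\<pi> \<in> words N N"
    using assms(7,8) by (auto simp: is_state_def)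
  interpret bethe N p "1 - p" Y \<nu> R by unfold_locales (use R_gt Y in auto)
  \<comment> \<open>The unit vector at \<open>\<pi>\<close> makes \<open>row_amp\<close> an entry in
    the row \<open>\<pi>\<close> and \<open>observe\<close> the indicator of the final
    state.\<close>
  let ?\<delta> = "\<lambda>w. if w = \<pi> then 1 else 0 :: complex"
  let ?a = "(2 * of_real pi * \<i>) ^ N :: complex"
  let ?c = "exp (- (of_nat N * of_real t)) :: complex"
  let ?M = "\<lambda>n. (move_average N p (species \<nu>) ^^ n) (observe N (species \<nu>) X ?\<delta>) (initial_config N Y)"
  have obs: "observe N (species \<nu>) X ?\<delta> c = (if in_state N (species \<nu>) c X \<pi> then 1 else 0)" for c
  proof -
    have "map (species \<nu>) (names N X c) = \<pi> \<longleftrightarrow> (\<forall>i\<in>{1..N}. species \<nu> (c (X i)) = \<pi> ! (i - 1))"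
    proof -
      have "map (species \<nu>) (names N X c) = \<pi> \<longleftrightarrow> (\<forall>j<N. species \<nu> (c (X (Suc j))) = \<pi> ! j)"
        using words by (auto simp: list_eq_iff_nth_eq words_def nth_names)
      also have "\<dots> \<longleftrightarrow> (\<forall>i\<in>{1..N}. species \<nu> (c (X i)) = \<pi> ! (i - 1))"
      proof (intro iffI ballI allI impI)
        fix i assume "\<forall>j<N. species \<nu> (c (X (Suc j))) = \<pi> ! j" "i \<in> {1..N}"
        then show "species \<nu> (c (X i)) = \<pi> ! (i - 1)" by (cases i) auto
      next
        fix j assume "\<forall>i\<in>{1..N}. species \<nu> (c (X i)) = \<pi> ! (i - 1)" "j < N"
        then show "species \<nu> (c (X (Suc j))) = \<pi> ! j" by fastforce
      qed
      finally show ?thesis .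
    qed
    then show ?thesis by (simp add: observe_def in_state_def)
  qed
  have "(\<lambda>n. complex_of_real (exp (- (real N * t)) * t ^ n / fact n *
      (\<Sum>ks\<in>move_lists N n. list_weight p ks *
        (if in_state N (species \<nu>) (fold (move (species \<nu>)) ks (initial_config N Y)) X \<pi> then 1 else 0))))
      sums complex_of_real (transition_prob N p Y \<nu> X \<pi> t)"
    using transition_prob_sums[OF assms(2,3,9)] by (subst sums_of_real_iff)
  moreover have "complex_of_real (exp (- (real N * t)) * t ^ n / fact n *
      (\<Sum>ks\<in>move_lists N n. list_weight p ks *
        (if in_state N (species \<nu>) (fold (move (species \<nu>)) ks (initial_config N Y)) X \<pi> then 1 else 0))) =
      ?c * (of_real t ^ n / fact n * ?M n)" for n
    unfolding sum_list_weight[symmetric] obs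
    by (simp add: exp_of_real[symmetric] if_distrib cong: if_cong)
  ultimately have lhs: "(\<lambda>n. ?c * (of_real t ^ n / fact n * ?M n)) sums complex_of_real (transition_prob N p Y \<nu> X \<pi> t)"
    by (simp only:)
  have "(\<lambda>n. of_real t ^ n / fact n * moment n X ?\<delta>) sums
      circles_integral R N (\<lambda>\<xi>. wave X ?\<delta> \<xi> * exp (of_real t * energy \<xi>))"
    by (rule moment_exp_sums)
  moreover have "moment n X ?\<delta> = ?a * ?M n" for n
    by (rule moment_eq_move_average[OF bethe_axioms words(1) X])
  ultimately have "(\<lambda>n. of_real t ^ n / fact n * (?a * ?M n)) sums
      circles_integral R N (\<lambda>\<xi>. wave X ?\<delta> \<xi> * exp (of_real t * energy \<xi>))"
    by simp
  from sums_mult[OF this, of "?c / ?a"]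
  have "(\<lambda>n. ?c * (of_real t ^ n / fact n * ?M n)) sums
      (?c / ?a * circles_integral R N (\<lambda>\<xi>. wave X ?\<delta> \<xi> * exp (of_real t * energy \<xi>)))"
    by (simp add: field_simps)
  from sums_unique2[OF lhs this]
  have "complex_of_real (transition_prob N p Y \<nu> X \<pi> t) =
      ?c / ?a * circles_integral R N (\<lambda>\<xi>. wave X ?\<delta> \<xi> * exp (of_real t * energy \<xi>))" .
  also have "\<dots> = (1 / (2 * of_real pi * \<i>)) ^ N *
      (?c * circles_integral R N (\<lambda>\<xi>. wave X ?\<delta> \<xi> * exp (of_real t * energy \<xi>)))"
    by (simp add: power_one_over)
  also have "?c * circles_integral R N (\<lambda>\<xi>. wave X ?\<delta> \<xi> * exp (of_real t * energy \<xi>)) =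
      circles_integral R N (\<lambda>\<xi>. ?c * (wave X ?\<delta> \<xi> * exp (of_real t * energy \<xi>)))"
  proof (rule circles_integral_scale[symmetric])
    show "(\<lambda>\<xi>. wave X ?\<delta> \<xi> * exp (of_real t * energy \<xi>)) \<in> separable_continuous R N"
      by (intro separable_continuous_mult separable_wave separable_exp_energy)
  qed (rule R_pos)
  also have "\<dots> = circles_integral R N (\<lambda>\<xi>. \<Sum>\<sigma> | \<sigma> permutes {1..N}. A_mat N \<xi> \<sigma> \<pi> \<nu> *
      (\<Prod>i = 1..N. \<xi> (\<sigma> i) powi (X i - Y (\<sigma> i) - 1) * exp (epsilon p q (\<xi> i) * of_real t)))"
  proof (rule circles_integral_cong[OF R_pos])
    fix \<xi> assume \<xi>: "\<xi> \<in> torus R N"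
    have ne: "\<xi> i \<noteq> 1" for i using torus_ne(1)[OF \<xi> R_gt] .
    \<comment> \<open>The constant \<open>- 1\<close> in \<open>epsilon\<close> accounts for the
      factor \<open>?c\<close>, which the particle system contributes through the Poisson
      weights.\<close>
    have "(\<Sum>i = 1..N. epsilon p q (\<xi> i) * of_real t) =
        (\<Sum>i = 1..N. of_real t * (of_real p / \<xi> i + of_real (1 - p) * \<xi> i) - of_real t)"
      unfolding epsilon_def assms(4) by (intro sum.cong refl) (simp add: algebra_simps)
    also have "\<dots> = of_real t * energy \<xi> - of_nat N * of_real t"
      unfolding energy_def sum_subtractf sum_distrib_left[symmetric] by simp
    finally have eps: "(\<Sum>i = 1..N. epsilon p q (\<xi> i) * of_real t) = of_real t * energy \<xi> - of_nat N * of_real t" .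
    have exp: "(\<Prod>i = 1..N. exp (epsilon p q (\<xi> i) * of_real t)) = ?c * exp (of_real t * energy \<xi>)"
      unfolding exp_sum[OF finite_atLeastAtMost, symmetric] eps by (simp add: mult_exp_exp)
    have "A_mat N \<xi> \<sigma> \<pi> \<nu> * (\<Prod>i = 1..N. \<xi> (\<sigma> i) powi (X i - Y (\<sigma> i) - 1) * exp (epsilon p q (\<xi> i) * of_real t)) =
        ?c * (row_amp N \<xi> \<sigma> ?\<delta> \<nu> * plane_wave \<sigma> X \<xi> * exp (of_real t * energy \<xi>))"
      if "\<sigma> permutes {1..N}" for \<sigma>
      unfolding prod.distrib exp A_mat_row_amp[where \<xi> = \<xi>, OF ne that words(2,1)] plane_wave_def
      by (simp only: mult_ac)
    then show "?c * (wave X ?\<delta> \<xi> * exp (of_real t * energy \<xi>)) = (\<Sum>\<sigma> | \<sigma> permutes {1..N}. A_mat N \<xi> \<sigma> \<pi> \<nu> *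
      (\<Prod>i = 1..N. \<xi> (\<sigma> i) powi (X i - Y (\<sigma> i) - 1) * exp (epsilon p q (\<xi> i) * of_real t)))"
      unfolding wave_def sum_distrib_right sum_distrib_left by (intro sum.cong refl) auto
  qed
  finally show ?thesis .
qed

end
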